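(* Consider the two-dimensional setting described in the context ($\Omega \subset \mathbb{R}^2$, coefficients $\mu_t, \mu_s, p$, sets $\Omega_0$, $\Gamma_\pm$, $D$, and line segments $L_1, \dots, L_K$ with $K \ge 1$ and directions $\xi^{(j)}_\pm$). Suppose that the boundary data $I_0$, a function on $\Gamma_-$, is bounded and that it satisfies at least one of the following two conditions: 1. $I_0(x, \cdot)$ is continuous on $\Gamma_{-,x}$ for almost all $x \in \partial\Omega$; 2. $I_0(\cdot, \xi)$ is continuous on $\Gamma_{-,\xi}$ for almost all $\xi \in S^1$. Then there exists a unique solution $I$ to the boundary value problem with boundary data $I_0$. Moreover, $$\operatorname{disc}(I) \subset \operatorname{disc}_B \cup \operatorname{disc}_C,$$ where $$\operatorname{disc}_B := \{ (x_* + t\xi_*, \xi_* ) \mid (x_*, \xi_* ) \in \operatorname{disc}(I_0),\ 0 \leq t < \tau_+(x_*, \xi_* ) \}$$ and $$\operatorname{disc}_C := \bigcup_{j=1}^K \{ (x + t\xi^{(j)}_\pm, \xi^{(j)}_\pm) \mid x \in L_j,\ 0 \leq t < \tau_+(x, \xi^{(j)}_\pm) \},$$ both signs $\pm$ being included in the union.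
   Context: Domain. $\Omega \subset \mathbb{R}^2$ is a bounded convex domain with $C^1$ boundary, and $n(x)$ is the outer unit normal at $x \in \partial\Omega$. $S^1$ is the unit circle with Lebesgue measure $d\sigma$. Suppose $\overline{\Omega} = \bigcup_{j=1}^N \overline{\Omega_j}$, where $\Omega_1, \dots, \Omega_N$ are disjoint subdomains of $\Omega$ with piecewise $C^1$ boundaries, and put $\Omega_0 := \bigcup_{j=1}^N \Omega_j$. Line segments in the interfaces. It is assumed that $\partial\Omega_0 \setminus \partial\Omega$ contains at most a finite number of (open) line segments, denoted $L_1, \dots, L_K$, and only the case $K \ge 1$ is considered. (This assumption replaces the generalized convexity condition, i.e. the requirement that half lines $\{x - t\xi \mid t \ge 0\}$ meet $\partial\Omega_0$ in a uniformly bounded finite number of points, which is not assumed.) For $1 \le j \le K$, $\xi^{(j)}_+ \in S^1$ is a direction of $L_j$ (for any $x \in L_j$ there is $t>0$ with $x + t\xi^{(j)}_+ \in L_j$), and $\xi^{(j)}_- := -\xi^{(j)}_+$. Coefficients. $\mu_t$ and $\mu_s$ are nonnegative bounded functions with $\mu_t \ge \mu_s$ on $\Omega$, all of whose discontinuity points in $\Omega$ are contained in $\partial\Omega_0$ (so they are continuous on $\Omega_0$), and they are reset to $0$ on $\mathbb{R}^2 \setminus \Omega_0$. $p$ is a nonnegative bounded function on $\mathbb{R}^2 \times S^1 \times S^1$, continuous on $\Omega_0 \times S^1 \times S^1$, equal to $0$ on $(\mathbb{R}^2 \setminus \Omega_0) \times S^1 \times S^1$, and satisfying $\int_{S^1}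 p(x,\xi,\xi')\,d\sigma_{\xi'} = 1$ for all $(x,\xi) \in \Omega_0 \times S^1$. Notation. $\Gamma_\pm := \{(x,\xi) \in \partial\Omega \times S^1 \mid \pm n(x)\cdot\xi > 0\}$; $\Gamma_{-,\xi} := \{x \in \partial\Omega \mid n(x)\cdot\xi < 0\}$ for $\xi \in S^1$; $\Gamma_{-,x} := \{\xi \in S^1 \mid n(x)\cdot\xi<0\}$ for $x \in \partial\Omega$; $D := (\Omega \times S^1) \cup \Gamma_-$ and $\overline{D} := D \cup \Gamma_+$. For $(x,\xi) \in \overline{D}$, $\tau_\pm(x,\xi) := \inf\{t>0 \mid x \pm t\xi \notin \Omega\}$ and $P(x,\xi) := x - \tau_-(x,\xi)\xi$. For a function $f$, $\operatorname{disc}(f)$ denotes the set of all discontinuous points of $f$. Boundary value problem. The problem is the stationary transport equation $$\xi\cdot\nabla_x I(x,\xi) + \mu_t(x) I(x,\xi) = \mu_s(x)\int_{S^1} p(x,\xi,\xi') I(x,\xi')\,d\sigma_{\xi'}$$ in $\Omega\times S^1$ with $I = I_0$ on $\Gamma_-$. A solution is by definition a bounded measurable function $I$ on $D$ such that for all $(x,\xi) \in D$ $$I(x,\xi) = e^{-M_t(x,\xi;\tau_-(x,\xi))} I_0(P(x,\xi),\xi) + \int_0^{\tau_-(x,\xi)} \mu_s(x-s\xi)\, e^{-M_t(x,\xi;s)} \int_{S^1} p(x-s\xi,\xi,\xi') I(x-s\xi,\xi')\,d\sigma_{\xi'}\,ds,$$ where $M_t(x,\xi;s) := \int_0^s \m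u_t(x-r\xi)\,dr$.
   Formalization: Adds that I_0 is Borel measurable on Γ_- ("measurable" solution means Borel), and that every line meets the interface ∂Ω_0∖∂Ω outside L_1,…,L_K in a set of length zero; without these, existence or the inclusion for disc(I) can fail. *)

theory Defs
  imports "HOL-Analysis.Analysis"
begin

type_synonym plane = "real^2"

abbreviation S1 :: "plane set" where
  "S1 \<equiv> sphere 0 1"

definition circle_measure :: "plane measure" where
  "circle_measure =
     distr (restrict_space lborel {0..<2*pi}) (restrict_space borel S1)
       (\<lambda>\<theta>. vector [cos \<theta>, sin \<theta>])"

text \<open>Points of \<open>S\<close> at which \<open>f\<close>, regarded as a function on \<open>S\<close> only, is discontinuous.\<close>

definition disc :: "'a::t2_space set \<Rightarrow> ('a \<Rightarrow> real) \<Rightarrow> 'a set" where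
  "disc S f = {z \<in> S. \<not> continuous (at z within S) f}"

definition C1_arc :: "(real \<Rightarrow> plane) \<Rightarrow> bool" where
  "C1_arc \<gamma> \<longleftrightarrow> arc \<gamma> \<and> \<gamma> C1_differentiable_on {0..1}
     \<and> (\<forall>t\<in>{0..1}. vector_derivative \<gamma> (at t) \<noteq> 0)"

text \<open>A piecewise \<open>C\<^sup>1\<close> boundary is made up of finitely many regular \<open>C\<^sup>1\<close> arcs
  which meet at most at their end points.\<close>

definition piecewise_C1_boundary :: "plane set \<Rightarrow> bool" where
  "piecewise_C1_boundary U \<longleftrightarrow>
     (\<exists>A. finite A \<and> (\<forall>\<gamma>\<in>A. C1_arc \<gamma>) \<and> frontier U = (\<Union>\<gamma>\<in>A. path_image \<gamma>)
        \<and> (\<forall>\<gamma>\<in>A. \<forall>\<eta>\<in>A. \<gamma> \<noteq> \<eta> \<longrightarrow>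
             path_image \<gamma> \<inter> path_image \<eta> \<subseteq>
               {pathstart \<gamma>, pathfinish \<gamma>} \<inter> {pathstart \<eta>, pathfinish \<eta>}))"

text \<open>Sets of arc length zero on a \<open>C\<^sup>1\<close> curve \<open>C\<close>: null in every regular \<open>C\<^sup>1\<close>
  parametrization of a piece of \<open>C\<close>.\<close>

definition arc_length_null :: "plane set \<Rightarrow> plane set \<Rightarrow> bool" where
  "arc_length_null C Z \<longleftrightarrow>
     (\<forall>\<gamma>. C1_arc \<gamma> \<and> path_image \<gamma> \<subseteq> C \<longrightarrow> negligible {t \<in> {0..1}. \<gamma> t \<in> Z})"

text \<open>Near \<open>x\<close>, in the orthonormal frame \<open>(e\<^sub>1, e\<^sub>2)\<close>, the set \<open>U\<close> is the strict
  subgraph of the \<open>C\<^sup>1\<close> function \<open>\<phi>\<close>.\<close>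

definition C1_graph_at ::
  "plane set \<Rightarrow> plane \<Rightarrow> plane \<Rightarrow> plane \<Rightarrow> (real \<Rightarrow> real) \<Rightarrow> bool" where
  "C1_graph_at U x e1 e2 \<phi> \<longleftrightarrow>
     norm e1 = 1 \<and> norm e2 = 1 \<and> e1 \<bullet> e2 = 0 \<and> \<phi> C1_differentiable_on UNIV
     \<and> (\<exists>r>0. U \<inter> ball x r = {y \<in> ball x r. y \<bullet> e2 < \<phi> (y \<bullet> e1)})"

definition C1_boundary :: "plane set \<Rightarrow> bool" where
  "C1_boundary U \<longleftrightarrow> (\<forall>x\<in>frontier U. \<exists>e1 e2 \<phi>. C1_graph_at U x e1 e2 \<phi>)"

text \<open>The vector chosen below does not depend on the local graph representation.\<close>

definition outer_normal :: "plane set \<Rightarrow> plane \<Rightarrow> plane" where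
  "outer_normal U x =
     (SOME \<nu>. \<exists>e1 e2 \<phi>. C1_graph_at U x e1 e2 \<phi> \<and>
        \<nu> = sgn (e2 - deriv \<phi> (x \<bullet> e1) *\<^sub>R e1))"

definition Gamma_minus :: "plane set \<Rightarrow> (plane \<times> plane) set" where
  "Gamma_minus \<Omega> = {(x, \<xi>). x \<in> frontier \<Omega> \<and> \<xi> \<in> S1 \<and> outer_normal \<Omega> x \<bullet> \<xi> < 0}"

definition Gamma_minus_dir :: "plane set \<Rightarrow> plane \<Rightarrow> plane set" where
  "Gamma_minus_dir \<Omega> \<xi> = {x \<in> frontier \<Omega>. outer_normal \<Omega> x \<bullet> \<xi> < 0}"

definition Gamma_minus_pt :: "plane set \<Rightarrow> plane \<Rightarrow> plane set" where
  "Gamma_minus_pt \<Omega> x = {\<xi> \<in> S1. outer_normal \<Omega> x \<bullet> \<xi> < 0}"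

definition phase_dom :: "plane set \<Rightarrow> (plane \<times> plane) set" where
  "phase_dom \<Omega> = \<Omega> \<times> S1 \<union> Gamma_minus \<Omega>"

definition tau_plus :: "plane set \<Rightarrow> plane \<Rightarrow> plane \<Rightarrow> real" where
  "tau_plus \<Omega> x \<xi> = Inf {t. 0 < t \<and> x + t *\<^sub>R \<xi> \<notin> \<Omega>}"

definition tau_minus :: "plane set \<Rightarrow> plane \<Rightarrow> plane \<Rightarrow> real" where
  "tau_minus \<Omega> x \<xi> = Inf {t. 0 < t \<and> x - t *\<^sub>R \<xi> \<notin> \<Omega>}"

definition entry_pt :: "plane set \<Rightarrow> plane \<Rightarrow> plane \<Rightarrow> plane" where
  "entry_pt \<Omega> x \<xi> = x - tau_minus \<Omega> x \<xi> *\<^sub>R \<xi>"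

definition optical_depth :: "(plane \<Rightarrow> real) \<Rightarrow> plane \<Rightarrow> plane \<Rightarrow> real \<Rightarrow> real" where
  "optical_depth \<mu>t x \<xi> s = (LINT r:{0..s}|lborel. \<mu>t (x - r *\<^sub>R \<xi>))"

text \<open>Only the values of \<open>I\<close> on \<open>phase_dom \<Omega>\<close> matter: for \<open>s\<close> strictly between \<open>0\<close> and
  \<open>tau_minus \<Omega> x \<xi>\<close> the point \<open>x - s \<xi>\<close> lies in \<open>\<Omega>\<close>. ``Measurable'' is Borel
  measurable, so that all the angular sections of \<open>I\<close> are measurable.\<close>

definition transport_solution ::
  "plane set \<Rightarrow> (plane \<Rightarrow> real) \<Rightarrow> (plane \<Rightarrow> real) \<Rightarrow> (plane \<times> plane \<times> plane \<Rightarrow> real)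
   \<Rightarrow> (plane \<times> plane \<Rightarrow> real) \<Rightarrow> (plane \<times> plane \<Rightarrow> real) \<Rightarrow> bool" where
  "transport_solution \<Omega> \<mu>t \<mu>s p I0 I \<longleftrightarrow>
     bounded (I ` phase_dom \<Omega>) \<and>
     I \<in> borel_measurable (restrict_space borel (phase_dom \<Omega>)) \<and>
     (\<forall>(x, \<xi>) \<in> phase_dom \<Omega>.
        I (x, \<xi>) =
          exp (- optical_depth \<mu>t x \<xi> (tau_minus \<Omega> x \<xi>)) * I0 (entry_pt \<Omega> x \<xi>, \<xi>)
          + (LINT s:{0..tau_minus \<Omega> x \<xi>}|lborel.
               \<mu>s (x - s *\<^sub>R \<xi>) * exp (- optical_depth \<mu>t x \<xi> s) *
               (LINT \<xi>'|circle_measure. p (x - s *\<^sub>R \<xi>, \<xi>, \<xi>') * I (x - s *\<^sub>R \<xi>, \<xi>'))))"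

definition is_open_line_segment :: "plane set \<Rightarrow> bool" where
  "is_open_line_segment S \<longleftrightarrow> (\<exists>a b. a \<noteq> b \<and> S = open_segment a b)"

text \<open>\<open>L\<^sub>1, \<dots>, L\<^sub>K\<close> are the line segments in the interface \<open>F\<close>. The last conjunct
  makes explicit that \<open>F\<close> shares a set of positive length with a line only along
  these segments. It does not follow from the other conjuncts: a \<open>C\<^sup>1\<close> curve that contains no
  segment can meet a line in a Cantor set of positive length, and the optical depth is then
  in general discontinuous along that line.\<close>

definition interface_segments :: "plane set \<Rightarrow> nat \<Rightarrow> (nat \<Rightarrow> plane set) \<Rightarrow> bool" where
  "interface_segments F K L \<longleftrightarrow>
     (\<forall>j\<in>{1..K}. is_open_line_segment (L j) \<and> L j \<subseteq> F) \<and>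
     (\<forall>S. is_open_line_segment S \<and> S \<subseteq> F \<longrightarrow> (\<exists>j\<in>{1..K}. S \<subseteq> L j)) \<and>
     (\<forall>x. \<forall>\<xi>\<in>S1. negligible {t. x + t *\<^sub>R \<xi> \<in> F - (\<Union>j\<in>{1..K}. L j)})"

definition disc_B :: "plane set \<Rightarrow> (plane \<times> plane \<Rightarrow> real) \<Rightarrow> (plane \<times> plane) set" where
  "disc_B \<Omega> I0 =
     {(x + t *\<^sub>R \<xi>, \<xi>) | x \<xi> t.
        (x, \<xi>) \<in> disc (Gamma_minus \<Omega>) I0 \<and> 0 \<le> t \<and> t < tau_plus \<Omega> x \<xi>}"

definition disc_C ::
  "plane set \<Rightarrow> nat \<Rightarrow> (nat \<Rightarrow> plane set) \<Rightarrow> (nat \<Rightarrow> plane) \<Rightarrow> (plane \<times> plane) set" where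
  "disc_C \<Omega> K L \<xi>p =
     (\<Union>j\<in>{1..K}. \<Union>\<xi>\<in>{\<xi>p j, - \<xi>p j}.
        {(x + t *\<^sub>R \<xi>, \<xi>) | x t. x \<in> L j \<and> 0 \<le> t \<and> t < tau_plus \<Omega> x \<xi>})"

end

theory Submission
  imports Defs
begin

text \<open>Write \<open>J = \<integral> p I d\<sigma>\<close> for the in-scattered radiation. The transport equation says
  \<open>I = b + S J\<close>, where \<open>b\<close> is the attenuated boundary value and \<open>S\<close> integrates along rays, and hence
  \<open>J\<close> is a fixed point of \<open>J \<mapsto> \<integral> p (b + S J) d\<sigma>\<close>. Since
  \<open>\<integral> \<mu>\<^sub>s exp (- M) \<le> \<integral> \<mu>\<^sub>t exp (- M) = 1 - exp (- M)\<close> along a ray, this map is a contraction in the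
  supremum norm. It preserves continuity on \<open>\<Omega>\<^sub>0 \<times> S\<^sup>1\<close>: off \<open>disc_C\<close>, almost every point of a ray lies
  off the interface, so \<open>S J\<close> is continuous there by dominated convergence, and for fixed \<open>x\<close> only finitely
  many directions are exceptional. The term \<open>\<integral> p b d\<sigma>\<close> is continuous by dominated convergence over
  directions under condition 2, and over boundary points, after substituting the entry point for the
  direction, under condition 1. So the fixed point \<open>J\<close> is continuous on \<open>\<Omega>\<^sub>0 \<times> S\<^sup>1\<close>, and \<open>I = b + S J\<close> can
  only be discontinuous on \<open>disc_B\<close>, through \<open>b\<close>, and on \<open>disc_C\<close>.\<close>

section \<open>Angles, the circle measure and attenuation\<close>

text \<open>The unknown is \<open>J\<close> rather than \<open>I\<close> because averaging over
  directions smooths: jumps of the boundary data travel along whole rays in \<open>I\<close>,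
  whereas \<open>J\<close> sees them only through an integral. Continuity of \<open>J\<close> is
  asked on \<open>\<Omega>0 \<times> S1\<close> only, where the coefficients are continuous; what
  happens on the interface is invisible to a ray integral as long as the ray meets the interface in
  a null set of parameters. Since \<open>\<mu>t\<close> and \<open>\<mu>s\<close> vanish off
  \<open>\<Omega>0\<close>, all ray integrals can be extended to the fixed length
  \<open>diam\<close>. This removes the moving upper limit from the dominated convergence arguments
  and gives the uniform contraction constant \<open>q = 1 - exp (- (B * diam)) < 1\<close>.
  Condition 1 is the harder one: for a fixed direction the entry point moves with \<open>y\<close>,
  and nothing is known about \<open>I0\<close> under such a motion. If the boundary point is held
  fixed instead, it is the direction that moves. The price is the Jacobian of the map from boundary
  points to directions, which stays bounded because \<open>y\<close> keeps a positive distance from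
  the boundary.\<close>

definition circ :: "real \<Rightarrow> plane" where
  "circ \<theta> = vector [cos \<theta>, sin \<theta>]"

text \<open>\<open>Arg2pi\<close> takes its values in [0, 2 pi), so \<open>angle\<close> inverts
  \<open>circ\<close> on the half-open interval that carries \<open>circle_measure\<close>. Away
  from the origin its only jump is across the ray in direction \<open>circ 0\<close>.\<close>

definition angle :: "plane \<Rightarrow> real" where
  "angle v = Arg2pi (Complex (v $ 1) (v $ 2))"

text \<open>The determinant of the pair. Divided by the squared norm of \<open>v\<close>, it is the
  angular speed about the origin of a point at \<open>v\<close> with velocity
  \<open>w\<close>.\<close>

definition cross2 :: "plane \<Rightarrow> plane \<Rightarrow> real" where
  "cross2 v w = v $ 1 * w $ 2 - v $ 2 * w $ 1"

lemma norm_plane: "norm (v :: plane) = cmod (Complex (v $ 1) (v $ 2))"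
  by (simp add: norm_vec_def L2_set_def sum_2 cmod_def)

lemma norm_circ [simp]: "norm (circ \<theta>) = 1"
  by (simp add: norm_plane circ_def cmod_def)

lemma continuous_on_circ [continuous_intros]:
  fixes f :: "'a::t2_space \<Rightarrow> real"
  assumes "continuous_on A f"
  shows "continuous_on A (\<lambda>x. circ (f x))"
proof -
  have "continuous_on A (\<lambda>x. circ (f x) $ i)" for i
  proof -
    show ?thesis
      using continuous_on_cos[OF assms] continuous_on_sin[OF assms] exhaust_2[of i] by (auto simp: circ_def)
  qed
  then have "continuous_on A (\<lambda>x. (\<chi> i. circ (f x) $ i))"
    by (rule continuous_on_vec_lambda)
  then show ?thesis by simp
qed

lemma angle_circ:
  assumes "0 \<le> \<theta>" "\<theta> < 2 * pi"
  shows "angle (circ \<theta>) = \<theta>"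
proof -
  have "Complex (cos \<theta>) (sin \<theta>) = cis \<theta>"
    by (simp add: complex_eq_iff)
  then show ?thesis
    unfolding angle_def using assms
    by (intro Arg2pi_unique[of 1]) (auto simp: circ_def cis_conv_exp)
qed

lemma angle_range: "0 \<le> angle v" "angle v < 2 * pi"
  using Arg2pi[of "Complex (v $ 1) (v $ 2)"] by (auto simp: angle_def)

lemma inj_on_circ: "inj_on circ {0..<2*pi}"
  by (rule inj_on_inverseI[of _ angle]) (simp add: angle_circ)

lemma circ_angle:
  assumes "v \<noteq> 0"
  shows "circ (angle v) = sgn v"
proof -
  have "norm v * cos (angle v) = v $ 1" "norm v * sin (angle v) = v $ 2"
    using cos_Arg2pi[of "Complex (v $ 1) (v $ 2)"] sin_Arg2pi[of "Complex (v $ 1) (v $ 2)"]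
    by (simp_all add: angle_def norm_plane)
  then show ?thesis using assms
    by (auto simp: vec_eq_iff forall_2 circ_def sgn_div_norm field_simps)
qed

text \<open>Positivity of \<open>angle\<close> singles out the points off the branch cut, which is
  the region where \<open>angle\<close> is differentiable.\<close>

lemma angle_pos_iff: "0 < angle v \<longleftrightarrow> v \<noteq> 0 \<and> sgn v \<noteq> circ 0"
proof (cases "v = 0")
  case True
  have "angle 0 = 0" by (simp add: angle_def zero_complex.code[symmetric])
  with True show ?thesis by simp
next
  case False
  then have "sgn v = circ 0 \<longleftrightarrow> angle v = 0"
    using circ_angle[OF False] angle_circ[of 0] angle_circ[of "angle v"] angle_range[of v] by auto
  with False angle_range(1)[of v] show ?thesis by auto
qed

text \<open>Off the nonnegative real axis the argument of z in (0, 2 pi) is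
  \<open>Im (Ln (- z)) + pi\<close>, and the cut of \<open>Ln\<close> at \<open>- z\<close> is
  exactly the axis excluded by \<open>pos\<close>. The derivative is therefore the imaginary part of
  v'/v.\<close>

lemma has_derivative_angle:
  assumes v: "(v has_vector_derivative v') (at t within S)" and "t \<in> S"
    and pos: "\<And>s. s \<in> S \<Longrightarrow> 0 < angle (v s)"
  shows "((\<lambda>s. angle (v s)) has_field_derivative cross2 (v t) v' / (norm (v t))\<^sup>2) (at t within S)"
proof -
  define L :: "plane \<Rightarrow> complex" where "L = (\<lambda>v. Complex (v $ 1) (v $ 2))"
  have "linear L"
    by (rule linearI) (auto simp: L_def complex_eq_iff)
  then have "bounded_linear L" by (simp add: linear_conv_bounded_linear)
  then have 1: "((\<lambda>s. L (- v s)) has_vector_derivative L (- v')) (at t within S)"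
    by (rule bounded_linear.has_vector_derivative) (intro has_vector_derivative_minus v)
  have nz: "L (- v t) \<notin> \<real>\<^sub>\<le>\<^sub>0"
  proof
    assume "L (- v t) \<in> \<real>\<^sub>\<le>\<^sub>0"
    then have "angle (v t) = 0"
      by (auto simp: angle_def Arg2pi_eq_0 L_def complex_nonpos_Reals_iff complex_is_Real_iff)
    with pos[OF \<open>t \<in> S\<close>] show False by simp
  qed
  have "(Ln \<circ> (\<lambda>s. L (- v s)) has_vector_derivative L (- v') * inverse (L (- v t))) (at t within S)"
    by (rule field_vector_diff_chain_within[OF 1]) (rule has_field_derivative_Ln[THEN has_field_derivative_at_within], rule nz)
  then have "((\<lambda>s. Im (Ln (L (- v s)))) has_vector_derivative Im (L (- v') * inverse (L (- v t)))) (at t within S)"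
    unfolding comp_def by (rule bounded_linear.has_vector_derivative[OF bounded_linear_Im])
  then have "((\<lambda>s. Im (Ln (L (- v s))) + pi) has_vector_derivative Im (L (- v') * inverse (L (- v t)))) (at t within S)"
    by (auto intro!: derivative_eq_intros)
  moreover have "Im (L (- v') * inverse (L (- v t))) = cross2 (v t) v' / (norm (v t))\<^sup>2"
    by (simp add: L_def cross2_def norm_plane cmod_power2 Im_divide flip: divide_inverse)
  ultimately have "((\<lambda>s. Im (Ln (L (- v s))) + pi) has_field_derivative cross2 (v t) v' / (norm (v t))\<^sup>2) (at t within S)"
    by (simp add: has_real_derivative_iff_has_vector_derivative)
  then show ?thesis
  proof (rule has_field_derivative_transform_within[of _ _ _ _ 1])
    fix s assume "s \<in> S"
    have "L (- v s) = - L (v s)" by (simp add: L_def complex_eq_iff)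
    then show "Im (Ln (L (- v s))) + pi = angle (v s)"
      using Arg2pi_Ln[of "L (v s)"] pos[OF \<open>s \<in> S\<close>] by (simp add: angle_def L_def)
  qed (use \<open>t \<in> S\<close> in auto)
qed

section \<open>Integration over directions by means of the angle\<close>

lemma space_circle [simp]: "space circle_measure = S1"
  and sets_circle [measurable_cong]: "sets circle_measure = sets (restrict_space borel S1)"
  by (simp_all add: circle_measure_def space_restrict_space)

lemma circle_measure_circ:
  "circle_measure = distr (restrict_space lborel {0..<2*pi}) (restrict_space borel S1) circ"
  by (simp add: circle_measure_def circ_def[abs_def])

lemma circ_borel [measurable]: "circ \<in> borel_measurable borel"
  by (intro borel_measurable_continuous_onI continuous_intros)

lemma circ_measurable:
  "circ \<in> measurable (restrict_space lborel {0..<2*pi}) (restrict_space borel S1)"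
  by (intro measurable_restrict_space2 measurable_restrict_space1) auto

lemma finite_measure_circle: "finite_measure circle_measure"
  unfolding circle_measure_circ
proof (rule finite_measure.finite_measure_distr[OF _ circ_measurable])
  show "finite_measure (restrict_space lborel {0..<2*pi})"
    by (rule finite_measureI) (simp add: emeasure_restrict_space space_restrict_space)
qed

lemma integral_circle:
  fixes f :: "plane \<Rightarrow> real"
  assumes "f \<in> borel_measurable (restrict_space borel S1)"
  shows "(LINT \<xi>|circle_measure. f \<xi>) = (LINT \<theta>:{0..<2*pi}|lborel. f (circ \<theta>))"
  unfolding circle_measure_circ
  by (subst integral_distr[OF circ_measurable assms])
     (simp add: integral_restrict_space set_lebesgue_integral_def)

text \<open>Since \<open>circ\<close> is injective on [0, 2 pi), a finite set of directions comes
  from finitely many angles. This is how the finitely many directions of interface segments are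
  discarded.\<close>

lemma AE_circle_not_in_finite:
  assumes "finite A"
  shows "AE \<xi> in circle_measure. \<xi> \<notin> A"
proof -
  have fin: "finite {\<theta> \<in> {0..<2*pi}. circ \<theta> \<in> A}"
  proof (rule finite_subset)
    show "{\<theta> \<in> {0..<2*pi}. circ \<theta> \<in> A} \<subseteq> angle ` A"
      using angle_circ by force
  qed (use assms in auto)
  have "AE \<theta> in lborel. \<theta> \<notin> {\<theta> \<in> {0..<2*pi}. circ \<theta> \<in> A}"
    by (intro AE_not_in countable_imp_null_set_lborel countable_finite fin)
  then have "AE \<theta> in restrict_space lborel {0..<2*pi}. circ \<theta> \<notin> A"
    by (subst AE_restrict_space_iff) auto
  moreover have "{\<xi> \<in> space (restrict_space borel S1). \<xi> \<notin> A} \<in> sets (restrict_space borel S1)"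
  proof -
    have "{\<xi> \<in> space (restrict_space borel S1). \<xi> \<notin> A} = (- A) \<inter> S1"
      by (auto simp: space_restrict_space)
    moreover have "- A \<in> sets borel" using assms by (simp add: finite_imp_closed)
    ultimately show ?thesis by (auto simp: sets_restrict_space)
  qed
  ultimately show ?thesis
    unfolding circle_measure_circ by (subst AE_distr_iff[OF circ_measurable])
qed

text \<open>Dividing the increment bound by the distance shows that the derivative within the
  interval vanishes at every point. It serves where an integrand is only measurable, so that its
  integral cannot be differentiated at every point.\<close>

lemma quadratic_increments_const:
  fixes f :: "real \<Rightarrow> real"
  assumes "\<And>s t. 0 \<le> s \<Longrightarrow> s \<le> t \<Longrightarrow> t \<le> T \<Longrightarrow> \<bar>f t - f s\<bar> \<le> C * (t - s)\<^sup>2" and "0 \<le> T"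
  shows "f T = f 0"
proof -
  have bound: "\<bar>f y - f x\<bar> \<le> C * (y - x)\<^sup>2" if "x \<in> {0..T}" "y \<in> {0..T}" for x y
    using assms(1)[of x y] assms(1)[of y x] that
    by (cases "x \<le> y") (auto simp: abs_minus_commute power2_commute)
  have "(f has_derivative (\<lambda>h. 0)) (at x within {0..T})" if x: "x \<in> {0..T}" for x
  proof (rule has_derivativeI_sandwich[of 1])
    fix y assume "y \<in> {0..T}" "y \<noteq> x"
    then show "norm (f y - f x - 0) / norm (y - x) \<le> C * \<bar>y - x\<bar>"
      using bound[OF x, of y] by (simp add: divide_simps power2_eq_square mult.assoc flip: abs_mult)
  next
    have "((\<lambda>y. C * \<bar>y - x\<bar>) \<longlongrightarrow> C * \<bar>x - x\<bar>) (at x within {0..T})"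
      by (intro tendsto_intros)
    then show "((\<lambda>y. C * \<bar>y - x\<bar>) \<longlongrightarrow> 0) (at x within {0..T})" by simp
  qed auto
  then have "\<exists>c. \<forall>x\<in>{0..T}. f x = c"
    by (intro has_derivative_zero_constant) auto
  with \<open>0 \<le> T\<close> show ?thesis by auto
qed

text \<open>Both estimates come from \<open>1 + u \<le> exp u\<close>, taken at
  \<open>u = y - x\<close> and at \<open>u = x - y\<close>; no order between \<open>x\<close> and
  \<open>y\<close> is involved.\<close>

lemma exp_neg_mean_value:
  fixes x y :: real
  shows "exp (- y) * (y - x) \<le> exp (- x) - exp (- y)" "exp (- x) - exp (- y) \<le> exp (- x) * (y - x)"
proof -
  have "exp (- y) * (1 + (y - x)) \<le> exp (- y) * exp (y - x)"
    using exp_ge_add_one_self[of "y - x"] by (intro mult_left_mono) auto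
  then show "exp (- y) * (y - x) \<le> exp (- x) - exp (- y)"
    by (simp add: algebra_simps flip: exp_add)
  have "exp (- x) * (1 + (x - y)) \<le> exp (- x) * exp (x - y)"
    using exp_ge_add_one_self[of "x - y"] by (intro mult_left_mono) auto
  then show "exp (- x) - exp (- y) \<le> exp (- x) * (y - x)"
    by (simp add: algebra_simps flip: exp_add)
qed

lemma set_integrable_bounded_Icc:
  fixes f :: "real \<Rightarrow> real"
  assumes [measurable]: "f \<in> borel_measurable borel" and "\<And>x. x \<in> {s..t} \<Longrightarrow> \<bar>f x\<bar> \<le> C"
  shows "set_integrable lborel {s..t} f"
  unfolding set_integrable_def
proof (rule Bochner_Integration.integrable_bound[of _ "\<lambda>x. C * indicator {s..t} x"])
  show "integrable lborel (\<lambda>x. C * indicator {s..t} x)"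
    by (intro integrable_mult_right integrable_real_indicator) (auto simp: emeasure_lborel_Icc_eq)
  show "AE x in lborel. norm (indicat_real {s..t} x *\<^sub>R f x) \<le> norm (C * indicat_real {s..t} x)"
    by (rule AE_I2) (use assms(2) in \<open>fastforce simp: indicator_def\<close>)
qed auto

text \<open>The difference of the two sides, as a function of \<open>T\<close>, has increments bounded by the square
  of the increment of \<open>T\<close>, so it is constant.\<close>

lemma integral_attenuation:
  fixes a :: "real \<Rightarrow> real"
  assumes [measurable]: "a \<in> borel_measurable borel" and a: "\<And>s. 0 \<le> a s" "\<And>s. a s \<le> B" and "0 \<le> T"
  shows "(LINT s:{0..T}|lborel. a s * exp (- (LINT r:{0..s}|lborel. a r)))
           = 1 - exp (- (LINT r:{0..T}|lborel. a r))"
proof -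
  have "0 \<le> B" using a[of 0] by linarith
  define G where "G = (\<lambda>s. LINT r:{0..s}|lborel. a r)"
  define h where "h = (\<lambda>s. a s * exp (- G s))"
  have [measurable]: "G \<in> borel_measurable borel"
    unfolding G_def set_lebesgue_integral_def indicator_def atLeastAtMost_iff by measurable
  have G_nonneg: "0 \<le> G s" for s
    unfolding G_def set_lebesgue_integral_def
    by (intro Bochner_Integration.integral_nonneg) (auto simp: a)
  have int_a: "set_integrable lborel {s..t} a" for s t
    by (rule set_integrable_bounded_Icc[where C = B]) (use a in auto)
  have int_h: "set_integrable lborel {s..t} h" for s t
  proof (rule set_integrable_bounded_Icc[where C = B])
    fix x 
    have "\<bar>h x\<bar> = a x * exp (- G x)" using a(1)[of x] by (simp add: h_def abs_mult)
    also have "\<dots> \<le> B * 1" using a[of x] G_nonneg[of x] by (intro mult_mono) auto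
    finally show "\<bar>h x\<bar> \<le> B" by simp
  qed (simp add: h_def)
  have G: "G s = integral {0..s} a" for s
    unfolding G_def by (rule set_borel_integral_eq_integral(2)[OF int_a])
  define H where "H = (\<lambda>s. integral {0..s} h + exp (- G s))"
  have "\<bar>H t - H s\<bar> \<le> B\<^sup>2 * (t - s)\<^sup>2" if st: "0 \<le> s" "s \<le> t" for s t
  proof -
    note ia = set_borel_integral_eq_integral(1)[OF int_a]
    note ih = set_borel_integral_eq_integral(1)[OF int_h]
    define \<Delta> where "\<Delta> = integral {s..t} a"
    have \<Delta>: "G t - G s = \<Delta>"
      unfolding G \<Delta>_def using Henstock_Kurzweil_Integration.integral_combine[OF st ia] by simp
    have \<Delta>0: "0 \<le> \<Delta>" unfolding \<Delta>_def by (rule integral_nonneg[OF ia]) (use a in auto)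
    have "\<Delta> \<le> integral {s..t} (\<lambda>_. B)" unfolding \<Delta>_def
      by (rule integral_le[OF ia]) (use a in auto)
    then have \<Delta>1: "\<Delta> \<le> B * (t - s)" using st by (simp add: mult.commute)
    have mono: "G x \<le> G y" if "0 \<le> x" "x \<le> y" for x y
      using Henstock_Kurzweil_Integration.integral_combine[OF that ia]
        integral_nonneg[OF ia, of x y] a(1) unfolding G by force
    have "integral {s..t} h \<le> integral {s..t} (\<lambda>u. exp (- G s) * a u)"
      by (rule integral_le[OF ih]) (use ia a mono st in \<open>auto simp: h_def mult.commute intro!: mult_left_mono mult_right_mono\<close>)
    then have hu: "integral {s..t} h \<le> exp (- G s) * \<Delta>" by (simp add: \<Delta>_def)
    have "integral {s..t} (\<lambda>u. exp (- G t) * a u) \<le> integral {s..t} h"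
      by (rule integral_le[OF _ ih]) (use ia a mono st in \<open>auto simp: h_def mult.commute intro!: mult_left_mono mult_right_mono\<close>)
    then have hl: "exp (- G t) * \<Delta> \<le> integral {s..t} h" by (simp add: \<Delta>_def)
    have "H t - H s = integral {s..t} h - (exp (- G s) - exp (- G t))"
      unfolding H_def using Henstock_Kurzweil_Integration.integral_combine[OF st ih] by simp
    moreover have "exp (- G t) * \<Delta> \<le> exp (- G s) - exp (- G t)" "exp (- G s) - exp (- G t) \<le> exp (- G s) * \<Delta>"
      using exp_neg_mean_value(1)[of "G t" "G s"] exp_neg_mean_value(2)[of "G s" "G t"] by (simp_all add: \<Delta>)
    \<comment> \<open>The integral of \<open>h\<close> over the subinterval and the drop of the
      exponential both lie between \<open>exp (- G t) * \<Delta>\<close> and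
      \<open>exp (- G s) * \<Delta>\<close>. Their distance is at most the length of that range,
      which is itself of second order in \<open>t - s\<close>.\<close>
    ultimately have "\<bar>H t - H s\<bar> \<le> (exp (- G s) - exp (- G t)) * \<Delta>"
      using hl hu by (simp add: algebra_simps abs_le_iff)
    also have "\<dots> \<le> \<Delta> * \<Delta>"
    proof (rule mult_right_mono[OF _ \<Delta>0])
      have "exp (- G s) * \<Delta> \<le> 1 * \<Delta>" by (rule mult_right_mono[OF _ \<Delta>0]) (simp add: G_nonneg)
      then show "exp (- G s) - exp (- G t) \<le> \<Delta>"
        using exp_neg_mean_value(2)[of "G s" "G t"] by (simp add: \<Delta>)
    qed
    also have "\<dots> \<le> (B * (t - s)) * (B * (t - s))"
      by (intro mult_mono) (use \<Delta>0 \<Delta>1 in auto)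
    finally show ?thesis by (simp add: power2_eq_square mult_ac)
  qed
  then have "H T = H 0"
    by (intro quadratic_increments_const[of T H "B\<^sup>2"]) (use \<open>0 \<le> T\<close> in auto)
  then have "integral {0..T} h = 1 - exp (- G T)"
    by (simp add: H_def G)
  moreover have "(LINT s:{0..T}|lborel. h s) = integral {0..T} h"
    by (rule set_borel_integral_eq_integral(2)[OF int_h])
  ultimately show ?thesis by (simp add: h_def G_def)
qed

section \<open>Rays in a convex domain with regular boundary\<close>

text \<open>A point of the ball above the graph has a neighbourhood that misses \<open>U\<close>, so
  the frontier cannot lie there. A point on the graph is the limit of points just below it, reached
  by moving in direction \<open>- e2\<close>.\<close>

lemma frontier_C1_graph:
  assumes "open U" "C1_graph_at U x e1 e2 \<phi>"
  obtains r where "r > 0" "\<And>y. y \<in> ball x r \<Longrightarrow> y \<in> U \<longleftrightarrow> y \<bullet> e2 < \<phi> (y \<bullet> e1)"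
    "\<And>y. y \<in> ball x r \<Longrightarrow> y \<in> frontier U \<longleftrightarrow> y \<bullet> e2 = \<phi> (y \<bullet> e1)"
proof -
  obtain r where "r > 0" and *: "U \<inter> ball x r = {y \<in> ball x r. y \<bullet> e2 < \<phi> (y \<bullet> e1)}"
    using assms(2) unfolding C1_graph_at_def by blast
  then have r: "r > 0" "\<And>y. y \<in> ball x r \<Longrightarrow> y \<in> U \<longleftrightarrow> y \<bullet> e2 < \<phi> (y \<bullet> e1)"
    by blast+
  have e: "norm e2 = 1" "e1 \<bullet> e2 = 0" "\<phi> C1_differentiable_on UNIV"
    using assms(2) by (auto simp: C1_graph_at_def)
  have cont: "continuous_on UNIV (\<lambda>y. \<phi> (y \<bullet> e1))"
    by (rule continuous_on_compose2[OF C1_differentiable_imp_continuous_on[OF e(3)]]) (auto intro: continuous_intros)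
  have "y \<bullet> e2 = \<phi> (y \<bullet> e1)" if y: "y \<in> frontier U" "y \<in> ball x r" for y
  proof (rule antisym)
    have "y \<notin> U" using y \<open>open U\<close> by (auto simp: frontier_def interior_open)
    with r(2)[OF y(2)] show "\<phi> (y \<bullet> e1) \<le> y \<bullet> e2" by simp
    show "y \<bullet> e2 \<le> \<phi> (y \<bullet> e1)"
    proof (rule ccontr)
      assume above: "\<not> y \<bullet> e2 \<le> \<phi> (y \<bullet> e1)"
      define V where "V = {y. \<phi> (y \<bullet> e1) < y \<bullet> e2} \<inter> ball x r"
      have "open V" unfolding V_def
        by (intro open_Int open_Collect_less cont continuous_intros) auto
      moreover have "y \<in> V" using y above by (auto simp: V_def)
      moreover have "V \<inter> U = {}"
      proof -
        have "w \<notin> U" if "w \<in> V" for w using that r(2)[of w] by (simp add: V_def)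
        then show ?thesis by blast
      qed
      ultimately show False using y(1)
        using open_Int_closure_eq_empty[of V U] by (auto simp: frontier_def)
    qed
  qed
  moreover have "y \<in> frontier U" if y: "y \<in> ball x r" "y \<bullet> e2 = \<phi> (y \<bullet> e1)" for y
  proof -
    have "y \<notin> U" using y r(2)[OF y(1)] by simp
    moreover have "y \<in> closure U"
    proof (rule Lim_in_closed_set)
      have "((\<lambda>s. y - s *\<^sub>R e2) \<longlongrightarrow> y - 0 *\<^sub>R e2) (at_right 0)" by (intro tendsto_intros)
      then show *: "((\<lambda>s. y - s *\<^sub>R e2) \<longlongrightarrow> y) (at_right 0)" by simp
      have "eventually (\<lambda>s. y - s *\<^sub>R e2 \<in> ball x r) (at_right 0)"
        using topological_tendstoD[OF * _ y(1)] by simp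
      then show "eventually (\<lambda>s. y - s *\<^sub>R e2 \<in> closure U) (at_right 0)"
        using eventually_at_right_less[of 0]
      proof eventually_elim
        case (elim s)
        have "(y - s *\<^sub>R e2) \<bullet> e2 < \<phi> ((y - s *\<^sub>R e2) \<bullet> e1)"
          using elim(2) y e
          by (simp add: inner_diff_left inner_commute[of e2 e1] power2_norm_eq_inner[symmetric])
        with r(2)[OF elim(1)] have "y - s *\<^sub>R e2 \<in> U" by simp
        then show ?case using closure_subset by auto
      qed
    qed auto
    ultimately show ?thesis using \<open>open U\<close> by (auto simp: frontier_def interior_open)
  qed
  ultimately have "\<And>y. y \<in> ball x r \<Longrightarrow> y \<in> frontier U \<longleftrightarrow> y \<bullet> e2 = \<phi> (y \<bullet> e1)" by blast
  with r that show ?thesis by blast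
qed

locale convex_C1_domain =
  fixes \<Omega> :: "plane set"
  assumes open_domain: "open \<Omega>" and bounded_domain: "bounded \<Omega>"
    and convex_domain: "convex \<Omega>" and C1_domain: "C1_boundary \<Omega>"
begin

abbreviation "D \<equiv> phase_dom \<Omega>"

abbreviation "\<tau> \<equiv> tau_minus \<Omega>"

abbreviation "P \<equiv> entry_pt \<Omega>"

lemma not_in_frontier: "x \<in> \<Omega> \<Longrightarrow> x \<notin> frontier \<Omega>"
  using open_domain by (auto simp: frontier_def interior_open)

lemma frontier_iff: "x \<in> frontier \<Omega> \<longleftrightarrow> x \<in> closure \<Omega> \<and> x \<notin> \<Omega>"
  using open_domain by (auto simp: frontier_def interior_open)

text \<open>The normal is picked by a choice operator. All that is used about it is that some local
  graph realizes the chosen vector.\<close>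

lemma outer_normal_graph:
  assumes "x \<in> frontier \<Omega>"
  obtains e1 e2 \<phi> where "C1_graph_at \<Omega> x e1 e2 \<phi>"
    "outer_normal \<Omega> x = sgn (e2 - deriv \<phi> (x \<bullet> e1) *\<^sub>R e1)"
proof -
  have "\<exists>\<nu> e1 e2 \<phi>. C1_graph_at \<Omega> x e1 e2 \<phi> \<and> \<nu> = sgn (e2 - deriv \<phi> (x \<bullet> e1) *\<^sub>R e1)"
    using C1_domain assms by (auto simp: C1_boundary_def)
  from someI_ex[OF this] show ?thesis
    using that unfolding outer_normal_def by blast
qed

lemma outer_normal_nonzero:
  assumes "x \<in> frontier \<Omega>"
  shows "outer_normal \<Omega> x \<noteq> 0"
proof
  assume 0: "outer_normal \<Omega> x = 0"
  obtain e1 e2 \<phi> where *: "C1_graph_at \<Omega> x e1 e2 \<phi>"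
    "outer_normal \<Omega> x = sgn (e2 - deriv \<phi> (x \<bullet> e1) *\<^sub>R e1)"
    using outer_normal_graph[OF assms] .
  then have "(e2 - deriv \<phi> (x \<bullet> e1) *\<^sub>R e1) \<bullet> e2 = 0"
    using 0 by (simp add: sgn_zero_iff)
  moreover have "e2 \<bullet> e2 = 1" "e1 \<bullet> e2 = 0"
    using *(1) by (auto simp: C1_graph_at_def power2_norm_eq_inner[symmetric])
  ultimately show False by (simp add: inner_diff_left)
qed

text \<open>Along the ray the height over the graph starts at 0 and has as derivative a positive
  multiple of the normal component of \<open>\<xi>\<close>. A negative derivative puts the ray
  strictly below the graph for small positive times.\<close>

lemma inward_direction_enters:
  assumes x: "x \<in> frontier \<Omega>" and \<xi>: "outer_normal \<Omega> x \<bullet> \<xi> < 0"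
  shows "\<exists>d>0. \<forall>s. 0 < s \<and> s < d \<longrightarrow> x + s *\<^sub>R \<xi> \<in> \<Omega>"
proof -
  obtain e1 e2 \<phi> where graph: "C1_graph_at \<Omega> x e1 e2 \<phi>"
    and normal: "outer_normal \<Omega> x = sgn (e2 - deriv \<phi> (x \<bullet> e1) *\<^sub>R e1)"
    using outer_normal_graph[OF x] .
  obtain r where r: "r > 0" "\<And>y. y \<in> ball x r \<Longrightarrow> y \<in> \<Omega> \<longleftrightarrow> y \<bullet> e2 < \<phi> (y \<bullet> e1)"
    "\<And>y. y \<in> ball x r \<Longrightarrow> y \<in> frontier \<Omega> \<longleftrightarrow> y \<bullet> e2 = \<phi> (y \<bullet> e1)"
    using frontier_C1_graph[OF open_domain graph] by blast
  have x0: "x \<bullet> e2 = \<phi> (x \<bullet> e1)" using r(1) r(3)[of x] x by simp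
  define v where "v = e2 - deriv \<phi> (x \<bullet> e1) *\<^sub>R e1"
  have "v \<bullet> \<xi> < 0"
    using \<xi> by (simp add: normal v_def[symmetric] sgn_div_norm divide_less_0_iff mult_less_0_iff)
  then have neg: "\<xi> \<bullet> e2 - deriv \<phi> (x \<bullet> e1) * (\<xi> \<bullet> e1) < 0"
    by (simp add: v_def inner_diff_right inner_commute[of _ \<xi>])
  have "\<phi> C1_differentiable_on UNIV" using graph by (auto simp: C1_graph_at_def)
  then have "\<phi> differentiable at (x \<bullet> e1)"
    by (auto simp: C1_differentiable_on_eq)
  then have d\<phi>: "(\<phi> has_field_derivative deriv \<phi> (x \<bullet> e1)) (at (x \<bullet> e1))"
    by (simp add: DERIV_deriv_iff_real_differentiable)
  have "((\<lambda>s. (x + s *\<^sub>R \<xi>) \<bullet> e1) has_field_derivative \<xi> \<bullet> e1) (at 0)"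
    unfolding inner_add_left inner_scaleR_left by (auto intro!: derivative_eq_intros)
  then have "((\<lambda>s. \<phi> ((x + s *\<^sub>R \<xi>) \<bullet> e1)) has_field_derivative deriv \<phi> (x \<bullet> e1) * (\<xi> \<bullet> e1)) (at 0)"
    by (rule DERIV_chain2[rotated]) (use d\<phi> in simp)
  moreover have "((\<lambda>s. (x + s *\<^sub>R \<xi>) \<bullet> e2) has_field_derivative \<xi> \<bullet> e2) (at 0)"
    unfolding inner_add_left inner_scaleR_left by (auto intro!: derivative_eq_intros)
  ultimately have "((\<lambda>s. (x + s *\<^sub>R \<xi>) \<bullet> e2 - \<phi> ((x + s *\<^sub>R \<xi>) \<bullet> e1)) has_field_derivative
      \<xi> \<bullet> e2 - deriv \<phi> (x \<bullet> e1) * (\<xi> \<bullet> e1)) (at 0)"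
    by (intro derivative_intros)
  from has_real_derivative_neg_dec_right[OF this neg]
  obtain d where d: "d > 0" "\<And>s. 0 < s \<Longrightarrow> s < d \<Longrightarrow> (x + s *\<^sub>R \<xi>) \<bullet> e2 - \<phi> ((x + s *\<^sub>R \<xi>) \<bullet> e1) < 0"
    using x0 by auto
  have "((\<lambda>s. x + s *\<^sub>R \<xi>) \<longlongrightarrow> x + 0 *\<^sub>R \<xi>) (at_right 0)" by (intro tendsto_intros)
  then have "eventually (\<lambda>s. x + s *\<^sub>R \<xi> \<in> ball x r) (at_right 0)"
    by (rule topological_tendstoD) (use r in auto)
  then obtain b where b: "b > 0" "\<And>s. 0 < s \<Longrightarrow> s < b \<Longrightarrow> x + s *\<^sub>R \<xi> \<in> ball x r"
    by (auto simp: eventually_at_right_field)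
  have "x + s *\<^sub>R \<xi> \<in> \<Omega>" if "0 < s" "s < min b d" for s
    using r(2)[OF b(2)[of s]] d(2)[of s] that by simp
  then show ?thesis using b(1) d(1) by (intro exI[of _ "min b d"]) auto
qed

text \<open>If some \<open>w\<close> in \<open>\<Omega>\<close> lay on the outer side of the
  tangent, then the direction \<open>x - w\<close> would lead from \<open>x\<close> into
  \<open>\<Omega>\<close>, and \<open>x\<close> would lie between two points of the convex set.
  Strictness comes from openness: \<open>y\<close> can still be shifted a little along the
  normal.\<close>

lemma outer_normal_supports:
  assumes x: "x \<in> frontier \<Omega>" and y: "y \<in> \<Omega>"
  shows "outer_normal \<Omega> x \<bullet> (y - x) < 0"
proof -
  let ?\<nu> = "outer_normal \<Omega> x"
  have le: "?\<nu> \<bullet> (w - x) \<le> 0" if w: "w \<in> \<Omega>" for w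
  proof (rule ccontr)
    assume "\<not> ?\<nu> \<bullet> (w - x) \<le> 0"
    then have "?\<nu> \<bullet> (x - w) < 0" by (simp add: inner_diff_right)
    from inward_direction_enters[OF x this] obtain d
      where d: "d > 0" "\<And>s. 0 < s \<Longrightarrow> s < d \<Longrightarrow> x + s *\<^sub>R (x - w) \<in> \<Omega>" by auto
    define s where "s = d / 2"
    have s: "0 < s" "s < d" using d(1) by (auto simp: s_def)
    \<comment> \<open>The weights 1/(1+s) and s/(1+s) recover \<open>x\<close> from \<open>w\<close>
      and the reflected point \<open>x + s (x - w)\<close>.\<close>
    have "(1 / (1 + s)) *\<^sub>R (x + s *\<^sub>R (x - w)) + (s / (1 + s)) *\<^sub>R w \<in> \<Omega>"
      using s d(2)[OF s] w by (intro convexD[OF convex_domain]) (auto simp: field_simps)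
    also have "(1 / (1 + s)) *\<^sub>R (x + s *\<^sub>R (x - w)) + (s / (1 + s)) *\<^sub>R w
        = (1 / (1 + s)) *\<^sub>R ((1 + s) *\<^sub>R x)"
      by (simp add: algebra_simps)
    also have "\<dots> = x" using s by simp
    finally show False using x not_in_frontier by blast
  qed
  obtain e where e: "e > 0" "ball y e \<subseteq> \<Omega>" using open_domain y openE by blast
  \<comment> \<open>The normalization makes the shift along the normal have length
    \<open>e / 2\<close>, inside the ball around \<open>y\<close>.\<close>
  define c where "c = e / (2 * norm ?\<nu>)"
  have "norm ?\<nu> > 0" using outer_normal_nonzero[OF x] by simp
  then have c: "c > 0" "norm (c *\<^sub>R ?\<nu>) = e / 2" using e by (auto simp: c_def)
  then have "y + c *\<^sub>R ?\<nu> \<in> \<Omega>" using e by (intro subsetD[OF e(2)]) (simp add: dist_norm)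
  from le[OF this] have "?\<nu> \<bullet> (y - x) + c * (?\<nu> \<bullet> ?\<nu>) \<le> 0"
    by (simp add: inner_diff_right inner_add_right)
  moreover have "c * (?\<nu> \<bullet> ?\<nu>) > 0"
    using c outer_normal_nonzero[OF x] by simp
  ultimately show ?thesis by linarith
qed

text \<open>By convexity the sign of the normal component is decided by whether the forward ray ever
  meets \<open>\<Omega>\<close>. Unlike the sign condition, that property visibly persists under
  small changes of the point and of the direction.\<close>

lemma Gamma_minus_iff:
  "(x, \<xi>) \<in> Gamma_minus \<Omega> \<longleftrightarrow> x \<in> frontier \<Omega> \<and> norm \<xi> = 1 \<and> (\<exists>s>0. x + s *\<^sub>R \<xi> \<in> \<Omega>)"
proof -
  have "outer_normal \<Omega> x \<bullet> \<xi> < 0 \<longleftrightarrow> (\<exists>s>0. x + s *\<^sub>R \<xi> \<in> \<Omega>)" if x: "x \<in> frontier \<Omega>"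
  proof
    assume "outer_normal \<Omega> x \<bullet> \<xi> < 0"
    from inward_direction_enters[OF x this] show "\<exists>s>0. x + s *\<^sub>R \<xi> \<in> \<Omega>"
      by (meson field_lbound_gt_zero)
  next
    assume "\<exists>s>0. x + s *\<^sub>R \<xi> \<in> \<Omega>"
    then obtain s where s: "s > 0" "x + s *\<^sub>R \<xi> \<in> \<Omega>" by blast
    from outer_normal_supports[OF x s(2)] s(1) show "outer_normal \<Omega> x \<bullet> \<xi> < 0"
      by (simp add: mult_less_0_iff)
  qed
  then show ?thesis by (auto simp: Gamma_minus_def)
qed

text \<open>Interior points and inflow boundary points obey one common description, so rays can be
  treated without distinguishing the two.\<close>

lemma phase_dom_iff:
  "(x, \<xi>) \<in> D \<longleftrightarrow> x \<in> closure \<Omega> \<and> norm \<xi> = 1 \<and> (\<exists>s>0. x + s *\<^sub>R \<xi> \<in> \<Omega>)"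
proof -
  have "\<exists>s>0. x + s *\<^sub>R \<xi> \<in> \<Omega>" if "x \<in> \<Omega>"
  proof -
    have "((\<lambda>s. x + s *\<^sub>R \<xi>) \<longlongrightarrow> x + 0 *\<^sub>R \<xi>) (at_right 0)" by (intro tendsto_intros)
    then have "eventually (\<lambda>s. x + s *\<^sub>R \<xi> \<in> \<Omega>) (at_right 0)"
      by (rule topological_tendstoD) (use open_domain that in auto)
    then obtain b where b: "b > 0" "\<And>s. 0 < s \<Longrightarrow> s < b \<Longrightarrow> x + s *\<^sub>R \<xi> \<in> \<Omega>"
      by (auto simp: eventually_at_right_field)
    then show ?thesis by (intro exI[of _ "b / 2"]) auto
  qed
  moreover have "x \<in> closure \<Omega>" if "x \<in> \<Omega>" using that closure_subset by auto
  ultimately show ?thesis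
    by (auto simp: phase_dom_def Gamma_minus_iff frontier_iff)
qed

lemma phase_dom_interior: "x \<in> \<Omega> \<Longrightarrow> norm \<xi> = 1 \<Longrightarrow> (x, \<xi>) \<in> D"
  by (simp add: phase_dom_def)

text \<open>In the ray description, \<open>D\<close> is the intersection of a closed set with an
  open one. The open one is the union over \<open>s\<close> of the preimages of
  \<open>\<Omega>\<close> under the flow for time \<open>s\<close>.\<close>

lemma phase_dom_borel [measurable]: "D \<in> sets borel"
proof -
  have "open (\<Union>s\<in>{0<..}. {z :: plane \<times> plane. fst z + s *\<^sub>R snd z \<in> \<Omega>})" (is "open ?U")
  proof (intro open_UN ballI)
    fix s :: real
    have "open ((\<lambda>z :: plane \<times> plane. fst z + s *\<^sub>R snd z) -` \<Omega>)"
      by (intro open_vimage open_domain continuous_intros)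
    then show "open {z :: plane \<times> plane. fst z + s *\<^sub>R snd z \<in> \<Omega>}" by (simp add: vimage_def)
  qed
  moreover have "closed (closure \<Omega> \<times> S1)"
    by (auto intro!: closed_Times)
  moreover have "D = (closure \<Omega> \<times> S1) \<inter> ?U"
    by (auto simp: phase_dom_iff)
  ultimately show ?thesis
    by (simp only: sets.Int borel_open borel_closed)
qed

section \<open>Exit times and entry points of rays\<close>

definition diam :: real where
  "diam = diameter (closure \<Omega>)"

lemma dist_le_diam: "x \<in> closure \<Omega> \<Longrightarrow> y \<in> closure \<Omega> \<Longrightarrow> dist x y \<le> diam"
  unfolding diam_def using bounded_domain by (intro diameter_bounded_bound) auto

lemma diam_nonneg: "0 \<le> diam"
  unfolding diam_def using bounded_domain by (intro diameter_ge_0) auto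

lemma exits:
  assumes "x \<in> closure \<Omega>" "norm \<xi> = 1" "t > diam"
  shows "x - t *\<^sub>R \<xi> \<notin> closure \<Omega>" "x + t *\<^sub>R \<xi> \<notin> closure \<Omega>"
  using dist_le_diam[OF assms(1), of "x - t *\<^sub>R \<xi>"] dist_le_diam[OF assms(1), of "x + t *\<^sub>R \<xi>"]
    assms diam_nonneg by (auto simp: dist_norm)

lemma mem_before_exit:
  assumes "x \<in> closure \<Omega>" "norm \<xi> = 1" "0 < t" "t < \<tau> x \<xi>"
  shows "x - t *\<^sub>R \<xi> \<in> \<Omega>"
proof (rule ccontr)
  assume "x - t *\<^sub>R \<xi> \<notin> \<Omega>"
  then have "\<tau> x \<xi> \<le> t"
    unfolding tau_minus_def using assms(3) by (intro cInf_lower) (auto intro!: bdd_belowI[of _ 0])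
  with assms show False by simp
qed

context
  fixes x \<xi> :: plane
  assumes z: "(x, \<xi>) \<in> D"
begin

lemma phase_dom_props: "x \<in> closure \<Omega>" "norm \<xi> = 1"
  using z by (auto simp: phase_dom_iff)

lemma exit_set_nonempty: "{t. 0 < t \<and> x - t *\<^sub>R \<xi> \<notin> \<Omega>} \<noteq> {}"
proof -
  have "x - (diam + 1) *\<^sub>R \<xi> \<notin> closure \<Omega>"
    by (rule exits[OF phase_dom_props]) simp
  then have "diam + 1 \<in> {t. 0 < t \<and> x - t *\<^sub>R \<xi> \<notin> \<Omega>}"
    using diam_nonneg closure_subset[of \<Omega>] by auto
  then show ?thesis by blast
qed

lemma tau_nonneg: "0 \<le> \<tau> x \<xi>"
  unfolding tau_minus_def by (rule cInf_greatest[OF exit_set_nonempty]) auto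

lemma before_tau: "0 < t \<Longrightarrow> t < \<tau> x \<xi> \<Longrightarrow> x - t *\<^sub>R \<xi> \<in> \<Omega>"
  using mem_before_exit phase_dom_props by blast

text \<open>The ray passes through \<open>\<Omega>\<close> ahead of \<open>x\<close>. If it touched
  the closure again after leaving, convexity would put the whole open segment in between into the
  interior, including a point \<open>x - t' \<xi>\<close> known to be outside. Exclusion from the
  closure, not only from \<open>\<Omega>\<close>, makes the statement stable under
  perturbation.\<close>

lemma after_tau:
  assumes t: "\<tau> x \<xi> < t"
  shows "x - t *\<^sub>R \<xi> \<notin> closure \<Omega>"
proof
  assume c: "x - t *\<^sub>R \<xi> \<in> closure \<Omega>"
  from t obtain t' where t': "0 < t'" "t' < t" "x - t' *\<^sub>R \<xi> \<notin> \<Omega>"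
    unfolding tau_minus_def by (auto dest: cInf_lessD[OF exit_set_nonempty])
  obtain s where s: "s > 0" "x + s *\<^sub>R \<xi> \<in> \<Omega>" using z by (auto simp: phase_dom_iff)
  have "x - t' *\<^sub>R \<xi> \<in> open_segment (x + s *\<^sub>R \<xi>) (x - t *\<^sub>R \<xi>)"
  proof -
    \<comment> \<open>The position of \<open>x - t' \<xi>\<close> on the segment from
      \<open>x + s \<xi>\<close> to \<open>x - t \<xi>\<close>, measured as a fraction of its length
      \<open>s + t\<close>.\<close>
    define u where "u = (s + t') / (s + t)"
    have u: "0 < u" "u < 1" using s t' by (auto simp: u_def)
    have "u * (s + t) = s + t'" using s t' by (simp add: u_def)
    then have "- t' = (1 - u) * s - u * t" by (simp add: algebra_simps)
    then have "x - t' *\<^sub>R \<xi> = (1 - u) *\<^sub>R (x + s *\<^sub>R \<xi>) + u *\<^sub>R (x - t *\<^sub>R \<xi>)"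
      by (simp add: algebra_simps flip: scaleR_minus_left scaleR_add_left)
    moreover have "x + s *\<^sub>R \<xi> \<noteq> x - t *\<^sub>R \<xi>"
    proof
      assume "x + s *\<^sub>R \<xi> = x - t *\<^sub>R \<xi>"
      then have "(s + t) *\<^sub>R \<xi> = 0" by (simp add: algebra_simps)
      then show False using s t' phase_dom_props by auto
    qed
    ultimately show ?thesis using u unfolding in_segment by blast
  qed
  moreover have "open_segment (x + s *\<^sub>R \<xi>) (x - t *\<^sub>R \<xi>) \<subseteq> interior \<Omega>"
    using s c by (intro in_interior_closure_convex_segment convex_domain) (auto simp: interior_open open_domain)
  ultimately show False using t' interior_subset by auto
qed

lemma tau_le_diam: "\<tau> x \<xi> \<le> diam"
proof (rule ccontr)
  assume "\<not> \<tau> x \<xi> \<le> diam"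
  then obtain t where t: "diam < t" "t < \<tau> x \<xi>" using dense by (meson not_le)
  then have "x - t *\<^sub>R \<xi> \<in> \<Omega>" using diam_nonneg by (intro before_tau) auto
  with exits(1)[OF phase_dom_props t(1)] closure_subset show False by auto
qed

text \<open>Just after the exit time the ray is outside, so the entry point cannot belong to the
  open set. Just before it the ray is inside, so the entry point belongs to the closure; if the exit
  time is 0, the point is \<open>x\<close> itself.\<close>

lemma entry_frontier: "P x \<xi> \<in> frontier \<Omega>"
proof -
  have "P x \<xi> \<notin> \<Omega>"
  proof
    assume "P x \<xi> \<in> \<Omega>"
    have "((\<lambda>t. x - t *\<^sub>R \<xi>) \<longlongrightarrow> x - \<tau> x \<xi> *\<^sub>R \<xi>) (at_right (\<tau> x \<xi>))" by (intro tendsto_intros)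
    then have "eventually (\<lambda>t. x - t *\<^sub>R \<xi> \<in> \<Omega>) (at_right (\<tau> x \<xi>))"
      by (rule topological_tendstoD) (use open_domain \<open>P x \<xi> \<in> \<Omega>\<close> in \<open>auto simp: entry_pt_def\<close>)
    then have "eventually (\<lambda>t. False) (at_right (\<tau> x \<xi>))"
      using eventually_at_right_less
      by eventually_elim (use after_tau closure_subset in blast)
    then show False by simp
  qed
  moreover have "P x \<xi> \<in> closure \<Omega>"
  proof (cases "\<tau> x \<xi> = 0")
    case True
    then show ?thesis using phase_dom_props by (simp add: entry_pt_def)
  next
    case False
    with tau_nonneg have pos: "0 < \<tau> x \<xi>" by simp
    have lim: "((\<lambda>t. x - t *\<^sub>R \<xi>) \<longlongrightarrow> P x \<xi>) (at_left (\<tau> x \<xi>))"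
      unfolding entry_pt_def by (intro tendsto_intros)
    have "eventually (\<lambda>t. t \<in> {0<..<\<tau> x \<xi>}) (at_left (\<tau> x \<xi>))"
      using eventually_at_left_real[OF pos] .
    then have "eventually (\<lambda>t. x - t *\<^sub>R \<xi> \<in> closure \<Omega>) (at_left (\<tau> x \<xi>))"
      by eventually_elim (use before_tau closure_subset in auto)
    from Lim_in_closed_set[OF closed_closure this _ lim] show ?thesis by simp
  qed
  ultimately show ?thesis by (simp add: frontier_iff)
qed

lemma entry_Gamma_minus: "(P x \<xi>, \<xi>) \<in> Gamma_minus \<Omega>"
proof -
  obtain s where s: "s > 0" "x + s *\<^sub>R \<xi> \<in> \<Omega>" using z by (auto simp: phase_dom_iff)
  have "P x \<xi> + (\<tau> x \<xi> + s) *\<^sub>R \<xi> = x + s *\<^sub>R \<xi>"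
    by (simp add: entry_pt_def algebra_simps)
  then show ?thesis
    unfolding Gamma_minus_iff using entry_frontier phase_dom_props s tau_nonneg
    by (metis add_nonneg_pos)
qed

lemma tau_pos: "x \<in> \<Omega> \<Longrightarrow> 0 < \<tau> x \<xi>"
  using entry_frontier tau_nonneg not_in_frontier by (cases "\<tau> x \<xi> = 0") (auto simp: entry_pt_def)

end

text \<open>A backward ray from \<open>D\<close> meets the frontier only once. The delicate case is
  \<open>t = 0\<close>: there \<open>x\<close> is an inflow point, and a later stretch of the
  backward ray inside \<open>\<Omega>\<close> would make the normal component of
  \<open>\<xi>\<close> positive.\<close>

lemma tau_eqI:
  assumes "(x, \<xi>) \<in> D" "0 \<le> t" "x - t *\<^sub>R \<xi> \<in> frontier \<Omega>"
  shows "\<tau> x \<xi> = t"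
proof (rule antisym)
  show "t \<le> \<tau> x \<xi>"
    using after_tau[OF assms(1), of t] assms(3) by (force simp: frontier_iff)
  show "\<tau> x \<xi> \<le> t"
  proof (rule ccontr)
    assume "\<not> \<tau> x \<xi> \<le> t"
    then have gt: "t < \<tau> x \<xi>" by simp
    with before_tau[OF assms(1), of t] assms have "t = 0"
      by (cases "t = 0") (auto simp: frontier_iff)
    with assms(3) have "x \<in> frontier \<Omega>" by simp
    then have "outer_normal \<Omega> x \<bullet> \<xi> < 0"
      using assms(1) by (auto simp: phase_dom_def Gamma_minus_def frontier_iff)
    moreover have "x - (\<tau> x \<xi> / 2) *\<^sub>R \<xi> \<in> \<Omega>"
      using gt assms(2) by (intro before_tau[OF assms(1)]) auto
    from outer_normal_supports[OF \<open>x \<in> frontier \<Omega>\<close> this] have "0 < outer_normal \<Omega> x \<bullet> \<xi>"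
      using gt assms(2) by (simp add: zero_less_mult_iff)
    ultimately show False by simp
  qed
qed

text \<open>Each inequality rests on an open condition at one fixed time: before the exit time the
  ray is in \<open>\<Omega>\<close>, after it the ray is in the complement of the closure. Nearby
  rays share both properties.\<close>

lemma tau_tendsto:
  assumes z: "(x, \<xi>) \<in> D" and ev: "eventually (\<lambda>n. (X n, \<Xi> n) \<in> D) F"
    and X: "(X \<longlongrightarrow> x) F" and \<Xi>: "(\<Xi> \<longlongrightarrow> \<xi>) F"
  shows "((\<lambda>n. \<tau> (X n) (\<Xi> n)) \<longlongrightarrow> \<tau> x \<xi>) F"
proof (rule order_tendstoI)
  have lim: "((\<lambda>n. X n - t *\<^sub>R \<Xi> n) \<longlongrightarrow> x - t *\<^sub>R \<xi>) F" for t
    by (intro tendsto_intros X \<Xi>)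
  fix a
  show "eventually (\<lambda>n. a < \<tau> (X n) (\<Xi> n)) F" if a: "a < \<tau> x \<xi>"
  proof (cases "a < 0")
    case True
    from ev show ?thesis by eventually_elim (use tau_nonneg True in force)
  next
    case False
    obtain t where t: "a < t" "t < \<tau> x \<xi>" using dense[OF a] by blast
    then have "x - t *\<^sub>R \<xi> \<in> \<Omega>" using before_tau[OF z, of t] False by simp
    from topological_tendstoD[OF lim open_domain this] ev show ?thesis
    proof eventually_elim
      case (elim n)
      then have "\<not> \<tau> (X n) (\<Xi> n) < t" using after_tau[OF elim(2), of t] closure_subset by auto
      with t show ?case by simp
    qed
  qed
  show "eventually (\<lambda>n. \<tau> (X n) (\<Xi> n) < a) F" if a: "\<tau> x \<xi> < a"
  proof -
    obtain t where t: "\<tau> x \<xi> < t" "t < a" using dense[OF a] by blast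
    then have "x - t *\<^sub>R \<xi> \<in> - closure \<Omega>" using after_tau[OF z, of t] by simp
    from topological_tendstoD[OF lim _ this] ev have "eventually (\<lambda>n. \<not> t < \<tau> (X n) (\<Xi> n)) F"
    proof (elim eventually_elim2)
      fix n assume "X n - t *\<^sub>R \<Xi> n \<in> - closure \<Omega>" "(X n, \<Xi> n) \<in> D"
      with before_tau[of "X n" "\<Xi> n" t] tau_nonneg[OF z] t(1) closure_subset
      show "\<not> t < \<tau> (X n) (\<Xi> n)" by auto
    qed auto
    then show ?thesis by eventually_elim (use t in simp)
  qed
qed

lemma entry_tendsto:
  assumes "(x, \<xi>) \<in> D" "eventually (\<lambda>n. (X n, \<Xi> n) \<in> D) F" "(X \<longlongrightarrow> x) F" "(\<Xi> \<longlongrightarrow> \<xi>) F"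
  shows "((\<lambda>n. P (X n) (\<Xi> n)) \<longlongrightarrow> P x \<xi>) F"
  unfolding entry_pt_def by (intro tendsto_intros tau_tendsto assms)

lemma continuous_on_entry: "continuous_on D (\<lambda>z. P (fst z) (snd z))"
proof -
  have "((\<lambda>z. P (fst z) (snd z)) \<longlongrightarrow> P x \<xi>) (at (x, \<xi>) within D)" if "(x, \<xi>) \<in> D" for x \<xi>
  proof (rule entry_tendsto[OF that])
    show "\<forall>\<^sub>F z in at (x, \<xi>) within D. (fst z, snd z) \<in> D"
      by (simp add: eventually_at_filter)
    have "((\<lambda>z. z) \<longlongrightarrow> (x, \<xi>)) (at (x, \<xi>) within D)" by (rule tendsto_ident_at)
    from tendsto_fst[OF this] tendsto_snd[OF this]
    show "(fst \<longlongrightarrow> x) (at (x, \<xi>) within D)" "(snd \<longlongrightarrow> \<xi>) (at (x, \<xi>) within D)" by simp_all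
  qed
  then show ?thesis by (auto simp: continuous_on_def)
qed

lemma less_tau_plus:
  assumes y: "y \<in> closure \<Omega>" and "norm \<xi> = 1" "0 \<le> t" and before: "\<And>s. 0 < s \<Longrightarrow> s \<le> t \<Longrightarrow> y + s *\<^sub>R \<xi> \<in> \<Omega>"
    and t: "y + t *\<^sub>R \<xi> \<in> \<Omega>"
  shows "t < tau_plus \<Omega> y \<xi>"
proof -
  have "((\<lambda>s. y + s *\<^sub>R \<xi>) \<longlongrightarrow> y + t *\<^sub>R \<xi>) (at_right t)" by (intro tendsto_intros)
  then have "eventually (\<lambda>s. y + s *\<^sub>R \<xi> \<in> \<Omega>) (at_right t)"
    by (rule topological_tendstoD) (use open_domain t in auto)
  then obtain b where b: "b > t" "\<And>s. t < s \<Longrightarrow> s < b \<Longrightarrow> y + s *\<^sub>R \<xi> \<in> \<Omega>"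
    by (auto simp: eventually_at_right_field)
  have "b \<le> tau_plus \<Omega> y \<xi>"
    unfolding tau_plus_def
  proof (rule cInf_greatest)
    have "y + (diam + 1) *\<^sub>R \<xi> \<notin> closure \<Omega>" by (rule exits) (use assms in auto)
    then have "diam + 1 \<in> {t. 0 < t \<and> y + t *\<^sub>R \<xi> \<notin> \<Omega>}"
      using diam_nonneg closure_subset[of \<Omega>] by auto
    then show "{t. 0 < t \<and> y + t *\<^sub>R \<xi> \<notin> \<Omega>} \<noteq> {}" by blast
  next
    fix s assume "s \<in> {t. 0 < t \<and> y + t *\<^sub>R \<xi> \<notin> \<Omega>}"
    then show "b \<le> s" using b(2)[of s] before[of s] by force
  qed
  with b(1) show ?thesis by simp
qed

text \<open>Needed to show that \<open>(x, \<xi>)\<close> belongs to the set swept forward from an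
  earlier point of its ray, as \<open>disc_B\<close> and \<open>disc_C\<close> demand. The second
  alternative covers inflow boundary points, which are their own entry points.\<close>

lemma less_tau_plus_from_ray:
  assumes z: "(x, \<xi>) \<in> D" and t: "0 \<le> t" "t \<le> \<tau> x \<xi>" and "x \<in> \<Omega> \<or> t = 0 \<and> \<tau> x \<xi> = 0"
  shows "t < tau_plus \<Omega> (x - t *\<^sub>R \<xi>) \<xi>"
  using assms(4)
proof
  assume x: "x \<in> \<Omega>"
  show ?thesis
  proof (rule less_tau_plus)
    have "P x \<xi> \<in> closure \<Omega>" using entry_frontier[OF z] by (simp add: frontier_iff)
    then show "x - t *\<^sub>R \<xi> \<in> closure \<Omega>"
      using before_tau[OF z, of t] t x closure_subset[of \<Omega>] by (cases "t = 0"; cases "t = \<tau> x \<xi>") (auto simp: entry_pt_def)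
    show "norm \<xi> = 1" by (rule phase_dom_props[OF z])
    fix s assume "0 < s" "s \<le> t"
    then show "x - t *\<^sub>R \<xi> + s *\<^sub>R \<xi> \<in> \<Omega>"
      using before_tau[OF z, of "t - s"] t x by (cases "s = t") (auto simp: algebra_simps)
  qed (use t x in auto)
next
  assume "t = 0 \<and> \<tau> x \<xi> = 0"
  then have fr: "x \<in> frontier \<Omega>" using entry_frontier[OF z] by (simp add: entry_pt_def)
  then have "outer_normal \<Omega> x \<bullet> \<xi> < 0" using z by (auto simp: phase_dom_def Gamma_minus_def frontier_iff)
  from inward_direction_enters[OF fr this] obtain d
    where d: "d > 0" "\<And>s. 0 < s \<Longrightarrow> s < d \<Longrightarrow> x + s *\<^sub>R \<xi> \<in> \<Omega>" by auto
  have "d / 2 < tau_plus \<Omega> x \<xi>"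
    by (rule less_tau_plus) (use phase_dom_props[OF z] d in auto)
  then show ?thesis using d(1) \<open>t = 0 \<and> _\<close> by simp
qed

text \<open>Seen from an interior point \<open>y\<close>, the map
  \<open>w \<mapsto> sgn (y - w)\<close> from the frontier to the circle is inverse to the entry
  point map; \<open>sgn_entry\<close> supplies the other composition.\<close>

lemma inward_unit_vector:
  assumes y: "y \<in> \<Omega>" and w: "w \<in> frontier \<Omega>"
  shows "(w, sgn (y - w)) \<in> Gamma_minus \<Omega>" "\<tau> y (sgn (y - w)) = norm (y - w)" "P y (sgn (y - w)) = w"
    "y \<noteq> w" 
proof -
  show ne: "y \<noteq> w" using assms not_in_frontier by auto
  have eq: "norm (y - w) *\<^sub>R sgn (y - w) = y - w" using ne by (simp add: sgn_div_norm)
  then have "w + norm (y - w) *\<^sub>R sgn (y - w) \<in> \<Omega>" using y by simp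
  then show "(w, sgn (y - w)) \<in> Gamma_minus \<Omega>"
    unfolding Gamma_minus_iff using ne w by (auto simp: norm_sgn intro!: exI[of _ "norm (y - w)"])
  show "\<tau> y (sgn (y - w)) = norm (y - w)"
    by (rule tau_eqI) (use y w ne in \<open>auto simp: eq norm_sgn intro!: phase_dom_interior\<close>)
  then show "P y (sgn (y - w)) = w" by (simp add: entry_pt_def eq)
qed

lemma sgn_entry:
  assumes "y \<in> \<Omega>" "norm \<xi> = 1"
  shows "sgn (y - P y \<xi>) = \<xi>"
  using tau_pos[OF phase_dom_interior[OF assms] assms(1)] assms
  by (simp add: entry_pt_def sgn_div_norm)

end

section \<open>Integration over directions as integration over the boundary\<close>

text \<open>The matrix with rows \<open>e1\<close> and \<open>e2\<close> is orthogonal, so its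
  columns are orthonormal as well; facts 3 and 4 express this in coordinates.\<close>

lemma orthonormal_expansion_plane:
  fixes e1 e2 y :: plane
  assumes "norm e1 = 1" "norm e2 = 1" "e1 \<bullet> e2 = 0"
  shows "y = (y \<bullet> e1) *\<^sub>R e1 + (y \<bullet> e2) *\<^sub>R e2"
proof -
  define a b c d where "a = e1 $ 1" "b = e1 $ 2" "c = e2 $ 1" "d = e2 $ 2"
  have 1: "a\<^sup>2 + b\<^sup>2 = 1" "c\<^sup>2 + d\<^sup>2 = 1"
    using assms(1,2) by (auto simp: norm_vec_def L2_set_def sum_2 a_b_c_d_def)
  have 2: "a * c + b * d = 0"
    using assms(3) by (simp add: inner_vec_def sum_2 a_b_c_d_def)
  have 3: "a\<^sup>2 + c\<^sup>2 = 1" "b\<^sup>2 + d\<^sup>2 = 1"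
    using 1 2 by algebra+
  have "(a * b + c * d)\<^sup>2 = 0"
    using 1 2 3 by algebra
  then have 4: "a * b + c * d = 0" by simp
  have "y $ 1 = (y $ 1 * a + y $ 2 * b) * a + (y $ 1 * c + y $ 2 * d) * c"
    "y $ 2 = (y $ 1 * a + y $ 2 * b) * b + (y $ 1 * c + y $ 2 * d) * d"
    using 3 4 by algebra+
  then show ?thesis
    by (simp add: vec_eq_iff forall_2 inner_vec_def sum_2 a_b_c_d_def)
qed

text \<open>The graph over the interval from \<open>c - \<delta>\<close> to
  \<open>c + \<delta>\<close>, rescaled to the unit interval. Its \<open>e1\<close> component is
  affine with slope \<open>2 * \<delta>\<close>, which gives both injectivity and a nonzero
  derivative.\<close>

lemma C1_arc_graph:
  fixes e1 e2 :: plane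
  assumes e: "norm e1 = 1" "e1 \<bullet> e2 = 0" and \<phi>: "\<phi> C1_differentiable_on UNIV" and "\<delta> > 0"
  shows "C1_arc (\<lambda>t. (c + (2 * t - 1) * \<delta>) *\<^sub>R e1 + \<phi> (c + (2 * t - 1) * \<delta>) *\<^sub>R e2)" (is "C1_arc ?\<gamma>")
proof -
  obtain D where D: "\<And>s. (\<phi> has_vector_derivative D s) (at s)" "continuous_on UNIV D"
    using \<phi> unfolding C1_differentiable_on_def by blast
  define u where "u = (\<lambda>t. c + (2 * t - 1) * \<delta>)"
  have u: "(u has_field_derivative 2 * \<delta>) (at t)" for t
    unfolding u_def by (auto intro!: derivative_eq_intros)
  have "((\<lambda>t. \<phi> (u t)) has_field_derivative D (u t) * (2 * \<delta>)) (at t)" for t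
    by (rule DERIV_chain2[OF _ u]) (use D(1) in \<open>simp add: has_real_derivative_iff_has_vector_derivative\<close>)
  then have "((\<lambda>t. u t *\<^sub>R e1 + \<phi> (u t) *\<^sub>R e2) has_vector_derivative
      (2 * \<delta>) *\<^sub>R e1 + (D (u t) * (2 * \<delta>)) *\<^sub>R e2) (at t)" for t
    using has_vector_derivative_add has_vector_derivative_scaleR[OF u has_vector_derivative_const, of e1 t]
      has_vector_derivative_scaleR[OF _ has_vector_derivative_const, of "\<lambda>t. \<phi> (u t)" "D (u t) * (2 * \<delta>)" t UNIV e2]
    by fastforce
  then have der: "(?\<gamma> has_vector_derivative (2 * \<delta>) *\<^sub>R e1 + (D (u t) * (2 * \<delta>)) *\<^sub>R e2) (at t)" for t
    by (simp add: u_def)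
  have e11: "e1 \<bullet> e1 = 1" using e(1) by (simp add: power2_norm_eq_inner[symmetric])
  have "continuous_on {0..1} ?\<gamma>"
    by (rule continuous_at_imp_continuous_on) (use der has_vector_derivative_continuous in blast)
  moreover have "inj_on ?\<gamma> {0..1}"
  proof (rule inj_onI)
    fix s t assume "?\<gamma> s = ?\<gamma> t"
    then have "?\<gamma> s \<bullet> e1 = ?\<gamma> t \<bullet> e1" by simp
    then show "s = t" using e(2) e11 \<open>\<delta> > 0\<close> by (simp add: inner_add_left inner_commute[of e2])
  qed
  ultimately have "arc ?\<gamma>" by (simp add: arc_def path_def)
  moreover have "?\<gamma> C1_differentiable_on {0..1}"
    unfolding C1_differentiable_on_def
  proof (intro exI conjI ballI)
    show "(?\<gamma> has_vector_derivative (2 * \<delta>) *\<^sub>R e1 + (D (u t) * (2 * \<delta>)) *\<^sub>R e2) (at t)" for t by (rule der)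
    have "continuous_on {0..1} u" unfolding u_def by (intro continuous_intros)
    then have "continuous_on {0..1} (\<lambda>t. D (u t))"
      by (rule continuous_on_compose2[OF D(2)]) auto
    then show "continuous_on {0..1} (\<lambda>t. (2 * \<delta>) *\<^sub>R e1 + (D (u t) * (2 * \<delta>)) *\<^sub>R e2)"
      by (intro continuous_intros)
  qed
  moreover have "vector_derivative ?\<gamma> (at t) \<noteq> 0" for t
  proof
    assume "vector_derivative ?\<gamma> (at t) = 0"
    then have "((2 * \<delta>) *\<^sub>R e1 + (D (u t) * (2 * \<delta>)) *\<^sub>R e2) \<bullet> e1 = 0"
      using vector_derivative_at[OF der[of t]] by simp
    then show False using e(2) e11 \<open>\<delta> > 0\<close> by (simp add: inner_add_left inner_commute[of e2])
  qed
  ultimately show ?thesis by (simp add: C1_arc_def)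
qed

context convex_C1_domain
begin

lemma local_boundary_arc:
  assumes x: "x \<in> frontier \<Omega>"
  obtains \<gamma> \<delta> where "C1_arc \<gamma>" "path_image \<gamma> \<subseteq> frontier \<Omega>" "\<delta> > 0" "frontier \<Omega> \<inter> ball x \<delta> \<subseteq> path_image \<gamma>"
proof -
  obtain e1 e2 \<phi> where graph: "C1_graph_at \<Omega> x e1 e2 \<phi>"
    using outer_normal_graph[OF x] by blast
  then have e: "norm e1 = 1" "norm e2 = 1" "e1 \<bullet> e2 = 0" "\<phi> C1_differentiable_on UNIV"
    by (auto simp: C1_graph_at_def)
  have ee: "e1 \<bullet> e1 = 1" "e2 \<bullet> e2 = 1" using e(1,2) by (simp_all add: power2_norm_eq_inner[symmetric])
  obtain r where r: "r > 0" "\<And>y. y \<in> ball x r \<Longrightarrow> y \<in> \<Omega> \<longleftrightarrow> y \<bullet> e2 < \<phi> (y \<bullet> e1)"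
    "\<And>y. y \<in> ball x r \<Longrightarrow> y \<in> frontier \<Omega> \<longleftrightarrow> y \<bullet> e2 = \<phi> (y \<bullet> e1)"
    using frontier_C1_graph[OF open_domain graph] by blast
  define c where "c = x \<bullet> e1"
  have x0: "x \<bullet> e2 = \<phi> c" using r(1) r(3)[of x] x by (simp add: c_def)
  have "isCont \<phi> c"
    using C1_differentiable_imp_continuous_on[OF e(4)] by (simp add: continuous_on_eq_continuous_at)
  then obtain d where d: "d > 0" "\<And>s. dist s c < d \<Longrightarrow> dist (\<phi> s) (\<phi> c) < r / 2"
    using r(1) unfolding continuous_at_eps_delta by (metis half_gt_zero)
  \<comment> \<open>The bound \<open>d / 2\<close> makes the continuity estimate available also at
    the closed ends of the arc. With \<open>r / 2\<close> for each of the two components, the arc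
    stays in the ball where the graph describes the frontier.\<close>
  define \<delta> where "\<delta> = min (d / 2) (r / 2)"
  have \<delta>: "\<delta> > 0" "\<delta> < d" "\<delta> \<le> r / 2" using d(1) r(1) by (auto simp: \<delta>_def min_def)
  define \<gamma> where "\<gamma> = (\<lambda>t. (c + (2 * t - 1) * \<delta>) *\<^sub>R e1 + \<phi> (c + (2 * t - 1) * \<delta>) *\<^sub>R e2)"
  show thesis
  proof
    show "C1_arc \<gamma>" unfolding \<gamma>_def by (rule C1_arc_graph) (use e \<delta> in auto)
    show "path_image \<gamma> \<subseteq> frontier \<Omega>"
    proof
      fix w assume "w \<in> path_image \<gamma>"
      then obtain t where t: "t \<in> {0..1}" "w = \<gamma> t" by (auto simp: path_image_def)
      define s where "s = c + (2 * t - 1) * \<delta>"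
      have w: "w = s *\<^sub>R e1 + \<phi> s *\<^sub>R e2" by (simp add: t \<gamma>_def s_def)
      have "\<bar>2 * t - 1\<bar> \<le> 1" using t(1) by auto
      then have s: "\<bar>s - c\<bar> \<le> \<delta>" using \<delta>(1) by (simp add: s_def abs_mult mult_left_le_one_le)
      have "x = c *\<^sub>R e1 + \<phi> c *\<^sub>R e2"
        using orthonormal_expansion_plane[OF e(1-3), of x] by (simp add: c_def x0[unfolded c_def])
      then have "dist x w = norm ((c - s) *\<^sub>R e1 + (\<phi> c - \<phi> s) *\<^sub>R e2)"
        by (simp add: w dist_norm algebra_simps)
      also have "\<dots> \<le> \<bar>c - s\<bar> + \<bar>\<phi> c - \<phi> s\<bar>"
        by (rule order_trans[OF norm_triangle_ineq]) (simp add: e)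
      also have "\<dots> < r" using s \<delta> d(2)[of s] by (simp add: dist_real_def abs_minus_commute)
      finally have "w \<in> ball x r" by simp
      moreover have "w \<bullet> e1 = s" "w \<bullet> e2 = \<phi> s"
        using e(3) ee by (auto simp: w inner_add_left inner_commute[of e2 e1])
      ultimately show "w \<in> frontier \<Omega>" using r(3)[of w] by simp
    qed
    show "\<delta> > 0" by (rule \<delta>)
    show "frontier \<Omega> \<inter> ball x \<delta> \<subseteq> path_image \<gamma>"
    proof
      fix w assume w: "w \<in> frontier \<Omega> \<inter> ball x \<delta>"
      then have "w \<in> ball x r" using \<delta> r(1) by auto
      with w r(3) have w2: "w \<bullet> e2 = \<phi> (w \<bullet> e1)" by blast
      define t where "t = ((w \<bullet> e1 - c) / \<delta> + 1) / 2"
      have "\<bar>w \<bullet> e1 - c\<bar> = \<bar>(w - x) \<bullet> e1\<bar>" by (simp add: c_def inner_diff_left)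
      also have "\<dots> \<le> norm (w - x)" using Cauchy_Schwarz_ineq2[of "w - x" e1] e by simp
      also have "\<dots> \<le> \<delta>" using w by (simp add: dist_norm norm_minus_commute)
      finally have "t \<in> {0..1}" using \<delta>(1) by (auto simp: t_def field_simps abs_le_iff)
      moreover have "c + (2 * t - 1) * \<delta> = w \<bullet> e1" using \<delta>(1) by (simp add: t_def field_simps)
      then have "\<gamma> t = w"
        using orthonormal_expansion_plane[OF e(1-3), of w] w2 by (simp add: \<gamma>_def)
      ultimately show "w \<in> path_image \<gamma>" by (auto simp: path_image_def)
    qed
  qed
qed

text \<open>Compactness gives finitely many arcs, which may overlap. Cutting them into disjoint
  Borel pieces lets an integral over the boundary be summed arc by arc without counting a point
  twice.\<close>

lemma boundary_partition:
  obtains m :: nat and \<gamma> Z where "\<And>i. i < m \<Longrightarrow> C1_arc (\<gamma> i)" "\<And>i. i < m \<Longrightarrow> path_image (\<gamma> i) \<subseteq> frontier \<Omega>"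
    "\<And>i. i < m \<Longrightarrow> Z i \<in> sets borel" "\<And>i. i < m \<Longrightarrow> Z i \<subseteq> path_image (\<gamma> i)"
    "\<And>w. w \<in> frontier \<Omega> \<Longrightarrow> (\<Sum>i<m. indicator (Z i) w) = (1 :: real)"
proof -
  have "\<forall>x\<in>frontier \<Omega>. \<exists>q. C1_arc (fst q) \<and> path_image (fst q) \<subseteq> frontier \<Omega> \<and> snd q > (0::real)
      \<and> frontier \<Omega> \<inter> ball x (snd q) \<subseteq> path_image (fst q)"
  proof
    fix x assume "x \<in> frontier \<Omega>"
    from local_boundary_arc[OF this] obtain \<gamma> \<delta> where "C1_arc \<gamma>" "path_image \<gamma> \<subseteq> frontier \<Omega>" "\<delta> > 0"
      "frontier \<Omega> \<inter> ball x \<delta> \<subseteq> path_image \<gamma>" .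
    then show "\<exists>q. C1_arc (fst q) \<and> path_image (fst q) \<subseteq> frontier \<Omega> \<and> snd q > (0::real)
      \<and> frontier \<Omega> \<inter> ball x (snd q) \<subseteq> path_image (fst q)"
      by (intro exI[of _ "(\<gamma>, \<delta>)"]) simp
  qed
  from bchoice[OF this] obtain q where q: "\<forall>x\<in>frontier \<Omega>. C1_arc (fst (q x)) \<and> path_image (fst (q x)) \<subseteq> frontier \<Omega>
      \<and> snd (q x) > (0::real) \<and> frontier \<Omega> \<inter> ball x (snd (q x)) \<subseteq> path_image (fst (q x))" ..
  define g d where "g = (\<lambda>x. fst (q x))" and "d = (\<lambda>x. snd (q x))"
  have gd: "C1_arc (g x)" "path_image (g x) \<subseteq> frontier \<Omega>" "d x > 0"
    "frontier \<Omega> \<inter> ball x (d x) \<subseteq> path_image (g x)" if "x \<in> frontier \<Omega>" for x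
    using q that by (simp_all add: g_def d_def)
  have "compact (frontier \<Omega>)" using bounded_domain by (rule compact_frontier_bounded)
  moreover have "frontier \<Omega> \<subseteq> (\<Union>x\<in>frontier \<Omega>. ball x (d x))"
    using gd(3) centre_in_ball by blast
  ultimately obtain C where C: "C \<subseteq> frontier \<Omega>" "finite C" "frontier \<Omega> \<subseteq> (\<Union>x\<in>C. ball x (d x))"
    using compactE_image[of "frontier \<Omega>" "frontier \<Omega>" "\<lambda>x. ball x (d x)"] by (metis open_ball)
  obtain m :: nat and h where h: "C = h ` {i. i < m}"
    using finite_imp_nat_seg_image_inj_on[OF C(2)] by metis
  define \<gamma> where "\<gamma> = (\<lambda>i. g (h i))"
  \<comment> \<open>The set \<open>disjointed\<close> produces at index \<open>i\<close> refers to
    no index above \<open>i\<close>, so for \<open>i < m\<close> only arcs of the cover enter.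
    Nothing is known about \<open>\<gamma> i\<close> for larger \<open>i\<close>.\<close>
  define Z where "Z = disjointed (\<lambda>i. path_image (\<gamma> i))"
  have hC: "h i \<in> frontier \<Omega>" if "i < m" for i using C(1) h that by auto
  show thesis
  proof
    fix i assume i: "i < m"
    show "C1_arc (\<gamma> i)" "path_image (\<gamma> i) \<subseteq> frontier \<Omega>"
      unfolding \<gamma>_def using gd(1,2)[OF hC[OF i]] .
    show "Z i \<subseteq> path_image (\<gamma> i)" by (auto simp: Z_def disjointed_def)
    have "path_image (\<gamma> j) \<in> sets borel" if "j < m" for j
      using gd(1)[OF hC[OF that]]
      by (intro borel_closed closed_path_image) (auto simp: \<gamma>_def C1_arc_def arc_def)
    then show "Z i \<in> sets borel"
      using i unfolding Z_def disjointed_def by (intro sets.Diff sets.finite_UN) auto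
  next
    fix w assume w: "w \<in> frontier \<Omega>"
    with C(3) obtain x where "x \<in> C" "w \<in> ball x (d x)" by blast
    with gd(4)[of x] C(1) w have "w \<in> path_image (g x)" by blast
    with h \<open>x \<in> C\<close> obtain j where "j < m" "w \<in> path_image (\<gamma> j)"
      unfolding \<gamma>_def by blast
    then have "w \<in> (\<Union>i\<in>{0..<m}. Z i)" unfolding Z_def finite_UN_disjointed_eq by auto
    then obtain k where k: "k < m" "w \<in> Z k" by auto
    have "disjoint_family Z" unfolding Z_def by (rule disjoint_family_disjointed)
    then have "indicator (Z i) w = (if i = k then 1 else 0 :: real)" for i
      using k(2) by (auto simp: disjoint_family_on_def indicator_def)
    then show "(\<Sum>i<m. indicator (Z i) w) = (1 :: real)" using k(1) by simp
  qed
qed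

lemma entry_borel:
  assumes "y \<in> \<Omega>"
  shows "P y \<in> borel_measurable (restrict_space borel S1)"
proof (rule borel_measurable_continuous_on_restrict)
  have "continuous_on S1 (\<lambda>\<xi>. (y, \<xi>))" by (intro continuous_intros)
  moreover have "(\<lambda>\<xi>. (y, \<xi>)) ` S1 \<subseteq> D" using assms by (auto simp: phase_dom_interior)
  ultimately have "continuous_on S1 (\<lambda>\<xi>. P (fst (y, \<xi>)) (snd (y, \<xi>)))"
    by (rule continuous_on_compose2[OF continuous_on_entry])
  then show "continuous_on S1 (P y)" by simp
qed

text \<open>The change of variables is \<open>\<theta> = angle (y - \<gamma> t)\<close>, with
  Jacobian \<open>w\<close>. It is injective because \<open>y\<close> sees each boundary point in
  its own direction, and the directions entering through \<open>Z\<close> correspond to the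
  parameters in \<open>S\<close>. At most one parameter looks along the branch cut of
  \<open>angle\<close>, and it is removed.\<close>

lemma angular_substitution:
  fixes F :: "plane \<Rightarrow> real"
  assumes y: "y \<in> \<Omega>" and \<gamma>: "C1_arc \<gamma>" "path_image \<gamma> \<subseteq> frontier \<Omega>"
    and Z: "Z \<in> sets borel" "Z \<subseteq> path_image \<gamma>"
    and F: "F \<in> borel_measurable (restrict_space borel S1)" "\<And>\<xi>. norm \<xi> = 1 \<Longrightarrow> \<bar>F \<xi>\<bar> \<le> C"
  defines "S \<equiv> {t \<in> {0..1}. \<gamma> t \<in> Z}"
    and "w \<equiv> \<lambda>t. \<bar>cross2 (y - \<gamma> t) (vector_derivative \<gamma> (at t))\<bar> / (norm (y - \<gamma> t))\<^sup>2"
  shows "(\<lambda>t. w t * F (sgn (y - \<gamma> t))) absolutely_integrable_on S"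
    and "(LINT \<xi>|circle_measure. indicator Z (P y \<xi>) * F \<xi>) = integral S (\<lambda>t. w t * F (sgn (y - \<gamma> t)))"
proof -
  have cont: "continuous_on {0..1} \<gamma>" and inj: "inj_on \<gamma> {0..1}"
    and der: "\<And>t. t \<in> {0..1} \<Longrightarrow> (\<gamma> has_vector_derivative vector_derivative \<gamma> (at t)) (at t)"
    using \<gamma>(1) by (auto simp: C1_arc_def arc_def path_def C1_differentiable_on_eq vector_derivative_works)
  have fr: "\<gamma> t \<in> frontier \<Omega>" if "t \<in> {0..1}" for t
    using \<gamma>(2) that by (auto simp: path_image_def)
  \<comment> \<open>The angle 0 is left out to match the removal of the branch cut from the
    parameters.\<close>
  define A where "A = {\<theta> \<in> {0<..<2*pi}. P y (circ \<theta>) \<in> Z}"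
  define S' where "S' = {t \<in> S. sgn (y - \<gamma> t) \<noteq> circ 0}"
  define \<alpha> where "\<alpha> = (\<lambda>t. angle (y - \<gamma> t))"
  have pos: "0 < \<alpha> t" if "t \<in> S'" for t
    using that inward_unit_vector(4)[OF y fr] by (auto simp: S'_def S_def \<alpha>_def angle_pos_iff)
  have circ_\<alpha>: "circ (\<alpha> t) = sgn (y - \<gamma> t)" if "t \<in> {0..1}" for t
    using that inward_unit_vector(4)[OF y fr] by (auto simp: \<alpha>_def circ_angle)
  have S: "S \<in> sets borel"
  proof -
    have "\<gamma> \<in> borel_measurable (restrict_space borel {0..1})"
      by (rule borel_measurable_continuous_on_restrict[OF cont])
    from measurable_sets[OF this Z(1)] have "\<gamma> -` Z \<inter> {0..1} \<in> sets (restrict_space borel {0..1})"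
      by (simp add: space_restrict_space)
    moreover have "\<gamma> -` Z \<inter> {0..1} = S" by (auto simp: S_def)
    ultimately show ?thesis by (simp add: sets_restrict_space_iff)
  qed
  have inj_at: "t = s" if "s \<in> {0..1}" "t \<in> {0..1}" "sgn (y - \<gamma> t) = sgn (y - \<gamma> s)" for s t
    using inward_unit_vector(3)[OF y fr, of s] inward_unit_vector(3)[OF y fr, of t] that inj
    by (auto dest: inj_onD)
  have diff: "negligible (S - S')" "finite (S - S')"
  proof -
    have "\<exists>t0. S - S' \<subseteq> {t0}"
    proof (cases "S - S' = {}")
      case False
      then obtain t0 where "t0 \<in> S - S'" by blast
      then have "S - S' \<subseteq> {t0}" using inj_at[of t0] by (auto simp: S'_def S_def)
      then show ?thesis by blast
    qed auto
    then show "finite (S - S')" using finite_subset by blast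
    then show "negligible (S - S')" by (rule negligible_finite)
  qed
  have S': "S' \<in> sets borel"
  proof -
    have "S' = S - (S - S')" by (auto simp: S'_def)
    moreover have "S - S' \<in> sets borel" using diff(2) by (simp add: borel_closed finite_imp_closed)
    ultimately show ?thesis using S by (metis sets.Diff)
  qed
  have inj_\<alpha>: "inj_on \<alpha> S'"
    by (rule inj_onI, rule inj_at) (auto simp: S'_def S_def circ_\<alpha>[symmetric])
  have img: "\<alpha> ` S' = A"
  proof (intro subset_antisym subsetI)
    fix \<theta> assume "\<theta> \<in> \<alpha> ` S'"
    then obtain t where t: "t \<in> S'" "\<theta> = \<alpha> t" by blast
    then have "t \<in> {0..1}" "\<gamma> t \<in> Z" by (auto simp: S'_def S_def)
    then show "\<theta> \<in> A"
      using pos[OF t(1)] angle_range(2) inward_unit_vector(3)[OF y fr] circ_\<alpha>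
      by (auto simp: A_def t \<alpha>_def)
  next
    fix \<theta> assume \<theta>: "\<theta> \<in> A"
    then have "P y (circ \<theta>) \<in> path_image \<gamma>" using Z(2) by (auto simp: A_def)
    then obtain t where t: "t \<in> {0..1}" "P y (circ \<theta>) = \<gamma> t" by (auto simp: path_image_def)
    have sg: "sgn (y - \<gamma> t) = circ \<theta>" using sgn_entry[OF y, of "circ \<theta>"] t by simp
    have "\<alpha> t = angle (circ (\<alpha> t))" using angle_range by (simp add: angle_circ \<alpha>_def)
    also have "\<dots> = \<theta>" using \<theta> by (simp add: circ_\<alpha>[OF t(1)] sg angle_circ A_def)
    finally have "\<alpha> t = \<theta>" .
    moreover have "t \<in> S'"
    proof -
      have "circ \<theta> \<noteq> circ 0" using \<theta> inj_onD[OF inj_on_circ, of \<theta> 0] by (auto simp: A_def)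
      then show ?thesis using \<theta> t sg by (auto simp: S'_def S_def A_def)
    qed
    ultimately show "\<theta> \<in> \<alpha> ` S'" by blast
  qed
  have S'_leb: "S' \<in> sets lebesgue" using S' by simp
  have "(\<alpha> has_field_derivative cross2 (y - \<gamma> t) (- vector_derivative \<gamma> (at t)) / (norm (y - \<gamma> t))\<^sup>2) (at t within S')"
    if t: "t \<in> S'" for t
    unfolding \<alpha>_def
  proof (rule has_derivative_angle[OF _ t])
    have "t \<in> {0..1}" using t by (auto simp: S'_def S_def)
    from has_vector_derivative_diff[OF has_vector_derivative_const der[OF this], of y]
    show "((\<lambda>s. y - \<gamma> s) has_vector_derivative - vector_derivative \<gamma> (at t)) (at t within S')"
      by (auto intro: has_vector_derivative_at_within)
    show "\<And>s. s \<in> S' \<Longrightarrow> 0 < angle (y - \<gamma> s)" using pos by (simp add: \<alpha>_def)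
  qed
  \<comment> \<open>The last argument is the expected value of the integral, so that absolute
    integrability and the value are transferred from \<open>A\<close> to \<open>S'\<close>
    together.\<close>
  note cov = has_absolute_integral_change_of_variables_1'[OF S'_leb this inj_\<alpha>, of "\<lambda>\<theta>. F (circ \<theta>)" "integral A (\<lambda>\<theta>. F (circ \<theta>))"]
  have "circ \<in> measurable borel (restrict_space borel S1)"
    by (intro measurable_restrict_space2) auto
  from measurable_compose[OF this F(1)] have [measurable]: "(\<lambda>\<theta>. F (circ \<theta>)) \<in> borel_measurable borel" .
  from measurable_compose[OF \<open>circ \<in> measurable borel (restrict_space borel S1)\<close> entry_borel[OF y]]
  have [measurable]: "(\<lambda>\<theta>. P y (circ \<theta>)) \<in> borel_measurable borel" .
  have [measurable]: "A \<in> sets borel"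
  proof -
    have "A = (\<lambda>\<theta>. P y (circ \<theta>)) -` Z \<inter> space borel \<inter> {0<..<2*pi}" by (auto simp: A_def)
    then show ?thesis using measurable_sets[OF \<open>(\<lambda>\<theta>. P y (circ \<theta>)) \<in> borel_measurable borel\<close> Z(1)] by simp
  qed
  have int_A: "set_integrable lborel A (\<lambda>\<theta>. F (circ \<theta>))"
  proof (rule set_integrable_subset)
    show "set_integrable lborel {0..2*pi} (\<lambda>\<theta>. F (circ \<theta>))"
      by (rule set_integrable_bounded_Icc[of _ _ _ C]) (use F(2) in auto)
    show "A \<in> sets lborel" using \<open>A \<in> sets borel\<close> by simp
    show "A \<subseteq> {0..2*pi}" by (auto simp: A_def)
  qed
  then have "(\<lambda>\<theta>. F (circ \<theta>)) absolutely_integrable_on A"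
    unfolding set_integrable_def by (subst integrable_completion) auto
  with cov have *: "(\<lambda>t. \<bar>cross2 (y - \<gamma> t) (- vector_derivative \<gamma> (at t)) / (norm (y - \<gamma> t))\<^sup>2\<bar> * F (circ (\<alpha> t))) absolutely_integrable_on S'"
    "integral S' (\<lambda>t. \<bar>cross2 (y - \<gamma> t) (- vector_derivative \<gamma> (at t)) / (norm (y - \<gamma> t))\<^sup>2\<bar> * F (circ (\<alpha> t)))
      = integral A (\<lambda>\<theta>. F (circ \<theta>))"
    unfolding img by auto
  have eq: "\<bar>cross2 (y - \<gamma> t) (- vector_derivative \<gamma> (at t)) / (norm (y - \<gamma> t))\<^sup>2\<bar> * F (circ (\<alpha> t))
      = w t * F (sgn (y - \<gamma> t))" if "t \<in> S'" for t
  proof -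
    have "cross2 (y - \<gamma> t) (- vector_derivative \<gamma> (at t)) = - cross2 (y - \<gamma> t) (vector_derivative \<gamma> (at t))"
      by (simp add: cross2_def)
    then show ?thesis using that by (simp add: w_def circ_\<alpha> S'_def S_def)
  qed
  have 1: "(\<lambda>t. w t * F (sgn (y - \<gamma> t))) absolutely_integrable_on S'"
    using *(1) eq by (subst set_integrable_cong[OF refl refl]) auto
  then show "(\<lambda>t. w t * F (sgn (y - \<gamma> t))) absolutely_integrable_on S"
    by (rule absolutely_integrable_spike_set) (use diff in \<open>auto simp: S'_def elim: negligible_subset\<close>)
  have "integral S (\<lambda>t. w t * F (sgn (y - \<gamma> t))) = integral S' (\<lambda>t. w t * F (sgn (y - \<gamma> t)))"
    by (rule integral_subset_negligible[symmetric]) (use diff in \<open>auto simp: S'_def\<close>)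
  also have "\<dots> = integral A (\<lambda>\<theta>. F (circ \<theta>))"
    unfolding *(2)[symmetric] by (rule integral_cong) (rule eq[symmetric])
  also have "\<dots> = (LINT \<theta>:A|lborel. F (circ \<theta>))"
    by (rule set_borel_integral_eq_integral(2)[OF int_A, symmetric])
  \<comment> \<open>Returning from the open to the half-open interval only adds the angle 0.\<close>
  also have "\<dots> = (LINT \<theta>:{0..<2*pi}|lborel. indicator Z (P y (circ \<theta>)) * F (circ \<theta>))"
    unfolding set_lebesgue_integral_def
  proof (rule integral_cong_AE)
    have "AE \<theta> in lborel. \<theta> \<noteq> (0::real)"
      by (rule AE_lborel_singleton)
    then show "AE \<theta> in lborel. indicat_real A \<theta> *\<^sub>R F (circ \<theta>)
        = indicat_real {0..<2*pi} \<theta> *\<^sub>R (indicat_real Z (P y (circ \<theta>)) * F (circ \<theta>))"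
      by eventually_elim (auto simp: A_def indicator_def)
  qed (use Z(1) in measurable)
  also have "\<dots> = (LINT \<xi>|circle_measure. indicator Z (P y \<xi>) * F \<xi>)"
  proof (rule integral_circle[symmetric])
    note entry_borel[OF y, measurable] F(1)[measurable] Z(1)[measurable]
    show "(\<lambda>\<xi>. indicat_real Z (P y \<xi>) * F \<xi>) \<in> borel_measurable (restrict_space borel S1)"
      by measurable
  qed
  finally show "(LINT \<xi>|circle_measure. indicator Z (P y \<xi>) * F \<xi>) = integral S (\<lambda>t. w t * F (sgn (y - \<gamma> t)))"
    by simp
qed

end

section \<open>Attenuation and scattering along rays\<close>

text \<open>Both displacements are differences of points of the segment, hence multiples of
  \<open>b - a\<close>. Unit vectors on the same line agree up to sign.\<close>

lemma open_segment_direction: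
  fixes a b u v \<xi> \<zeta> :: "'a::real_inner"
  assumes u: "u \<in> open_segment a b" "u + c *\<^sub>R \<xi> \<in> open_segment a b" "u + d *\<^sub>R \<zeta> \<in> open_segment a b"
    and "c \<noteq> 0" "d \<noteq> 0" "norm \<xi> = 1" "norm \<zeta> = 1"
  shows "\<xi> = \<zeta> \<or> \<xi> = - \<zeta>"
proof -
  obtain \<alpha> where \<alpha>: "c *\<^sub>R \<xi> = \<alpha> *\<^sub>R (b - a)"
  proof -
    obtain s t where "u = (1 - s) *\<^sub>R a + s *\<^sub>R b" "u + c *\<^sub>R \<xi> = (1 - t) *\<^sub>R a + t *\<^sub>R b"
      using u by (auto simp: in_segment)
    then have "c *\<^sub>R \<xi> = (1 - t) *\<^sub>R a + t *\<^sub>R b - ((1 - s) *\<^sub>R a + s *\<^sub>R b)"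
      by (metis add_diff_cancel_left')
    also have "\<dots> = (t - s) *\<^sub>R (b - a)" by (simp add: algebra_simps)
    finally show thesis by (rule that)
  qed
  obtain \<beta> where \<beta>: "d *\<^sub>R \<zeta> = \<beta> *\<^sub>R (b - a)"
  proof -
    obtain s t where "u = (1 - s) *\<^sub>R a + s *\<^sub>R b" "u + d *\<^sub>R \<zeta> = (1 - t) *\<^sub>R a + t *\<^sub>R b"
      using u by (auto simp: in_segment)
    then have "d *\<^sub>R \<zeta> = (1 - t) *\<^sub>R a + t *\<^sub>R b - ((1 - s) *\<^sub>R a + s *\<^sub>R b)"
      by (metis add_diff_cancel_left')
    also have "\<dots> = (t - s) *\<^sub>R (b - a)" by (simp add: algebra_simps)
    finally show thesis by (rule that)
  qed
  have "\<beta> \<noteq> 0" using \<beta> assms by auto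
  have "\<xi> = (1 / c) *\<^sub>R (c *\<^sub>R \<xi>)" using assms by simp
  also have "\<dots> = (\<alpha> / c / \<beta>) *\<^sub>R (\<beta> *\<^sub>R (b - a))" using \<open>\<beta> \<noteq> 0\<close> by (simp add: \<alpha>)
  also have "\<dots> = (\<alpha> / c / \<beta> * d) *\<^sub>R \<zeta>" by (simp flip: \<beta>)
  finally have eq: "\<xi> = (\<alpha> / c / \<beta> * d) *\<^sub>R \<zeta>" .
  define k where "k = \<alpha> / c / \<beta> * d"
  have "norm \<xi> = norm (k *\<^sub>R \<zeta>)" unfolding k_def by (rule arg_cong[OF eq])
  then have "\<bar>k\<bar> = 1" using assms by simp
  then have "k = 1 \<or> k = - 1" by linarith
  then show ?thesis using eq[folded k_def] by auto
qed

lemma disc_C_memI: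
  assumes "j \<in> {1..K}" "\<xi> = \<xi>p j \<or> \<xi> = - \<xi>p j" "y \<in> L j" "0 \<le> t" "t < tau_plus \<Omega> y \<xi>"
  shows "(y + t *\<^sub>R \<xi>, \<xi>) \<in> disc_C \<Omega> K L \<xi>p"
  unfolding disc_C_def
proof (rule UN_I[OF assms(1)], rule UN_I)
  show "\<xi> \<in> {\<xi>p j, - \<xi>p j}" using assms(2) by simp
  show "(y + t *\<^sub>R \<xi>, \<xi>) \<in> {(x + t *\<^sub>R \<xi>, \<xi>) | x t. x \<in> L j \<and> 0 \<le> t \<and> t < tau_plus \<Omega> x \<xi>}"
    by (rule CollectI, rule exI[of _ y], rule exI[of _ t]) (simp add: assms(3-5))
qed

text \<open>Of the decomposition into subdomains only their union is kept, an open subset that is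
  dense in the domain. Order and bounds of the coefficients are stated on the whole plane, so ray
  integrals need no case distinction on where the ray is.\<close>

locale transport_medium = convex_C1_domain +
  fixes \<Omega>0 :: "plane set" and K :: nat and L :: "nat \<Rightarrow> plane set" and \<xi>p :: "nat \<Rightarrow> plane"
    and \<mu>t \<mu>s :: "plane \<Rightarrow> real" and p :: "plane \<times> plane \<times> plane \<Rightarrow> real" and B Bp :: real
  assumes open_medium: "open \<Omega>0" and medium_subset: "\<Omega>0 \<subseteq> \<Omega>" and medium_dense: "\<Omega> \<subseteq> closure \<Omega>0"
    and segments: "interface_segments (frontier \<Omega>0 - frontier \<Omega>) K L"
    and directions: "\<And>j x. j \<in> {1..K} \<Longrightarrow> x \<in> L j \<Longrightarrow> \<exists>t>0. x + t *\<^sub>R \<xi>p j \<in> L j"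
    and unit_directions: "\<And>j. j \<in> {1..K} \<Longrightarrow> norm (\<xi>p j) = 1"
    and mu_le: "\<And>x. \<mu>t x \<le> B" and mu_order: "\<And>x. 0 \<le> \<mu>s x" "\<And>x. \<mu>s x \<le> \<mu>t x"
    and mu_cont: "continuous_on \<Omega>0 \<mu>t" "continuous_on \<Omega>0 \<mu>s"
    and mu_reset: "\<And>x. x \<notin> \<Omega>0 \<Longrightarrow> \<mu>t x = 0"
    and p_le: "\<And>x \<xi> \<xi>'. norm \<xi> = 1 \<Longrightarrow> norm \<xi>' = 1 \<Longrightarrow> p (x, \<xi>, \<xi>') \<le> Bp"
    and p_nonneg: "\<And>x \<xi> \<xi>'. norm \<xi> = 1 \<Longrightarrow> norm \<xi>' = 1 \<Longrightarrow> 0 \<le> p (x, \<xi>, \<xi>')"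
    and p_cont: "continuous_on (\<Omega>0 \<times> S1 \<times> S1) p"
    and p_normalized: "\<And>x \<xi>. x \<in> \<Omega>0 \<Longrightarrow> norm \<xi> = 1 \<Longrightarrow> (LINT \<xi>'|circle_measure. p (x, \<xi>, \<xi>')) = 1"
begin

lemma mu_t_nonneg: "0 \<le> \<mu>t x"
  using mu_order order_trans by blast

lemma mu_s_reset: "x \<notin> \<Omega>0 \<Longrightarrow> \<mu>s x = 0"
  using mu_order[of x] mu_reset[of x] by simp

lemma B_nonneg: "0 \<le> B"
  using mu_t_nonneg mu_le order_trans by blast

lemma medium_borel [measurable]: "\<Omega>0 \<in> sets borel"
  using open_medium by simp

lemma mu_borel [measurable]: "\<mu>t \<in> borel_measurable borel" "\<mu>s \<in> borel_measurable borel"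
proof -
  have *: "f \<in> borel_measurable borel" if "continuous_on \<Omega>0 f" "\<And>x. x \<notin> \<Omega>0 \<Longrightarrow> f x = 0" for f :: "plane \<Rightarrow> real"
  proof -
    have "(\<lambda>x. indicator \<Omega>0 x *\<^sub>R f x) \<in> borel_measurable borel"
      by (rule borel_measurable_continuous_on_indicator[OF medium_borel that(1)])
    also have "(\<lambda>x. indicator \<Omega>0 x *\<^sub>R f x) = f" using that(2) by (auto simp: fun_eq_iff indicator_def)
    finally show ?thesis .
  qed
  show "\<mu>t \<in> borel_measurable borel" "\<mu>s \<in> borel_measurable borel"
    using * mu_cont mu_reset mu_s_reset by blast+
qed

abbreviation "M \<equiv> optical_depth \<mu>t"

lemma optical_depth_borel [measurable]:
  assumes [measurable]: "f \<in> borel_measurable N" "g \<in> borel_measurable N" "h \<in> borel_measurable N"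
  shows "(\<lambda>w. M (f w) (g w) (h w)) \<in> borel_measurable N"
  unfolding optical_depth_def set_lebesgue_integral_def indicator_def atLeastAtMost_iff by measurable

lemma ray_attenuation:
  assumes "0 \<le> T"
  shows "(LINT s:{0..T}|lborel. \<mu>t (x - s *\<^sub>R \<xi>) * exp (- M x \<xi> s)) = 1 - exp (- M x \<xi> T)"
  unfolding optical_depth_def
  by (rule integral_attenuation[where B = B, OF _ _ _ assms]) (auto simp: mu_t_nonneg mu_le)

lemma optical_depth_nonneg: "0 \<le> M x \<xi> s"
  unfolding optical_depth_def set_lebesgue_integral_def
  by (intro Bochner_Integration.integral_nonneg) (auto simp: mu_t_nonneg)

lemma optical_depth_le:
  assumes "0 \<le> s"
  shows "M x \<xi> s \<le> B * s"
proof -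
  have "M x \<xi> s \<le> (LINT r:{0..s}|lborel. B)"
    unfolding optical_depth_def
    by (rule set_integral_mono; (rule set_integrable_bounded_Icc[where C = B])?)
       (auto simp: mu_t_nonneg mu_le B_nonneg abs_le_iff intro: order_trans[OF _ mu_t_nonneg])
  also have "\<dots> = B * s" using assms by (simp add: set_lebesgue_integral_def)
  finally show ?thesis .
qed

text \<open>Beyond the exit time the ray is off the closure of \<open>\<Omega>\<close>, where
  \<open>\<mu>t\<close> vanishes. The upper limit therefore becomes a constant, independent of the
  ray.\<close>

lemma optical_depth_tau:
  assumes "(x, \<xi>) \<in> D"
  shows "M x \<xi> (\<tau> x \<xi>) = M x \<xi> diam"
  unfolding optical_depth_def set_lebesgue_integral_def
proof (rule Bochner_Integration.integral_cong[OF refl])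
  fix r
  show "indicat_real {0..\<tau> x \<xi>} r *\<^sub>R \<mu>t (x - r *\<^sub>R \<xi>) = indicat_real {0..diam} r *\<^sub>R \<mu>t (x - r *\<^sub>R \<xi>)"
  proof (cases "r \<le> \<tau> x \<xi>")
    case True
    then show ?thesis using tau_le_diam[OF assms] by (auto simp: indicator_def)
  next
    case False
    then have "\<mu>t (x - r *\<^sub>R \<xi>) = 0"
      using after_tau[OF assms, of r] medium_subset closure_subset by (intro mu_reset) auto
    then show ?thesis by simp
  qed
qed

text \<open>Two points of \<open>L j\<close> on the ray would force the ray along \<open>L j\<close>, hence
  \<open>(x, \<xi>)\<close> into \<open>disc_C\<close>.\<close>

lemma AE_ray:
  assumes z: "(x, \<xi>) \<in> D" and nC: "(x, \<xi>) \<notin> disc_C \<Omega> K L \<xi>p"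
  shows "AE s in lborel. 0 \<le> s \<longrightarrow> x - s *\<^sub>R \<xi> \<in> \<Omega>0 \<or> x - s *\<^sub>R \<xi> \<notin> closure \<Omega>"
proof -
  have \<xi>: "norm \<xi> = 1" using phase_dom_props[OF z] by simp
  define E where "E = {s. x - s *\<^sub>R \<xi> \<in> frontier \<Omega>0 - frontier \<Omega> - (\<Union>j\<in>{1..K}. L j)}"
  define H where "H = (\<lambda>j. {s. 0 < s \<and> s < \<tau> x \<xi> \<and> x - s *\<^sub>R \<xi> \<in> L j})"
  \<comment> \<open>The last clause of \<open>interface_segments\<close> is used with
    \<open>- \<xi>\<close>, since rays are traversed backwards.\<close>
  have "negligible {t. x + t *\<^sub>R (- \<xi>) \<in> frontier \<Omega>0 - frontier \<Omega> - (\<Union>j\<in>{1..K}. L j)}"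
    using segments \<xi> unfolding interface_segments_def by (metis mem_sphere_0 norm_minus_cancel)
  then have "negligible E" by (simp add: E_def)
  then have "AE s in lebesgue. s \<notin> E" by (intro AE_not_in) (simp add: negligible_iff_null_sets)
  then have E: "AE s in lborel. s \<notin> E" by (simp add: AE_completion_iff)
  have "finite (H j)" if j: "j \<in> {1..K}" for j
  proof -
    have "s = s'" if s: "s \<in> H j" "s' \<in> H j" for s s'
    proof (rule ccontr)
      assume "s \<noteq> s'"
      have "\<forall>j\<in>{1..K}. is_open_line_segment (L j) \<and> L j \<subseteq> frontier \<Omega>0 - frontier \<Omega>"
        using segments unfolding interface_segments_def by (elim conjE)
      from bspec[OF this j] obtain a b where ab: "L j = open_segment a b"
        unfolding is_open_line_segment_def by blast
      have sL: "x - s *\<^sub>R \<xi> \<in> L j" "x - s' *\<^sub>R \<xi> \<in> L j" "0 < s" "s < \<tau> x \<xi>"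
        using s by (auto simp: H_def)
      obtain t where t: "t > 0" "x - s *\<^sub>R \<xi> + t *\<^sub>R \<xi>p j \<in> L j" using directions[OF j sL(1)] by blast
      have shift: "x - s *\<^sub>R \<xi> + (s - s') *\<^sub>R \<xi> = x - s' *\<^sub>R \<xi>" by (simp add: algebra_simps)
      have "\<xi> = \<xi>p j \<or> \<xi> = - \<xi>p j"
      proof (rule open_segment_direction)
        show "x - s *\<^sub>R \<xi> \<in> open_segment a b" "x - s *\<^sub>R \<xi> + t *\<^sub>R \<xi>p j \<in> open_segment a b"
          using sL t by (simp_all add: ab)
        show "x - s *\<^sub>R \<xi> + (s - s') *\<^sub>R \<xi> \<in> open_segment a b"
          unfolding shift using sL by (simp add: ab)
      qed (use t \<open>s \<noteq> s'\<close> \<xi> unit_directions[OF j] in auto)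
      moreover have "x \<in> \<Omega>"
      proof (rule ccontr)
        assume "x \<notin> \<Omega>"
        then have "\<tau> x \<xi> = 0"
          using tau_eqI[OF z, of 0] phase_dom_props[OF z] by (simp add: frontier_iff)
        with sL show False by simp
      qed
      then have "s < tau_plus \<Omega> (x - s *\<^sub>R \<xi>) \<xi>"
        using sL by (intro less_tau_plus_from_ray[OF z]) auto
      ultimately have "(x - s *\<^sub>R \<xi> + s *\<^sub>R \<xi>, \<xi>) \<in> disc_C \<Omega> K L \<xi>p"
        using sL by (intro disc_C_memI[OF j]) auto
      with nC show False by simp
    qed
    then have "\<exists>s0. H j \<subseteq> {s0}" by blast
    then show ?thesis using finite_subset by blast
  qed
  \<comment> \<open>The two end parameters are added because \<open>x\<close> and its entry point
    may lie on the outer boundary.\<close>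
  then have "finite ({0, \<tau> x \<xi>} \<union> (\<Union>j\<in>{1..K}. H j))" by auto
  then have "AE s in lborel. s \<notin> {0, \<tau> x \<xi>} \<union> (\<Union>j\<in>{1..K}. H j)"
    by (intro AE_not_in countable_imp_null_set_lborel countable_finite)
  with E show ?thesis
  proof eventually_elim
    case (elim s)
    show ?case
    proof (intro impI disjCI)
      assume s: "0 \<le> s" "\<not> x - s *\<^sub>R \<xi> \<notin> closure \<Omega>"
      then have "s \<le> \<tau> x \<xi>" using after_tau[OF z, of s] by force
      with elim s have s': "0 < s" "s < \<tau> x \<xi>" by auto
      then have mem: "x - s *\<^sub>R \<xi> \<in> \<Omega>" by (rule before_tau[OF z])
      show "x - s *\<^sub>R \<xi> \<in> \<Omega>0"
      proof (rule ccontr)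
        assume "x - s *\<^sub>R \<xi> \<notin> \<Omega>0"
        with mem medium_dense open_medium have "x - s *\<^sub>R \<xi> \<in> frontier \<Omega>0 - frontier \<Omega>"
          by (auto simp: frontier_def interior_open not_in_frontier open_domain)
        with elim s' show False by (auto simp: E_def H_def)
      qed
    qed
  qed
qed

text \<open>Both alternatives for the limit point are open conditions: inside
  \<open>\<Omega>0\<close> the function is continuous, and off the closure of
  \<open>\<Omega>\<close> it is eventually 0 along the sequence. Only points of the interface or of
  the outer boundary escape, and \<open>AE_ray\<close> makes these negligible.\<close>

lemma ray_tendsto:
  fixes G :: "plane \<times> plane \<Rightarrow> real"
  assumes G: "continuous_on (\<Omega>0 \<times> S1) G" "\<And>y \<xi>. y \<notin> \<Omega>0 \<Longrightarrow> G (y, \<xi>) = 0"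
    and X: "X \<longlonglongrightarrow> x" and \<Xi>: "\<Xi> \<longlonglongrightarrow> \<xi>" "\<And>n. norm (\<Xi> n) = 1"
    and s: "x - s *\<^sub>R \<xi> \<in> \<Omega>0 \<or> x - s *\<^sub>R \<xi> \<notin> closure \<Omega>"
  shows "(\<lambda>n. G (X n - s *\<^sub>R \<Xi> n, \<Xi> n)) \<longlonglongrightarrow> G (x - s *\<^sub>R \<xi>, \<xi>)"
proof -
  have lim: "(\<lambda>n. X n - s *\<^sub>R \<Xi> n) \<longlonglongrightarrow> x - s *\<^sub>R \<xi>" by (intro tendsto_intros X \<Xi>)
  have "(\<lambda>n. norm (\<Xi> n)) \<longlonglongrightarrow> norm \<xi>" by (intro tendsto_intros \<Xi>)
  then have \<xi>: "norm \<xi> = 1" using \<Xi>(2) by (simp add: LIMSEQ_const_iff)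
  from s show ?thesis
  proof
    assume mem: "x - s *\<^sub>R \<xi> \<in> \<Omega>0"
    have ev: "eventually (\<lambda>n. X n - s *\<^sub>R \<Xi> n \<in> \<Omega>0) sequentially"
      by (rule topological_tendstoD[OF lim open_medium mem])
    show ?thesis
    proof (rule continuous_on_tendsto_compose[OF G(1)])
      show "(\<lambda>n. (X n - s *\<^sub>R \<Xi> n, \<Xi> n)) \<longlonglongrightarrow> (x - s *\<^sub>R \<xi>, \<xi>)"
        by (intro tendsto_Pair lim \<Xi>)
      show "\<forall>\<^sub>F n in sequentially. (X n - s *\<^sub>R \<Xi> n, \<Xi> n) \<in> \<Omega>0 \<times> S1"
        using ev by eventually_elim (use \<Xi>(2) in simp)
    qed (use mem \<xi> in simp)
  next
    assume out: "x - s *\<^sub>R \<xi> \<notin> closure \<Omega>"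
    have "eventually (\<lambda>n. X n - s *\<^sub>R \<Xi> n \<in> - closure \<Omega>) sequentially"
      by (rule topological_tendstoD[OF lim]) (use out in auto)
    then have "eventually (\<lambda>n. G (X n - s *\<^sub>R \<Xi> n, \<Xi> n) = 0) sequentially"
      by eventually_elim (use G(2) medium_subset closure_subset in blast)
    moreover have "G (x - s *\<^sub>R \<xi>, \<xi>) = 0"
      using out G(2) medium_subset closure_subset by blast
    ultimately show ?thesis by (simp add: tendsto_eventually)
  qed
qed

lemma optical_depth_tendsto:
  assumes z: "(x, \<xi>) \<in> D" "(x, \<xi>) \<notin> disc_C \<Omega> K L \<xi>p"
    and X: "X \<longlonglongrightarrow> x" and \<Xi>: "\<Xi> \<longlonglongrightarrow> \<xi>" "\<And>n. norm (\<Xi> n) = 1"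
  shows "(\<lambda>n. M (X n) (\<Xi> n) s) \<longlonglongrightarrow> M x \<xi> s"
  unfolding optical_depth_def set_lebesgue_integral_def
proof (rule integral_dominated_convergence)
  show "integrable lborel (\<lambda>r. B * indicator {0..s} r)"
    by (intro integrable_mult_right integrable_real_indicator) (auto simp: emeasure_lborel_Icc_eq)
  have \<mu>: "continuous_on (\<Omega>0 \<times> S1) (\<lambda>w. \<mu>t (fst w))"
    by (rule continuous_on_compose2[OF mu_cont(1)]) (auto intro!: continuous_intros)
  show "AE r in lborel. (\<lambda>n. indicat_real {0..s} r *\<^sub>R \<mu>t (X n - r *\<^sub>R \<Xi> n))
      \<longlonglongrightarrow> indicat_real {0..s} r *\<^sub>R \<mu>t (x - r *\<^sub>R \<xi>)"
    using AE_ray[OF z]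
  proof eventually_elim
    case (elim r)
    show ?case
    proof (cases "0 \<le> r")
      case True
      with elim have "x - r *\<^sub>R \<xi> \<in> \<Omega>0 \<or> x - r *\<^sub>R \<xi> \<notin> closure \<Omega>" by simp
      from ray_tendsto[OF \<mu> _ X \<Xi> this] show ?thesis by (intro tendsto_intros) (simp add: mu_reset)
    qed (simp add: indicator_def)
  qed
  show "\<And>n. AE r in lborel. norm (indicat_real {0..s} r *\<^sub>R \<mu>t (X n - r *\<^sub>R \<Xi> n)) \<le> B * indicat_real {0..s} r"
    by (rule AE_I2) (auto simp: indicator_def mu_t_nonneg mu_le)
qed measurable

text \<open>The fixed upper limit \<open>diam\<close> replaces the exit time. The factor
  \<open>\<mu>s\<close> makes the extra stretch contribute nothing for phase points of
  \<open>D\<close>, and the formula makes sense for every pair of vectors, which helps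
  measurability.\<close>

definition scatter :: "(plane \<times> plane \<Rightarrow> real) \<Rightarrow> plane \<times> plane \<Rightarrow> real" where
  "scatter J = (\<lambda>(x, \<xi>). LINT s:{0..diam}|lborel. \<mu>s (x - s *\<^sub>R \<xi>) * exp (- M x \<xi> s) * J (x - s *\<^sub>R \<xi>, \<xi>))"

lemma scatter_borel [measurable]:
  assumes [measurable]: "J \<in> borel_measurable borel"
  shows "scatter J \<in> borel_measurable borel"
proof -
  have [measurable]: "J \<in> borel_measurable (borel \<Otimes>\<^sub>M borel)" using assms by (simp add: borel_prod)
  show ?thesis
    unfolding scatter_def set_lebesgue_integral_def indicator_def atLeastAtMost_iff borel_prod[symmetric] by measurable
qed

text \<open>The first bound keeps the attenuation factor, so that it integrates to
  \<open>1 - exp (- M)\<close> and yields the contraction constant. The second is a constant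
  majorant for dominated convergence.\<close>

lemma scatter_integrand_bound:
  assumes "\<bar>J (x - s *\<^sub>R \<xi>, \<xi>)\<bar> \<le> C"
  shows "\<bar>\<mu>s (x - s *\<^sub>R \<xi>) * exp (- M x \<xi> s) * J (x - s *\<^sub>R \<xi>, \<xi>)\<bar> \<le> \<mu>t (x - s *\<^sub>R \<xi>) * exp (- M x \<xi> s) * C"
    and "\<bar>\<mu>s (x - s *\<^sub>R \<xi>) * exp (- M x \<xi> s) * J (x - s *\<^sub>R \<xi>, \<xi>)\<bar> \<le> B * C"
    and "\<bar>\<mu>t (x - s *\<^sub>R \<xi>) * exp (- M x \<xi> s)\<bar> \<le> B"
proof -
  have C: "0 \<le> C" using assms by simp
  have e: "exp (- M x \<xi> s) \<le> 1" using optical_depth_nonneg by simp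
  have m: "\<bar>\<mu>s (x - s *\<^sub>R \<xi>)\<bar> \<le> \<mu>t (x - s *\<^sub>R \<xi>)" using mu_order by simp
  show "\<bar>\<mu>s (x - s *\<^sub>R \<xi>) * exp (- M x \<xi> s) * J (x - s *\<^sub>R \<xi>, \<xi>)\<bar> \<le> \<mu>t (x - s *\<^sub>R \<xi>) * exp (- M x \<xi> s) * C"
    unfolding abs_mult by (intro mult_mono assms m) (auto simp: mu_t_nonneg)
  also have "\<dots> \<le> B * 1 * C"
    using e C by (intro mult_mono mult_nonneg_nonneg) (auto simp: mu_le B_nonneg mu_t_nonneg)
  finally show "\<bar>\<mu>s (x - s *\<^sub>R \<xi>) * exp (- M x \<xi> s) * J (x - s *\<^sub>R \<xi>, \<xi>)\<bar> \<le> B * C" by simp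
  have "\<mu>t (x - s *\<^sub>R \<xi>) * exp (- M x \<xi> s) \<le> B * 1"
    using e by (intro mult_mono) (auto simp: mu_le B_nonneg mu_t_nonneg)
  then show "\<bar>\<mu>t (x - s *\<^sub>R \<xi>) * exp (- M x \<xi> s)\<bar> \<le> B" by (simp add: mu_t_nonneg)
qed

lemma scatter_integrable:
  assumes J: "J \<in> borel_measurable borel" and bound: "\<And>z. \<bar>J z\<bar> \<le> C"
  shows "set_integrable lborel {0..diam} (\<lambda>s. \<mu>s (x - s *\<^sub>R \<xi>) * exp (- M x \<xi> s) * J (x - s *\<^sub>R \<xi>, \<xi>))"
proof -
  have [measurable]: "J \<in> borel_measurable (borel \<Otimes>\<^sub>M borel)" using J by (simp add: borel_prod)
  show ?thesis
    by (rule set_integrable_bounded_Icc[where C = "B * C"]; (rule scatter_integrand_bound(2))?)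
       (measurable, rule bound)
qed

text \<open>No ray of length \<open>diam\<close> has optical depth above \<open>B * diam\<close>;
  \<open>q\<close> is the largest value of \<open>1 - exp (- M)\<close> that this bound
  permits.\<close>

definition q :: real where
  "q = 1 - exp (- (B * diam))"

lemma q_range: "0 \<le> q" "q < 1"
  using B_nonneg diam_nonneg by (auto simp: q_def)

lemma scatter_bound:
  assumes J: "J \<in> borel_measurable borel" and bound: "\<And>z. \<bar>J z\<bar> \<le> C"
  shows "\<bar>scatter J z\<bar> \<le> q * C"
proof -
  obtain x \<xi> where z: "z = (x, \<xi>)" by force
  have C: "0 \<le> C" using bound[of z] by linarith
  have "norm (scatter J z) \<le> (LINT s:{0..diam}|lborel. (\<mu>t (x - s *\<^sub>R \<xi>) * exp (- M x \<xi> s)) * C)"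
    unfolding scatter_def z prod.case set_lebesgue_integral_def
  proof (rule Bochner_Integration.integral_norm_bound_integral)
    show "integrable lborel (\<lambda>s. indicat_real {0..diam} s *\<^sub>R (\<mu>s (x - s *\<^sub>R \<xi>) * exp (- M x \<xi> s) * J (x - s *\<^sub>R \<xi>, \<xi>)))"
      using scatter_integrable[OF assms] by (simp add: set_integrable_def)
    have "set_integrable lborel {0..diam} (\<lambda>s. (\<mu>t (x - s *\<^sub>R \<xi>) * exp (- M x \<xi> s)) * C)"
      by (rule set_integrable_mult_left, rule set_integrable_bounded_Icc[where C = B])
         (use scatter_integrand_bound(3)[of "\<lambda>_. 0" x _ \<xi> 0] in auto)
    then show "integrable lborel (\<lambda>s. indicat_real {0..diam} s *\<^sub>R (\<mu>t (x - s *\<^sub>R \<xi>) * exp (- M x \<xi> s) * C))"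
      by (simp add: set_integrable_def)
    fix s
    show "norm (indicat_real {0..diam} s *\<^sub>R (\<mu>s (x - s *\<^sub>R \<xi>) * exp (- M x \<xi> s) * J (x - s *\<^sub>R \<xi>, \<xi>)))
        \<le> indicat_real {0..diam} s *\<^sub>R (\<mu>t (x - s *\<^sub>R \<xi>) * exp (- M x \<xi> s) * C)"
      using scatter_integrand_bound(1)[OF bound] by (auto simp: indicator_def)
  qed
  also have "\<dots> = (1 - exp (- M x \<xi> diam)) * C"
    by (simp add: ray_attenuation diam_nonneg)
  also have "\<dots> \<le> q * C"
    using optical_depth_le[OF diam_nonneg] C by (intro mult_right_mono) (auto simp: q_def)
  finally show ?thesis by simp
qed

lemma scatter_diff:
  assumes "J \<in> borel_measurable borel" "\<And>z. \<bar>J z\<bar> \<le> C" "J' \<in> borel_measurable borel" "\<And>z. \<bar>J' z\<bar> \<le> C'"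
  shows "scatter J z - scatter J' z = scatter (\<lambda>z. J z - J' z) z"
proof -
  obtain x \<xi> where z: "z = (x, \<xi>)" by force
  show ?thesis
    unfolding z scatter_def prod.case
    by (subst set_integral_diff(2)[OF scatter_integrable[OF assms(1,2)] scatter_integrable[OF assms(3,4)], symmetric])
       (simp add: algebra_simps)
qed

lemma scatter_tendsto:
  assumes z: "(x, \<xi>) \<in> D" "(x, \<xi>) \<notin> disc_C \<Omega> K L \<xi>p"
    and X: "X \<longlonglongrightarrow> x" and \<Xi>: "\<Xi> \<longlonglongrightarrow> \<xi>" "\<And>n. norm (\<Xi> n) = 1"
    and J: "J \<in> borel_measurable borel" "\<And>z. \<bar>J z\<bar> \<le> C" "continuous_on (\<Omega>0 \<times> S1) J"
  shows "(\<lambda>n. scatter J (X n, \<Xi> n)) \<longlonglongrightarrow> scatter J (x, \<xi>)"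
  unfolding scatter_def prod.case set_lebesgue_integral_def
proof (rule integral_dominated_convergence)
  have [measurable]: "J \<in> borel_measurable (borel \<Otimes>\<^sub>M borel)" using J by (simp add: borel_prod)
  show "integrable lborel (\<lambda>r. (B * C) * indicator {0..diam} r)"
    by (intro integrable_mult_right integrable_real_indicator) (auto simp: emeasure_lborel_Icc_eq)
  have \<mu>: "continuous_on (\<Omega>0 \<times> S1) (\<lambda>w. \<mu>s (fst w))"
    by (rule continuous_on_compose2[OF mu_cont(2)]) (auto intro!: continuous_intros)
  \<comment> \<open>The product, and not \<open>J\<close> alone, is passed to
    \<open>ray_tendsto\<close>: \<open>J\<close> may be nonzero off \<open>\<Omega>0\<close>,
    whereas \<open>\<mu>s\<close> makes the product vanish there.\<close>
  then have G: "continuous_on (\<Omega>0 \<times> S1) (\<lambda>w. \<mu>s (fst w) * J w)"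
    by (intro continuous_intros J)
  show "AE s in lborel. (\<lambda>n. indicat_real {0..diam} s *\<^sub>R (\<mu>s (X n - s *\<^sub>R \<Xi> n) * exp (- M (X n) (\<Xi> n) s) * J (X n - s *\<^sub>R \<Xi> n, \<Xi> n)))
      \<longlonglongrightarrow> indicat_real {0..diam} s *\<^sub>R (\<mu>s (x - s *\<^sub>R \<xi>) * exp (- M x \<xi> s) * J (x - s *\<^sub>R \<xi>, \<xi>))"
    using AE_ray[OF z]
  proof eventually_elim
    case (elim s)
    show ?case
    proof (cases "0 \<le> s")
      case True
      with elim have "x - s *\<^sub>R \<xi> \<in> \<Omega>0 \<or> x - s *\<^sub>R \<xi> \<notin> closure \<Omega>" by simp
      from ray_tendsto[OF G _ X \<Xi> this]
      have "(\<lambda>n. \<mu>s (X n - s *\<^sub>R \<Xi> n) * J (X n - s *\<^sub>R \<Xi> n, \<Xi> n)) \<longlonglongrightarrow> \<mu>s (x - s *\<^sub>R \<xi>) * J (x - s *\<^sub>R \<xi>, \<xi>)"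
        by (simp add: mu_s_reset)
      then have "(\<lambda>n. indicat_real {0..diam} s *\<^sub>R (exp (- M (X n) (\<Xi> n) s) * (\<mu>s (X n - s *\<^sub>R \<Xi> n) * J (X n - s *\<^sub>R \<Xi> n, \<Xi> n))))
        \<longlonglongrightarrow> indicat_real {0..diam} s *\<^sub>R (exp (- M x \<xi> s) * (\<mu>s (x - s *\<^sub>R \<xi>) * J (x - s *\<^sub>R \<xi>, \<xi>)))"
        by (rule tendsto_scaleR[OF tendsto_const tendsto_mult[OF tendsto_exp[OF tendsto_minus[OF optical_depth_tendsto[OF z X \<Xi>]]]]])
      then show ?thesis by (simp add: mult_ac)
    qed (simp add: indicator_def)
  qed
  show "\<And>n. AE s in lborel. norm (indicat_real {0..diam} s *\<^sub>R (\<mu>s (X n - s *\<^sub>R \<Xi> n) * exp (- M (X n) (\<Xi> n) s) * J (X n - s *\<^sub>R \<Xi> n, \<Xi> n)))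
      \<le> (B * C) * indicat_real {0..diam} s"
    using scatter_integrand_bound(2)[OF J(2)] by (intro AE_I2) (auto simp: indicator_def)
  show "(\<lambda>s. indicat_real {0..diam} s *\<^sub>R (\<mu>s (x - s *\<^sub>R \<xi>) * exp (- M x \<xi> s) * J (x - s *\<^sub>R \<xi>, \<xi>))) \<in> borel_measurable lborel"
    by measurable
  show "(\<lambda>s. indicat_real {0..diam} s *\<^sub>R (\<mu>s (X n - s *\<^sub>R \<Xi> n) * exp (- M (X n) (\<Xi> n) s) * J (X n - s *\<^sub>R \<Xi> n, \<Xi> n))) \<in> borel_measurable lborel" for n
    by measurable
qed

end

section \<open>Averaging over directions\<close>

context transport_medium
begin

text \<open>The cutoff to 0 makes the average a Borel function on the whole space although
  \<open>F\<close> is only controlled on \<open>D\<close> and \<open>p\<close> only on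
  \<open>\<Omega>0 \<times> S1 \<times> S1\<close>. It does not affect ray integrals, where
  \<open>\<mu>s\<close> vanishes off \<open>\<Omega>0\<close>.\<close>

definition gain :: "(plane \<times> plane \<Rightarrow> real) \<Rightarrow> plane \<times> plane \<Rightarrow> real" where
  "gain F = (\<lambda>(y, \<xi>). if y \<in> \<Omega>0 \<and> norm \<xi> = 1
     then (LINT \<xi>'|circle_measure. p (y, \<xi>, \<xi>') * F (y, \<xi>')) else 0)"

lemma gain_outside: "\<not> (fst z \<in> \<Omega>0 \<and> norm (snd z) = 1) \<Longrightarrow> gain F z = 0"
  unfolding gain_def case_prod_beta by (simp only: if_False)

lemma medium_phase_dom: "y \<in> \<Omega>0 \<Longrightarrow> norm \<xi> = 1 \<Longrightarrow> (y, \<xi>) \<in> D"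
  using medium_subset phase_dom_interior by blast

lemma section_borel:
  assumes "F \<in> borel_measurable (restrict_space borel D)" "y \<in> \<Omega>"
  shows "(\<lambda>\<xi>'. F (y, \<xi>')) \<in> borel_measurable (restrict_space borel S1)"
proof (rule measurable_compose[OF _ assms(1)])
  have "(\<lambda>\<xi>'. (y, \<xi>')) \<in> borel_measurable (restrict_space borel S1)"
    by (rule borel_measurable_continuous_on_restrict) (intro continuous_intros)
  then show "Pair y \<in> measurable (restrict_space borel S1) (restrict_space borel D)"
    using assms(2) by (intro measurable_restrict_space2) (auto simp: space_restrict_space phase_dom_interior)
qed

lemma kernel_section_borel:
  assumes "y \<in> \<Omega>0" "norm \<xi> = 1"
  shows "(\<lambda>\<xi>'. p (y, \<xi>, \<xi>')) \<in> borel_measurable (restrict_space borel S1)"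
proof (rule borel_measurable_continuous_on_restrict)
  have "continuous_on S1 (\<lambda>\<xi>'. (y, \<xi>, \<xi>'))" by (intro continuous_intros)
  then show "continuous_on S1 (\<lambda>\<xi>'. p (y, \<xi>, \<xi>'))"
    by (rule continuous_on_compose2[OF p_cont]) (use assms in auto)
qed

lemma kernel_bound: "norm \<xi> = 1 \<Longrightarrow> norm \<xi>' = 1 \<Longrightarrow> \<bar>p (x, \<xi>, \<xi>')\<bar> \<le> Bp"
  using p_nonneg p_le by (simp add: abs_le_iff order_trans[OF _ p_nonneg])

lemma Bp_nonneg: "0 \<le> Bp"
  using p_nonneg[of "circ 0" "circ 0" undefined] p_le[of "circ 0" "circ 0" undefined] by simp

lemma integrable_circleI:
  fixes f :: "plane \<Rightarrow> real"
  assumes "f \<in> borel_measurable (restrict_space borel S1)" "\<And>\<xi>. norm \<xi> = 1 \<Longrightarrow> \<bar>f \<xi>\<bar> \<le> C"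
  shows "integrable circle_measure f"
proof (rule finite_measure.integrable_const_bound[OF finite_measure_circle])
  show "AE \<xi> in circle_measure. norm (f \<xi>) \<le> C" by (rule AE_I2) (use assms(2) in auto)
  show "f \<in> borel_measurable circle_measure"
    using assms(1) by (simp add: measurable_cong_sets[OF sets_circle refl])
qed

lemma gain_integrable:
  assumes F: "F \<in> borel_measurable (restrict_space borel D)" "\<And>\<xi>'. norm \<xi>' = 1 \<Longrightarrow> \<bar>F (y, \<xi>')\<bar> \<le> C"
    and y: "y \<in> \<Omega>0" "norm \<xi> = 1"
  shows "integrable circle_measure (\<lambda>\<xi>'. p (y, \<xi>, \<xi>') * F (y, \<xi>'))"
proof (rule integrable_circleI)
  show "(\<lambda>\<xi>'. p (y, \<xi>, \<xi>') * F (y, \<xi>')) \<in> borel_measurable (restrict_space borel S1)"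
    using y medium_subset by (intro borel_measurable_times kernel_section_borel section_borel F) auto
  show "\<bar>p (y, \<xi>, \<xi>') * F (y, \<xi>')\<bar> \<le> Bp * C" if "norm \<xi>' = 1" for \<xi>'
    unfolding abs_mult using kernel_bound[OF y(2) that] F(2)[OF that] Bp_nonneg
    by (intro mult_mono) auto
qed

text \<open>On \<open>\<Omega>0 \<times> S1\<close> the kernel is a probability density in the
  incoming direction, so averaging cannot increase a bound. Thus the whole contraction factor comes
  from \<open>scatter\<close>.\<close>

lemma gain_bound:
  assumes F: "F \<in> borel_measurable (restrict_space borel D)"
    "\<And>y \<xi>'. y \<in> \<Omega>0 \<Longrightarrow> norm \<xi>' = 1 \<Longrightarrow> \<bar>F (y, \<xi>')\<bar> \<le> C" and "0 \<le> C"
  shows "\<bar>gain F z\<bar> \<le> C"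
proof -
  obtain y \<xi> where z: "z = (y, \<xi>)" by force
  show ?thesis
  proof (cases "y \<in> \<Omega>0 \<and> norm \<xi> = 1")
    case True
    have "norm (LINT \<xi>'|circle_measure. p (y, \<xi>, \<xi>') * F (y, \<xi>')) \<le> (LINT \<xi>'|circle_measure. p (y, \<xi>, \<xi>') * C)"
    proof (rule Bochner_Integration.integral_norm_bound_integral)
      show "integrable circle_measure (\<lambda>\<xi>'. p (y, \<xi>, \<xi>') * F (y, \<xi>'))"
        by (rule gain_integrable[where C = C]) (use True F in auto)
      show "integrable circle_measure (\<lambda>\<xi>'. p (y, \<xi>, \<xi>') * C)"
        by (rule integrable_mult_left, rule integrable_circleI[where C = Bp])
           (use True in \<open>auto intro: kernel_section_borel kernel_bound\<close>)
      fix \<xi>' assume "\<xi>' \<in> space circle_measure"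
      then have "norm \<xi>' = 1" by simp
      then show "norm (p (y, \<xi>, \<xi>') * F (y, \<xi>')) \<le> p (y, \<xi>, \<xi>') * C"
        using True F(2)[of y \<xi>'] p_nonneg[of \<xi> \<xi>' y] by (simp add: abs_mult mult_left_mono)
    qed
    also have "\<dots> = C" using True by (simp add: p_normalized)
    finally show ?thesis using True by (simp add: gain_def z)
  next
    case False
    then have "gain F z = 0" by (intro gain_outside) (simp add: z)
    then show ?thesis using \<open>0 \<le> C\<close> by simp
  qed
qed

text \<open>Both factors are extended by 0 to Borel functions on the full product spaces, where
  measurability of parameter integrals over a finite measure applies.\<close>

lemma gain_borel:
  assumes F: "F \<in> borel_measurable (restrict_space borel D)"
  shows "gain F \<in> borel_measurable borel"
proof -
  interpret C: finite_measure circle_measure by (rule finite_measure_circle)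
  define F' where "F' = (\<lambda>z. indicator D z *\<^sub>R F z)"
  define p' where "p' = (\<lambda>w. indicator (\<Omega>0 \<times> S1 \<times> S1) w *\<^sub>R p w)"
  have S1: "S1 \<in> sets borel" by simp
  have [measurable]: "F' \<in> borel_measurable (borel \<Otimes>\<^sub>M borel)"
    using F unfolding F'_def borel_prod by (subst (asm) borel_measurable_restrict_space_iff) auto
  have "\<Omega>0 \<times> S1 \<times> S1 \<in> sets (borel \<Otimes>\<^sub>M (borel \<Otimes>\<^sub>M borel))"
    using S1 by (intro pair_measureI medium_borel) auto
  then have "\<Omega>0 \<times> S1 \<times> S1 \<in> sets borel" unfolding borel_prod .
  then have "p' \<in> borel_measurable borel"
    unfolding p'_def by (intro borel_measurable_continuous_on_indicator p_cont)
  then have [measurable]: "p' \<in> borel_measurable (borel \<Otimes>\<^sub>M (borel \<Otimes>\<^sub>M borel))"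
    by (simp add: borel_prod)
  have [measurable]: "snd \<in> measurable (((borel :: plane measure) \<Otimes>\<^sub>M (borel :: plane measure)) \<Otimes>\<^sub>M circle_measure) borel"
  proof -
    have "(\<lambda>x. x) \<in> measurable circle_measure (borel :: plane measure)"
      by (simp add: measurable_cong_sets[OF sets_circle refl] measurable_restrict_space1)
    then show ?thesis by (rule measurable_compose[OF measurable_snd])
  qed
  have "(\<lambda>z. LINT \<xi>'|circle_measure. p' (fst z, snd z, \<xi>') * F' (fst z, \<xi>')) \<in> borel_measurable (borel \<Otimes>\<^sub>M borel)"
    by (rule C.borel_measurable_lebesgue_integral) measurable
  moreover have "gain F z = (LINT \<xi>'|circle_measure. p' (fst z, snd z, \<xi>') * F' (fst z, \<xi>'))" for z
  proof (cases "fst z \<in> \<Omega>0 \<and> norm (snd z) = 1")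
    case True
    then have "gain F z = (LINT \<xi>'|circle_measure. p (fst z, snd z, \<xi>') * F (fst z, \<xi>'))"
      by (simp add: gain_def case_prod_beta)
    also have "\<dots> = (LINT \<xi>'|circle_measure. p' (fst z, snd z, \<xi>') * F' (fst z, \<xi>'))"
      using True medium_phase_dom
      by (intro Bochner_Integration.integral_cong refl) (auto simp: p'_def F'_def indicator_def)
    finally show ?thesis .
  next
    case False
    then have "p' (fst z, snd z, \<xi>') = 0" for \<xi>' by (auto simp: p'_def indicator_def)
    with gain_outside[OF False] show ?thesis by simp
  qed
  then have "gain F = (\<lambda>z. LINT \<xi>'|circle_measure. p' (fst z, snd z, \<xi>') * F' (fst z, \<xi>'))"
    by (rule ext)
  ultimately show ?thesis by (simp only: borel_prod)
qed

lemma
  assumes F: "F \<in> borel_measurable (restrict_space borel D)" "\<And>y \<xi>'. y \<in> \<Omega>0 \<Longrightarrow> norm \<xi>' = 1 \<Longrightarrow> \<bar>F (y, \<xi>')\<bar> \<le> C"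
    and G: "G \<in> borel_measurable (restrict_space borel D)" "\<And>y \<xi>'. y \<in> \<Omega>0 \<Longrightarrow> norm \<xi>' = 1 \<Longrightarrow> \<bar>G (y, \<xi>')\<bar> \<le> C'"
  shows gain_diff: "gain F z - gain G z = gain (\<lambda>z. F z - G z) z"
    and gain_add: "gain (\<lambda>z. F z + G z) z = gain F z + gain G z"
proof -
  obtain y \<xi> where z: "z = (y, \<xi>)" by force
  have "gain F z - gain G z = gain (\<lambda>z. F z - G z) z \<and> gain (\<lambda>z. F z + G z) z = gain F z + gain G z"
  proof (cases "y \<in> \<Omega>0 \<and> norm \<xi> = 1")
    case True
    then have "integrable circle_measure (\<lambda>\<xi>'. p (y, \<xi>, \<xi>') * F (y, \<xi>'))"
      "integrable circle_measure (\<lambda>\<xi>'. p (y, \<xi>, \<xi>') * G (y, \<xi>'))"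
      using gain_integrable[OF F(1), of y C] gain_integrable[OF G(1), of y C'] F(2) G(2) by auto
    with True show ?thesis by (simp add: gain_def z algebra_simps)
  next
    case False
    then have "gain H z = 0" for H by (intro gain_outside) (simp add: z)
    then show ?thesis by simp
  qed
  then show "gain F z - gain G z = gain (\<lambda>z. F z - G z) z" "gain (\<lambda>z. F z + G z) z = gain F z + gain G z"
    by blast+
qed

lemma kernel_tendsto:
  assumes "Y \<longlonglongrightarrow> y" "\<And>n. Y n \<in> \<Omega>0" "y \<in> \<Omega>0" "\<Xi> \<longlonglongrightarrow> \<xi>" "\<And>n. norm (\<Xi> n) = 1" "norm \<xi> = 1"
    "H \<longlonglongrightarrow> \<eta>" "\<And>n. norm (H n) = 1" "norm \<eta> = 1"
  shows "(\<lambda>n. p (Y n, \<Xi> n, H n)) \<longlonglongrightarrow> p (y, \<xi>, \<eta>)"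
proof (rule continuous_on_tendsto_compose[OF p_cont])
  show "(\<lambda>n. (Y n, \<Xi> n, H n)) \<longlonglongrightarrow> (y, \<xi>, \<eta>)" by (intro tendsto_Pair assms)
qed (use assms in auto)

text \<open>The outgoing direction enters only through the continuous kernel. Hence convergence of
  \<open>F\<close> in the space variable, for almost every fixed incoming direction, suffices, and
  the null set may depend on the sequence.\<close>

lemma gain_continuous:
  assumes F: "F \<in> borel_measurable (restrict_space borel D)" "\<And>y \<xi>'. y \<in> \<Omega>0 \<Longrightarrow> norm \<xi>' = 1 \<Longrightarrow> \<bar>F (y, \<xi>')\<bar> \<le> C"
    and lim: "\<And>Y y. (\<And>n. Y n \<in> \<Omega>0) \<Longrightarrow> y \<in> \<Omega>0 \<Longrightarrow> Y \<longlonglongrightarrow> y \<Longrightarrow>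
      AE \<xi>' in circle_measure. (\<lambda>n. F (Y n, \<xi>')) \<longlonglongrightarrow> F (y, \<xi>')"
  shows "continuous_on (\<Omega>0 \<times> S1) (gain F)"
  unfolding continuous_on_sequentially
proof (intro allI ballI impI)
  fix X :: "nat \<Rightarrow> plane \<times> plane" and a assume a: "a \<in> \<Omega>0 \<times> S1" and X: "(\<forall>n. X n \<in> \<Omega>0 \<times> S1) \<and> X \<longlonglongrightarrow> a"
  define Y \<Xi> where "Y = (\<lambda>n. fst (X n))" and "\<Xi> = (\<lambda>n. snd (X n))"
  obtain y \<xi> where ya: "a = (y, \<xi>)" by force
  have Y: "Y \<longlonglongrightarrow> y" "\<And>n. Y n \<in> \<Omega>0" "y \<in> \<Omega>0" and \<Xi>: "\<Xi> \<longlonglongrightarrow> \<xi>" "\<And>n. norm (\<Xi> n) = 1" "norm \<xi> = 1"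
    using a X tendsto_fst[of X a] tendsto_snd[of X a] by (auto simp: Y_def \<Xi>_def ya mem_Times_iff)
  have "(\<lambda>n. LINT \<xi>'|circle_measure. p (Y n, \<Xi> n, \<xi>') * F (Y n, \<xi>')) \<longlonglongrightarrow> (LINT \<xi>'|circle_measure. p (y, \<xi>, \<xi>') * F (y, \<xi>'))"
  proof (rule integral_dominated_convergence)
    show "integrable circle_measure (\<lambda>_. Bp * C)"
      using finite_measure.integrable_const[OF finite_measure_circle] .
    show "AE \<xi>' in circle_measure. (\<lambda>n. p (Y n, \<Xi> n, \<xi>') * F (Y n, \<xi>')) \<longlonglongrightarrow> p (y, \<xi>, \<xi>') * F (y, \<xi>')"
      using lim[OF Y(2,3,1)] AE_space
    proof eventually_elim
      case (elim \<xi>')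
      then show ?case by (intro tendsto_mult kernel_tendsto Y \<Xi> tendsto_const) auto
    qed
    fix n
    show "AE \<xi>' in circle_measure. norm (p (Y n, \<Xi> n, \<xi>') * F (Y n, \<xi>')) \<le> Bp * C"
    proof (rule AE_I2)
      fix \<xi>' assume "\<xi>' \<in> space circle_measure"
      then have "norm \<xi>' = 1" by simp
      with kernel_bound[OF \<Xi>(2) this] F(2)[OF Y(2) this]
      show "norm (p (Y n, \<Xi> n, \<xi>') * F (Y n, \<xi>')) \<le> Bp * C"
        unfolding real_norm_def abs_mult using Bp_nonneg by (intro mult_mono) auto
    qed
    show "(\<lambda>\<xi>'. p (Y n, \<Xi> n, \<xi>') * F (Y n, \<xi>')) \<in> borel_measurable circle_measure"
      using gain_integrable[OF F(1,2) _ \<Xi>(2), OF Y(2) _ Y(2)] by auto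
  next
    show "(\<lambda>\<xi>'. p (y, \<xi>, \<xi>') * F (y, \<xi>')) \<in> borel_measurable circle_measure"
      using gain_integrable[OF F(1,2) _ \<Xi>(3), OF Y(3) _ Y(3)] by auto
  qed
  then show "(gain F \<circ> X) \<longlonglongrightarrow> gain F a"
    using Y \<Xi> by (simp add: gain_def ya comp_def case_prod_beta Y_def \<Xi>_def)
qed

definition exceptional :: "plane set" where
  "exceptional = \<xi>p ` {1..K} \<union> (\<lambda>j. - \<xi>p j) ` {1..K}"

lemma finite_exceptional: "finite exceptional"
  by (simp add: exceptional_def)

lemma not_exceptional: "\<xi> \<notin> exceptional \<Longrightarrow> (x, \<xi>) \<notin> disc_C \<Omega> K L \<xi>p"
  by (auto simp: exceptional_def disc_C_def)

lemma gain_scatter_continuous: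
  assumes J: "J \<in> borel_measurable borel" "\<And>z. \<bar>J z\<bar> \<le> C" "continuous_on (\<Omega>0 \<times> S1) J"
  shows "continuous_on (\<Omega>0 \<times> S1) (gain (scatter J))"
proof (rule gain_continuous)
  show "scatter J \<in> borel_measurable (restrict_space borel D)"
    using J(1) by (intro measurable_restrict_space1 scatter_borel)
  show "\<bar>scatter J (y, \<xi>')\<bar> \<le> q * C" for y \<xi>'
    by (rule scatter_bound[OF J(1,2)])
  fix Y y assume Y: "\<And>n. Y n \<in> \<Omega>0" "y \<in> \<Omega>0" "Y \<longlonglongrightarrow> y"
  show "AE \<xi>' in circle_measure. (\<lambda>n. scatter J (Y n, \<xi>')) \<longlonglongrightarrow> scatter J (y, \<xi>')"
    using AE_circle_not_in_finite[OF finite_exceptional] AE_space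
  proof eventually_elim
    case (elim \<xi>')
    then show ?case
      by (intro scatter_tendsto[OF _ _ Y(3) tendsto_const _ J] medium_phase_dom Y(2) not_exceptional) auto
  qed
qed

end

section \<open>Existence, uniqueness and discontinuities\<close>

lemma abs_cross2_le: "\<bar>cross2 v w\<bar> \<le> 2 * (norm v * norm w)"
proof -
  have "\<bar>v $ 1\<bar> * \<bar>w $ 2\<bar> \<le> norm v * norm w" "\<bar>v $ 2\<bar> * \<bar>w $ 1\<bar> \<le> norm v * norm w"
    by (intro mult_mono component_le_norm_cart; simp)+
  then show ?thesis
    unfolding cross2_def using abs_triangle_ineq4[of "v $ 1 * w $ 2" "v $ 2 * w $ 1"]
    by (simp add: abs_mult)
qed

locale transport_problem = transport_medium +
  fixes I0 :: "plane \<times> plane \<Rightarrow> real" and C0 :: real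
  assumes I0_borel: "I0 \<in> borel_measurable (restrict_space borel (Gamma_minus \<Omega>))"
    and I0_bound: "\<And>z. z \<in> Gamma_minus \<Omega> \<Longrightarrow> \<bar>I0 z\<bar> \<le> C0" and C0_nonneg: "0 \<le> C0"
    and I0_cont: "arc_length_null (frontier \<Omega>)
         {x \<in> frontier \<Omega>. \<not> continuous_on (Gamma_minus_pt \<Omega> x) (\<lambda>\<xi>. I0 (x, \<xi>))}
       \<or> (AE \<xi> in circle_measure. continuous_on (Gamma_minus_dir \<Omega> \<xi>) (\<lambda>x. I0 (x, \<xi>)))"
begin

section \<open>The attenuated boundary data and their directional average\<close>

definition source :: "plane \<times> plane \<Rightarrow> real" where
  "source = (\<lambda>(x, \<xi>). exp (- M x \<xi> diam) * I0 (P x \<xi>, \<xi>))"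

lemma source_borel: "source \<in> borel_measurable (restrict_space borel D)"
proof -
  have "(\<lambda>z. (P (fst z) (snd z), snd z)) \<in> borel_measurable (restrict_space borel D)"
    by (rule borel_measurable_continuous_on_restrict) (intro continuous_intros continuous_on_entry)
  then have "(\<lambda>z. (P (fst z) (snd z), snd z)) \<in> measurable (restrict_space borel D) (restrict_space borel (Gamma_minus \<Omega>))"
    by (intro measurable_restrict_space2) (auto simp: space_restrict_space entry_Gamma_minus)
  from measurable_compose[OF this I0_borel]
  have [measurable]: "(\<lambda>z. I0 (P (fst z) (snd z), snd z)) \<in> borel_measurable (restrict_space borel D)" .
  have [measurable]: "fst \<in> borel_measurable (restrict_space borel D)" "snd \<in> borel_measurable (restrict_space borel D)"
    by (auto intro!: borel_measurable_continuous_on_restrict continuous_intros)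
  show ?thesis unfolding source_def case_prod_beta by measurable
qed

lemma source_bound:
  assumes "z \<in> D"
  shows "\<bar>source z\<bar> \<le> C0"
proof -
  obtain x \<xi> where z: "z = (x, \<xi>)" by force
  have "exp (- M x \<xi> diam) * \<bar>I0 (P x \<xi>, \<xi>)\<bar> \<le> 1 * C0"
    using assms z optical_depth_nonneg I0_bound[OF entry_Gamma_minus] by (intro mult_mono) auto
  then show ?thesis by (simp add: source_def z abs_mult)
qed

lemma source_medium_bound: "y \<in> \<Omega>0 \<Longrightarrow> norm \<xi> = 1 \<Longrightarrow> \<bar>source (y, \<xi>)\<bar> \<le> C0"
  using source_bound medium_phase_dom by blast

text \<open>Convergence of the boundary data at the entry points is left as a hypothesis because it
  has three origins: either of the two continuity conditions, or continuity of \<open>I0\<close> at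
  the entry phase point when the phase point is off \<open>disc_B\<close>.\<close>

lemma source_tendsto:
  assumes z: "(x, \<xi>) \<in> D" "(x, \<xi>) \<notin> disc_C \<Omega> K L \<xi>p"
    and X: "X \<longlonglongrightarrow> x" and \<Xi>: "\<Xi> \<longlonglongrightarrow> \<xi>" "\<And>n. norm (\<Xi> n) = 1"
    and I0: "(\<lambda>n. I0 (P (X n) (\<Xi> n), \<Xi> n)) \<longlonglongrightarrow> I0 (P x \<xi>, \<xi>)"
  shows "(\<lambda>n. source (X n, \<Xi> n)) \<longlonglongrightarrow> source (x, \<xi>)"
  unfolding source_def prod.case
  by (rule tendsto_mult[OF tendsto_exp[OF tendsto_minus[OF optical_depth_tendsto[OF z X \<Xi>]]] I0])

lemma gain_source_continuous_direction:
  assumes "AE \<xi> in circle_measure. continuous_on (Gamma_minus_dir \<Omega> \<xi>) (\<lambda>x. I0 (x, \<xi>))"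
  shows "continuous_on (\<Omega>0 \<times> S1) (gain source)"
proof (rule gain_continuous[OF source_borel source_medium_bound])
  fix Y y assume Y: "\<And>n. Y n \<in> \<Omega>0" "y \<in> \<Omega>0" "Y \<longlonglongrightarrow> y"
  show "AE \<xi> in circle_measure. (\<lambda>n. source (Y n, \<xi>)) \<longlonglongrightarrow> source (y, \<xi>)"
    using AE_circle_not_in_finite[OF finite_exceptional] assms AE_space
  proof eventually_elim
    case (elim \<xi>)
    then have \<xi>: "norm \<xi> = 1" by simp
    have mem: "P v \<xi> \<in> Gamma_minus_dir \<Omega> \<xi>" if "v \<in> \<Omega>0" for v
      using entry_Gamma_minus[OF medium_phase_dom[OF that \<xi>]] by (simp add: Gamma_minus_def Gamma_minus_dir_def)
    have "(\<lambda>n. P (Y n) \<xi>) \<longlonglongrightarrow> P y \<xi>"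
      using Y \<xi> by (intro entry_tendsto medium_phase_dom always_eventually allI tendsto_const)
    then have "(\<lambda>n. I0 (P (Y n) \<xi>, \<xi>)) \<longlonglongrightarrow> I0 (P y \<xi>, \<xi>)"
      by (rule continuous_on_tendsto_compose[OF elim(2)]) (use mem Y in auto)
    then show ?case
      using Y \<xi> elim(1) by (intro source_tendsto medium_phase_dom not_exceptional tendsto_const) auto
  qed
qed auto

text \<open>Substituting the entry point for the direction makes the data at a fixed boundary point
  appear in the integrand, so that continuity of \<open>I0 (x, \<cdot>)\<close> for almost every \<open>x\<close> suffices.\<close>

lemma boundary_arc_integral_tendsto:
  assumes null: "arc_length_null (frontier \<Omega>)
         {x \<in> frontier \<Omega>. \<not> continuous_on (Gamma_minus_pt \<Omega> x) (\<lambda>\<xi>. I0 (x, \<xi>))}"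
    and \<gamma>: "C1_arc \<gamma>" "path_image \<gamma> \<subseteq> frontier \<Omega>"
    and Z: "Z \<in> sets borel" "Z \<subseteq> path_image \<gamma>"
    and Y: "Y \<longlonglongrightarrow> y" "\<And>n. Y n \<in> \<Omega>0" "y \<in> \<Omega>0"
    and \<Xi>: "\<Xi> \<longlonglongrightarrow> \<xi>" "\<And>n. norm (\<Xi> n) = 1" "norm \<xi> = 1"
  shows "(\<lambda>n. LINT \<xi>'|circle_measure. indicator Z (P (Y n) \<xi>') * (p (Y n, \<Xi> n, \<xi>') * source (Y n, \<xi>')))
    \<longlonglongrightarrow> (LINT \<xi>'|circle_measure. indicator Z (P y \<xi>') * (p (y, \<xi>, \<xi>') * source (y, \<xi>')))"
proof -
  define S where "S = {t \<in> {0..1}. \<gamma> t \<in> Z}"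
  define w where "w = (\<lambda>v t. \<bar>cross2 (v - \<gamma> t) (vector_derivative \<gamma> (at t))\<bar> / (norm (v - \<gamma> t))\<^sup>2)"
  define F where "F = (\<lambda>v \<zeta> \<xi>'. p (v, \<zeta>, \<xi>') * source (v, \<xi>'))"
  have fr: "\<gamma> t \<in> frontier \<Omega>" if "t \<in> {0..1}" for t
    using \<gamma>(2) that by (auto simp: path_image_def)
  have \<Omega>: "Y n \<in> \<Omega>" "y \<in> \<Omega>" for n using Y medium_subset by auto
  have F: "F v \<zeta> \<in> borel_measurable (restrict_space borel S1)" "\<bar>F v \<zeta> \<xi>'\<bar> \<le> Bp * C0"
    if "v \<in> \<Omega>0" "norm \<zeta> = 1" "norm \<xi>' = 1" for v \<zeta> \<xi>'
  proof -
    show "F v \<zeta> \<in> borel_measurable (restrict_space borel S1)"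
      unfolding F_def using that medium_subset
      by (intro borel_measurable_times kernel_section_borel section_borel source_borel) auto
    show "\<bar>F v \<zeta> \<xi>'\<bar> \<le> Bp * C0"
      unfolding F_def abs_mult using that Bp_nonneg
      by (intro mult_mono kernel_bound source_medium_bound) auto
  qed
  have subst: "set_integrable lebesgue S (\<lambda>t. w v t * F v \<zeta> (sgn (v - \<gamma> t)))"
    "(LINT \<xi>'|circle_measure. indicator Z (P v \<xi>') * F v \<zeta> \<xi>') = (LINT t:S|lebesgue. w v t * F v \<zeta> (sgn (v - \<gamma> t)))"
    if v: "v \<in> \<Omega>0" "norm \<zeta> = 1" for v \<zeta>
  proof -
    have "v \<in> \<Omega>" using v medium_subset by auto
    note * = angular_substitution[OF this \<gamma> Z F(1)[OF v norm_circ] F(2)[OF v]]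
    show 1: "set_integrable lebesgue S (\<lambda>t. w v t * F v \<zeta> (sgn (v - \<gamma> t)))"
      using *(1) unfolding S_def w_def .
    show "(LINT \<xi>'|circle_measure. indicator Z (P v \<xi>') * F v \<zeta> \<xi>') = (LINT t:S|lebesgue. w v t * F v \<zeta> (sgn (v - \<gamma> t)))"
      unfolding set_lebesgue_integral_eq_integral(2)[OF 1] using *(2) unfolding S_def w_def .
  qed
  \<comment> \<open>The sequence together with its limit is a compact subset of
    \<open>\<Omega>\<close>, so it has positive distance from the frontier. This bounds the Jacobian
    uniformly in \<open>n\<close>.\<close>
  obtain \<delta> where \<delta>: "\<delta> > 0" "\<And>n u. u \<in> frontier \<Omega> \<Longrightarrow> \<delta> \<le> dist (Y n) u"
  proof -
    have "insert y (range Y) \<inter> frontier \<Omega> = {}" using \<Omega> not_in_frontier by auto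
    from separate_compact_closed[OF compact_sequence_with_limit[OF Y(1)] _ this] show thesis
      using that by auto
  qed
  have cont: "continuous_on {0..1} (\<lambda>t. vector_derivative \<gamma> (at t))"
    using \<gamma>(1) by (auto simp: C1_arc_def C1_differentiable_on_eq)
  obtain V where V: "\<And>t. t \<in> {0..1} \<Longrightarrow> norm (vector_derivative \<gamma> (at t)) \<le> V"
  proof -
    have "bounded ((\<lambda>t. vector_derivative \<gamma> (at t)) ` {0..1})"
      by (intro compact_imp_bounded compact_continuous_image cont) auto
    then obtain V where "\<forall>t\<in>{0..1}. norm (vector_derivative \<gamma> (at t)) \<le> V"
      by (auto simp: bounded_iff)
    then show thesis using that by blast
  qed
  have w_bound: "\<bar>w (Y n) t\<bar> \<le> 2 * V / \<delta>" if t: "t \<in> {0..1}" for n t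
  proof -
    have d: "\<delta> \<le> norm (Y n - \<gamma> t)" using \<delta>(2)[OF fr[OF t]] by (simp add: dist_norm)
    with \<delta>(1) have pos: "0 < norm (Y n - \<gamma> t)" by linarith
    have "\<bar>w (Y n) t\<bar> = \<bar>cross2 (Y n - \<gamma> t) (vector_derivative \<gamma> (at t))\<bar> / (norm (Y n - \<gamma> t))\<^sup>2"
      by (simp add: w_def)
    also have "\<dots> \<le> 2 * (norm (Y n - \<gamma> t) * norm (vector_derivative \<gamma> (at t))) / (norm (Y n - \<gamma> t))\<^sup>2"
      by (intro divide_right_mono abs_cross2_le) auto
    also have "\<dots> = 2 * norm (vector_derivative \<gamma> (at t)) / norm (Y n - \<gamma> t)"
      using pos by (simp add: power2_eq_square)
    also have "\<dots> \<le> 2 * V / \<delta>"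
      using V[OF t] d \<delta>(1) order_trans[OF norm_ge_zero V[OF t]] by (intro frac_le) auto
    finally show ?thesis .
  qed
  have "(\<lambda>n. LINT t:S|lebesgue. w (Y n) t * F (Y n) (\<Xi> n) (sgn (Y n - \<gamma> t)))
      \<longlonglongrightarrow> (LINT t:S|lebesgue. w y t * F y \<xi> (sgn (y - \<gamma> t)))"
    unfolding set_lebesgue_integral_def
  proof (rule integral_dominated_convergence)
    have "integrable lborel (\<lambda>t. (2 * V / \<delta> * (Bp * C0)) * indicator {0..1::real} t)"
      by (intro integrable_mult_right integrable_real_indicator) auto
    then show "integrable lebesgue (\<lambda>t. (2 * V / \<delta> * (Bp * C0)) * indicator {0..1::real} t)"
      by (subst integrable_completion) auto
    show "(\<lambda>t. indicat_real S t *\<^sub>R (w y t * F y \<xi> (sgn (y - \<gamma> t)))) \<in> borel_measurable lebesgue"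
      using subst(1)[OF Y(3) \<Xi>(3)] by (auto simp: set_integrable_def)
    show "(\<lambda>t. indicat_real S t *\<^sub>R (w (Y n) t * F (Y n) (\<Xi> n) (sgn (Y n - \<gamma> t)))) \<in> borel_measurable lebesgue" for n
      using subst(1)[OF Y(2) \<Xi>(2)] by (auto simp: set_integrable_def)
    show "AE t in lebesgue. norm (indicat_real S t *\<^sub>R (w (Y n) t * F (Y n) (\<Xi> n) (sgn (Y n - \<gamma> t))))
        \<le> (2 * V / \<delta> * (Bp * C0)) * indicator {0..1::real} t" for n
    proof (rule AE_I2)
      fix t
      show "norm (indicat_real S t *\<^sub>R (w (Y n) t * F (Y n) (\<Xi> n) (sgn (Y n - \<gamma> t))))
        \<le> (2 * V / \<delta> * (Bp * C0)) * indicator {0..1::real} t"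
      proof (cases "t \<in> S")
        case True
        then have t: "t \<in> {0..1}" by (simp add: S_def)
        have "norm (sgn (Y n - \<gamma> t)) = 1"
          using inward_unit_vector(4)[OF \<Omega>(1) fr[OF t]] by (simp add: norm_sgn)
        from F(2)[OF Y(2) \<Xi>(2) this] w_bound[OF t]
        have "\<bar>w (Y n) t\<bar> * \<bar>F (Y n) (\<Xi> n) (sgn (Y n - \<gamma> t))\<bar> \<le> 2 * V / \<delta> * (Bp * C0)"
          using order_trans[OF abs_ge_zero w_bound[OF t]] by (intro mult_mono) auto
        then show ?thesis using True t by (simp add: abs_mult)
      next
        case False
        have "0 \<le> 2 * V / \<delta>" using order_trans[OF abs_ge_zero w_bound[of 0]] by simp
        then have "0 \<le> 2 * V / \<delta> * (Bp * C0)" by (intro mult_nonneg_nonneg Bp_nonneg C0_nonneg)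
        then show ?thesis using False by (simp add: indicator_def)
      qed
    qed
    \<comment> \<open>\<open>N1\<close> collects the boundary points where the angular continuity of
      \<open>I0\<close> fails. \<open>N2\<close> collects those seen from \<open>y\<close> in the
      direction of an interface segment; it is finite because distinct boundary points are seen in
      distinct directions.\<close>
    define N1 where "N1 = {t \<in> {0..1}. \<gamma> t \<in> {x \<in> frontier \<Omega>. \<not> continuous_on (Gamma_minus_pt \<Omega> x) (\<lambda>\<xi>. I0 (x, \<xi>))}}"
    define N2 where "N2 = (\<lambda>t. sgn (y - \<gamma> t)) -` exceptional \<inter> {0..1}"
    have "negligible N1" using null \<gamma> unfolding arc_length_null_def N1_def by blast
    moreover have "finite N2"
      unfolding N2_def
    proof (rule finite_vimage_IntI[OF finite_exceptional])
      have inj: "inj_on \<gamma> {0..1}" using \<gamma>(1) by (auto simp: C1_arc_def arc_def)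
      show "inj_on (\<lambda>t. sgn (y - \<gamma> t)) {0..1}"
      proof (rule inj_onI)
        fix s t assume st: "s \<in> {0..1::real}" "t \<in> {0..1}" "sgn (y - \<gamma> s) = sgn (y - \<gamma> t)"
        have "\<gamma> s = P y (sgn (y - \<gamma> s))" by (rule inward_unit_vector(3)[OF \<Omega>(2) fr[OF st(1)], symmetric])
        also have "\<dots> = \<gamma> t" unfolding st(3) by (rule inward_unit_vector(3)[OF \<Omega>(2) fr[OF st(2)]])
        finally show "s = t" using inj st(1,2) by (auto dest: inj_onD)
      qed
    qed
    ultimately have "negligible (N1 \<union> N2)" by (simp add: negligible_finite)
    then have "AE t in lebesgue. t \<notin> N1 \<union> N2" by (intro AE_not_in) (simp add: negligible_iff_null_sets)
    then show "AE t in lebesgue. (\<lambda>n. indicat_real S t *\<^sub>R (w (Y n) t * F (Y n) (\<Xi> n) (sgn (Y n - \<gamma> t))))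
        \<longlonglongrightarrow> indicat_real S t *\<^sub>R (w y t * F y \<xi> (sgn (y - \<gamma> t)))"
    proof eventually_elim
      case (elim t)
      show ?case
      proof (cases "t \<in> S")
        case True
        then have t: "t \<in> {0..1}" by (simp add: S_def)
        have ne: "y \<noteq> \<gamma> t" by (rule inward_unit_vector(4)[OF \<Omega>(2) fr[OF t]])
        have diff: "(\<lambda>n. Y n - \<gamma> t) \<longlonglongrightarrow> y - \<gamma> t" by (intro tendsto_intros Y)
        have \<eta>: "(\<lambda>n. sgn (Y n - \<gamma> t)) \<longlonglongrightarrow> sgn (y - \<gamma> t)" using ne by (intro tendsto_sgn diff) simp
        have \<eta>1: "norm (sgn (Y n - \<gamma> t)) = 1" "norm (sgn (y - \<gamma> t)) = 1" for n
          using inward_unit_vector(4)[OF \<Omega>(1) fr[OF t]] ne by (auto simp: norm_sgn)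
        have "(\<lambda>n. w (Y n) t) \<longlonglongrightarrow> w y t"
          unfolding w_def cross2_def using ne by (intro tendsto_intros Y tendsto_vec_nth) auto
        moreover have "(\<lambda>n. p (Y n, \<Xi> n, sgn (Y n - \<gamma> t))) \<longlonglongrightarrow> p (y, \<xi>, sgn (y - \<gamma> t))"
          by (intro kernel_tendsto Y \<Xi> \<eta> \<eta>1)
        moreover have "(\<lambda>n. source (Y n, sgn (Y n - \<gamma> t))) \<longlonglongrightarrow> source (y, sgn (y - \<gamma> t))"
        proof (rule source_tendsto[OF _ _ Y(1) \<eta> \<eta>1(1)])
          show "(y, sgn (y - \<gamma> t)) \<in> D" by (intro medium_phase_dom Y \<eta>1)
          show "(y, sgn (y - \<gamma> t)) \<notin> disc_C \<Omega> K L \<xi>p"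
            using elim t by (intro not_exceptional) (auto simp: N2_def)
          \<comment> \<open>For fixed \<open>t\<close> the ray into \<open>Y n\<close> from
            \<open>\<gamma> t\<close> has \<open>\<gamma> t\<close> as its entry point for every
            \<open>n\<close>, so only the direction argument of \<open>I0\<close> varies.\<close>
          have I0: "continuous_on (Gamma_minus_pt \<Omega> (\<gamma> t)) (\<lambda>\<xi>. I0 (\<gamma> t, \<xi>))"
            using elim t fr[OF t] by (auto simp: N1_def)
          have "sgn (v - \<gamma> t) \<in> Gamma_minus_pt \<Omega> (\<gamma> t)" if "v \<in> \<Omega>" for v
            using inward_unit_vector(1)[OF that fr[OF t]] by (simp add: Gamma_minus_def Gamma_minus_pt_def)
          then have "(\<lambda>n. I0 (\<gamma> t, sgn (Y n - \<gamma> t))) \<longlonglongrightarrow> I0 (\<gamma> t, sgn (y - \<gamma> t))"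
            by (intro continuous_on_tendsto_compose[OF I0 \<eta>]) (use \<Omega> in auto)
          then show "(\<lambda>n. I0 (P (Y n) (sgn (Y n - \<gamma> t)), sgn (Y n - \<gamma> t))) \<longlonglongrightarrow> I0 (P y (sgn (y - \<gamma> t)), sgn (y - \<gamma> t))"
            using inward_unit_vector(3)[OF _ fr[OF t]] \<Omega> by simp
        qed
        ultimately show ?thesis unfolding F_def by (intro tendsto_scaleR tendsto_const tendsto_mult)
      qed simp
    qed
  qed
  then show ?thesis
    using subst(2)[OF Y(2) \<Xi>(2)] subst(2)[OF Y(3) \<Xi>(3)] by (simp add: F_def)
qed

text \<open>Every entry point lies on the frontier, where the indicators of the arc pieces sum to 1.
  The average thus splits into finitely many arc integrals, each of which converges.\<close>

lemma gain_source_continuous_point: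
  assumes null: "arc_length_null (frontier \<Omega>)
         {x \<in> frontier \<Omega>. \<not> continuous_on (Gamma_minus_pt \<Omega> x) (\<lambda>\<xi>. I0 (x, \<xi>))}"
  shows "continuous_on (\<Omega>0 \<times> S1) (gain source)"
  unfolding continuous_on_sequentially
proof (intro allI ballI impI)
  fix X :: "nat \<Rightarrow> plane \<times> plane" and a assume a: "a \<in> \<Omega>0 \<times> S1" and X: "(\<forall>n. X n \<in> \<Omega>0 \<times> S1) \<and> X \<longlonglongrightarrow> a"
  define Y \<Xi> where "Y = (\<lambda>n. fst (X n))" and "\<Xi> = (\<lambda>n. snd (X n))"
  obtain y \<xi> where ya: "a = (y, \<xi>)" by force
  have Y: "Y \<longlonglongrightarrow> y" "\<And>n. Y n \<in> \<Omega>0" "y \<in> \<Omega>0" and \<Xi>: "\<Xi> \<longlonglongrightarrow> \<xi>" "\<And>n. norm (\<Xi> n) = 1" "norm \<xi> = 1"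
    using a X tendsto_fst[of X a] tendsto_snd[of X a] by (auto simp: Y_def \<Xi>_def ya mem_Times_iff)
  obtain m :: nat and \<gamma> Z where arcs: "\<And>i. i < m \<Longrightarrow> C1_arc (\<gamma> i)" "\<And>i. i < m \<Longrightarrow> path_image (\<gamma> i) \<subseteq> frontier \<Omega>"
    "\<And>i. i < m \<Longrightarrow> Z i \<in> sets borel" "\<And>i. i < m \<Longrightarrow> Z i \<subseteq> path_image (\<gamma> i)"
    "\<And>w. w \<in> frontier \<Omega> \<Longrightarrow> (\<Sum>i<m. indicator (Z i) w) = (1 :: real)"
    using boundary_partition by blast
  have split: "gain source (v, \<zeta>) = (\<Sum>i<m. LINT \<xi>'|circle_measure. indicator (Z i) (P v \<xi>') * (p (v, \<zeta>, \<xi>') * source (v, \<xi>')))"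
    if v: "v \<in> \<Omega>0" "norm \<zeta> = 1" for v \<zeta>
  proof -
    have v': "v \<in> \<Omega>" using v medium_subset by auto
    have "integrable circle_measure (\<lambda>\<xi>'. indicator (Z i) (P v \<xi>') * (p (v, \<zeta>, \<xi>') * source (v, \<xi>')))" if i: "i < m" for i
    proof (rule integrable_circleI)
      note entry_borel[OF v', measurable] arcs(3)[OF i, measurable] kernel_section_borel[OF v, measurable]
        section_borel[OF source_borel v', measurable]
      show "(\<lambda>\<xi>'. indicat_real (Z i) (P v \<xi>') * (p (v, \<zeta>, \<xi>') * source (v, \<xi>'))) \<in> borel_measurable (restrict_space borel S1)"
        by measurable
      fix \<xi>' :: plane assume \<xi>': "norm \<xi>' = 1"
      have "\<bar>indicat_real (Z i) (P v \<xi>')\<bar> * (\<bar>p (v, \<zeta>, \<xi>')\<bar> * \<bar>source (v, \<xi>')\<bar>) \<le> 1 * (Bp * C0)"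
        using v \<xi>' Bp_nonneg by (intro mult_mono kernel_bound source_medium_bound) (auto simp: indicator_def)
      then show "\<bar>indicat_real (Z i) (P v \<xi>') * (p (v, \<zeta>, \<xi>') * source (v, \<xi>'))\<bar> \<le> Bp * C0"
        by (simp add: abs_mult)
    qed
    then have "(\<Sum>i<m. LINT \<xi>'|circle_measure. indicator (Z i) (P v \<xi>') * (p (v, \<zeta>, \<xi>') * source (v, \<xi>')))
        = (LINT \<xi>'|circle_measure. (\<Sum>i<m. indicator (Z i) (P v \<xi>') * (p (v, \<zeta>, \<xi>') * source (v, \<xi>'))))"
      by (subst Bochner_Integration.integral_sum) auto
    also have "\<dots> = (LINT \<xi>'|circle_measure. p (v, \<zeta>, \<xi>') * source (v, \<xi>'))"
    proof (rule Bochner_Integration.integral_cong[OF refl])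
      fix \<xi>' assume "\<xi>' \<in> space circle_measure"
      then have "P v \<xi>' \<in> frontier \<Omega>" using v by (intro entry_frontier medium_phase_dom) auto
      from arcs(5)[OF this] show "(\<Sum>i<m. indicat_real (Z i) (P v \<xi>') * (p (v, \<zeta>, \<xi>') * source (v, \<xi>'))) = p (v, \<zeta>, \<xi>') * source (v, \<xi>')"
        by (simp flip: sum_distrib_right)
    qed
    finally show ?thesis using v by (simp add: gain_def)
  qed
  have "(\<lambda>n. gain source (Y n, \<Xi> n)) \<longlonglongrightarrow> gain source (y, \<xi>)"
    unfolding split[OF Y(2) \<Xi>(2)] split[OF Y(3) \<Xi>(3)]
  proof (rule tendsto_sum)
    fix i assume "i \<in> {..<m}"
    then have i: "i < m" by simp
    show "(\<lambda>n. LINT \<xi>'|circle_measure. indicator (Z i) (P (Y n) \<xi>') * (p (Y n, \<Xi> n, \<xi>') * source (Y n, \<xi>')))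
      \<longlonglongrightarrow> (LINT \<xi>'|circle_measure. indicator (Z i) (P y \<xi>') * (p (y, \<xi>, \<xi>') * source (y, \<xi>')))"
      by (rule boundary_arc_integral_tendsto[OF null arcs(1-4)[OF i] Y \<Xi>])
  qed
  then show "(gain source \<circ> X) \<longlonglongrightarrow> gain source a"
    by (simp add: ya comp_def Y_def \<Xi>_def)
qed

lemma gain_source_continuous: "continuous_on (\<Omega>0 \<times> S1) (gain source)"
  using I0_cont gain_source_continuous_point gain_source_continuous_direction by blast

text \<open>Where the ray is in \<open>\<Omega>0\<close>, the parameter is at most the exit time and
  the cutoff in \<open>gain\<close> is inactive; elsewhere \<open>\<mu>s\<close> kills both
  integrands. So exit times can be replaced by \<open>diam\<close> throughout the equation.\<close>

lemma transport_solution_iff: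
  "transport_solution \<Omega> \<mu>t \<mu>s p I0 I \<longleftrightarrow> bounded (I ` D) \<and> I \<in> borel_measurable (restrict_space borel D)
     \<and> (\<forall>z\<in>D. I z = source z + scatter (gain I) z)"
proof -
  have "(LINT s:{0..\<tau> x \<xi>}|lborel. \<mu>s (x - s *\<^sub>R \<xi>) * exp (- M x \<xi> s) *
               (LINT \<xi>'|circle_measure. p (x - s *\<^sub>R \<xi>, \<xi>, \<xi>') * I (x - s *\<^sub>R \<xi>, \<xi>')))
      = scatter (gain I) (x, \<xi>)" if z: "(x, \<xi>) \<in> D" for x \<xi>
    unfolding scatter_def prod.case set_lebesgue_integral_def
  proof (rule Bochner_Integration.integral_cong[OF refl])
    fix s
    show "indicat_real {0..\<tau> x \<xi>} s *\<^sub>R (\<mu>s (x - s *\<^sub>R \<xi>) * exp (- M x \<xi> s) *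
           (LINT \<xi>'|circle_measure. p (x - s *\<^sub>R \<xi>, \<xi>, \<xi>') * I (x - s *\<^sub>R \<xi>, \<xi>')))
        = indicat_real {0..diam} s *\<^sub>R (\<mu>s (x - s *\<^sub>R \<xi>) * exp (- M x \<xi> s) * gain I (x - s *\<^sub>R \<xi>, \<xi>))"
    proof (cases "x - s *\<^sub>R \<xi> \<in> \<Omega>0")
      case True
      then have "s \<le> \<tau> x \<xi>"
        using after_tau[OF z, of s] medium_subset closure_subset[of \<Omega>] by force
      then have "indicat_real {0..\<tau> x \<xi>} s = indicat_real {0..diam} s"
        using tau_le_diam[OF z] by (simp add: indicator_def)
      with True show ?thesis using phase_dom_props[OF z] by (simp add: gain_def)
    qed (simp add: mu_s_reset)
  qed
  then show ?thesis
    by (auto simp: transport_solution_def source_def optical_depth_tau split: prod.splits)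
qed

section \<open>The contraction for the in-scattered radiation and its fixed point\<close>

definition step :: "(plane \<times> plane \<Rightarrow> real) \<Rightarrow> plane \<times> plane \<Rightarrow> real" where
  "step J = gain (\<lambda>z. source z + scatter J z)"

text \<open>The solution of \<open>C0 + q * C = C\<close>, hence a radius for which the sup-norm
  ball is mapped into itself by \<open>step\<close>.\<close>

definition C :: real where
  "C = C0 / (1 - q)"

lemma C_props: "0 \<le> C" "C0 + q * C = C"
  using q_range C0_nonneg by (auto simp: C_def field_simps)

lemma total_borel:
  "J \<in> borel_measurable borel \<Longrightarrow> (\<lambda>z. source z + scatter J z) \<in> borel_measurable (restrict_space borel D)"
  by (intro borel_measurable_add source_borel measurable_restrict_space1 scatter_borel)

lemma total_bound:
  assumes "J \<in> borel_measurable borel" "\<And>z. \<bar>J z\<bar> \<le> C" "z \<in> D"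
  shows "\<bar>source z + scatter J z\<bar> \<le> C"
  using source_bound[OF assms(3)] scatter_bound[OF assms(1,2), of z] C_props by linarith

lemma
  assumes J: "J \<in> borel_measurable borel" "\<And>z. \<bar>J z\<bar> \<le> C"
  shows step_borel: "step J \<in> borel_measurable borel"
    and step_bound: "\<bar>step J z\<bar> \<le> C"
    and step_continuous: "continuous_on (\<Omega>0 \<times> S1) J \<Longrightarrow> continuous_on (\<Omega>0 \<times> S1) (step J)"
proof -
  show "step J \<in> borel_measurable borel"
    unfolding step_def by (intro gain_borel total_borel J)
  show "\<bar>step J z\<bar> \<le> C"
    unfolding step_def
    by (intro gain_bound total_borel total_bound J C_props medium_phase_dom)
  assume "continuous_on (\<Omega>0 \<times> S1) J"
  then have "continuous_on (\<Omega>0 \<times> S1) (\<lambda>z. gain source z + gain (scatter J) z)"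
    by (intro continuous_on_add gain_source_continuous gain_scatter_continuous[OF J])
  moreover have "step J = (\<lambda>z. gain source z + gain (scatter J) z)"
    unfolding step_def
    by (rule ext, rule gain_add[OF source_borel source_medium_bound measurable_restrict_space1[OF scatter_borel[OF J(1)]] scatter_bound[OF J]])
  ultimately show "continuous_on (\<Omega>0 \<times> S1) (step J)" by simp
qed

text \<open>The boundary term cancels, and linearity leaves \<open>gain\<close> applied to
  \<open>scatter\<close> of the difference.\<close>

lemma step_contraction:
  assumes J: "J \<in> borel_measurable borel" "\<And>z. \<bar>J z\<bar> \<le> C"
    and J': "J' \<in> borel_measurable borel" "\<And>z. \<bar>J' z\<bar> \<le> C"
    and c: "\<And>z. \<bar>J z - J' z\<bar> \<le> c"
  shows "\<bar>step J z - step J' z\<bar> \<le> q * c"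
proof -
  have 0: "0 \<le> c" using order_trans[OF abs_ge_zero c] by blast
  have borel: "(\<lambda>z. J z - J' z) \<in> borel_measurable borel" using J(1) J'(1) by measurable
  have "step J z - step J' z = gain (\<lambda>z. (source z + scatter J z) - (source z + scatter J' z)) z"
    unfolding step_def
    by (rule gain_diff[OF total_borel[OF J(1)] total_bound[OF J medium_phase_dom]
          total_borel[OF J'(1)] total_bound[OF J' medium_phase_dom]])
  also have "(\<lambda>z. (source z + scatter J z) - (source z + scatter J' z)) = scatter (\<lambda>z. J z - J' z)"
    by (rule ext) (simp add: scatter_diff[OF J J', symmetric])
  also have "\<bar>gain (scatter (\<lambda>z. J z - J' z)) z\<bar> \<le> q * c"
    using q_range 0
    by (intro gain_bound measurable_restrict_space1 scatter_borel borel scatter_bound c) auto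
  finally show ?thesis .
qed

text \<open>Picard iteration from 0. Convergence is geometric and uniform, so the Borel property,
  the bound and continuity on \<open>\<Omega>0 \<times> S1\<close> all pass to the limit.\<close>

lemma fixed_point:
  obtains J where "J \<in> borel_measurable borel" "\<And>z. \<bar>J z\<bar> \<le> C" "continuous_on (\<Omega>0 \<times> S1) J" "step J = J"
proof -
  define J where "J n = (step ^^ n) (\<lambda>_. 0)" for n
  have J_Suc: "J (Suc n) = step (J n)" for n by (simp add: J_def)
  have J: "J n \<in> borel_measurable borel \<and> (\<forall>z. \<bar>J n z\<bar> \<le> C) \<and> continuous_on (\<Omega>0 \<times> S1) (J n)" for n
  proof (induction n)
    case 0
    then show ?case by (simp add: J_def C_props)
  next
    case (Suc n)
    then have "J n \<in> borel_measurable borel" "\<And>z. \<bar>J n z\<bar> \<le> C" "continuous_on (\<Omega>0 \<times> S1) (J n)"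
      by blast+
    then show ?case
      unfolding J_Suc by (intro conjI allI step_borel step_bound step_continuous)
  qed
  have diff: "\<bar>J (Suc n) z - J n z\<bar> \<le> q ^ n * C" for n z
  proof (induction n arbitrary: z)
    case 0
    have "J 0 z = 0" by (simp add: J_def)
    moreover have "\<bar>J (Suc 0) z\<bar> \<le> C" using J[of "Suc 0"] by blast
    ultimately show ?case by simp
  next
    case (Suc n)
    have "\<bar>step (J (Suc n)) z - step (J n) z\<bar> \<le> q * (q ^ n * C)"
      by (rule step_contraction) (use J Suc in auto)
    then show ?case by (simp add: J_Suc mult.assoc)
  qed
  \<comment> \<open>The iterates are the partial sums of their increments because the iteration
    starts at 0; the increments have a geometric majorant.\<close>
  define Jl where "Jl = (\<lambda>z. \<Sum>i. J (Suc i) z - J i z)"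
  have "summable (\<lambda>n. q ^ n * C)" using q_range by (intro summable_mult2 summable_geometric) simp
  then have "uniform_limit UNIV (\<lambda>n z. \<Sum>i<n. J (Suc i) z - J i z) Jl sequentially"
    unfolding Jl_def by (intro Weierstrass_m_test[of _ _ "\<lambda>n. q ^ n * C"]) (use diff in auto)
  moreover have "(\<lambda>n z. \<Sum>i<n. J (Suc i) z - J i z) = J"
    by (intro ext) (subst sum_lessThan_telescope, simp add: J_def)
  ultimately have lim: "uniform_limit UNIV J Jl sequentially" by simp
  have ptw: "(\<lambda>n. J n z) \<longlonglongrightarrow> Jl z" for z by (rule tendsto_uniform_limitI[OF lim]) simp
  show thesis
  proof
    show borel: "Jl \<in> borel_measurable borel"
      by (rule borel_measurable_LIMSEQ_real[OF ptw]) (use J in auto)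
    show bound: "\<bar>Jl z\<bar> \<le> C" for z
      by (rule LIMSEQ_le_const2[OF tendsto_rabs[OF ptw]]) (use J in blast)
    show "continuous_on (\<Omega>0 \<times> S1) Jl"
      by (rule uniform_limit_theorem[OF _ uniform_limit_on_subset[OF lim]]) (use J in auto)
    show "step Jl = Jl"
    proof
      fix z
      \<comment> \<open>Uniform closeness of \<open>J n\<close> to \<open>Jl\<close> is carried
        through \<open>step\<close> by the contraction estimate. The shifted iterates then have both
        \<open>step Jl z\<close> and \<open>Jl z\<close> as limits.\<close>
      have "(\<lambda>n. J (Suc n) z) \<longlonglongrightarrow> step Jl z"
      proof (rule tendstoI)
        fix e :: real assume "e > 0"
        then have "eventually (\<lambda>n. \<forall>z\<in>UNIV. dist (J n z) (Jl z) < e / 2) sequentially"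
          using uniform_limitD[OF lim, of "e / 2"] by simp
        then show "eventually (\<lambda>n. dist (J (Suc n) z) (step Jl z) < e) sequentially"
        proof eventually_elim
          case (elim n)
          have "\<bar>step (J n) z - step Jl z\<bar> \<le> q * (e / 2)"
            by (rule step_contraction) (use J borel bound elim in \<open>auto simp: dist_real_def less_imp_le\<close>)
          also have "\<dots> \<le> 1 * (e / 2)" using q_range \<open>e > 0\<close> by (intro mult_right_mono) auto
          also have "\<dots> < e" using \<open>e > 0\<close> by simp
          finally show ?case by (simp add: J_Suc dist_real_def)
        qed
      qed
      from LIMSEQ_unique[OF this LIMSEQ_Suc[OF ptw]] show "step Jl z = Jl z" .
    qed
  qed
qed

text \<open>Two solutions differ by \<open>scatter\<close> of the average of their difference, so
  any bound on \<open>D\<close> improves by the factor \<open>q\<close>, again on all of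
  \<open>D\<close>. The starting bound is the sum of bounds for the two solutions, which need not be
  \<open>C\<close>.\<close>

lemma solution_unique:
  assumes I: "transport_solution \<Omega> \<mu>t \<mu>s p I0 I" and I': "transport_solution \<Omega> \<mu>t \<mu>s p I0 I'" and "z \<in> D"
  shows "I' z = I z"
proof -
  have "bounded (I ` D)" "bounded (I' ` D)" using I I' unfolding transport_solution_iff by blast+
  then obtain c c' where c: "\<And>z. z \<in> D \<Longrightarrow> \<bar>I z\<bar> \<le> c" and c': "\<And>z. z \<in> D \<Longrightarrow> \<bar>I' z\<bar> \<le> c'"
    unfolding bounded_iff ball_simps real_norm_def by blast
  have borel: "I \<in> borel_measurable (restrict_space borel D)" "I' \<in> borel_measurable (restrict_space borel D)"
    and eq: "\<And>z. z \<in> D \<Longrightarrow> I z = source z + scatter (gain I) z" "\<And>z. z \<in> D \<Longrightarrow> I' z = source z + scatter (gain I') z"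
    using I I' by (auto simp: transport_solution_iff)
  have nonneg: "0 \<le> c" "0 \<le> c'"
    using order_trans[OF abs_ge_zero c[OF \<open>z \<in> D\<close>]] order_trans[OF abs_ge_zero c'[OF \<open>z \<in> D\<close>]] .
  have "\<bar>I z - I' z\<bar> \<le> q ^ n * (c + c')" if "z \<in> D" for n z
    using that
  proof (induction n arbitrary: z)
    case 0
    then show ?case using c[OF 0] c'[OF 0] abs_triangle_ineq4[of "I z" "I' z"] by simp
  next
    case (Suc n)
    have "I z - I' z = scatter (gain I) z - scatter (gain I') z" using eq Suc.prems by simp
    also have "\<dots> = scatter (\<lambda>w. gain I w - gain I' w) z"
      by (rule scatter_diff[OF gain_borel[OF borel(1)] gain_bound[OF borel(1) c[OF medium_phase_dom] nonneg(1)]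
            gain_borel[OF borel(2)] gain_bound[OF borel(2) c'[OF medium_phase_dom] nonneg(2)]])
    also have "(\<lambda>w. gain I w - gain I' w) = gain (\<lambda>w. I w - I' w)"
      by (rule ext, rule gain_diff[OF borel(1) c[OF medium_phase_dom] borel(2) c'[OF medium_phase_dom]])
    also have "\<bar>scatter (gain (\<lambda>w. I w - I' w)) z\<bar> \<le> q * (q ^ n * (c + c'))"
      using borel nonneg q_range
      by (intro scatter_bound gain_borel gain_bound borel_measurable_diff Suc.IH medium_phase_dom) auto
    finally show ?case by (simp add: mult.assoc)
  qed
  then have le: "\<bar>I z - I' z\<bar> \<le> q ^ n * (c + c')" for n using \<open>z \<in> D\<close> by blast
  have "(\<lambda>n. q ^ n * (c + c')) \<longlonglongrightarrow> 0 * (c + c')"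
    using q_range by (intro tendsto_mult LIMSEQ_realpow_zero tendsto_const)
  then have "\<bar>I z - I' z\<bar> \<le> 0 * (c + c')"
    by (rule LIMSEQ_le_const) (use le in auto)
  then show ?thesis by simp
qed

text \<open>The phase point is reached from its entry point at time \<open>\<tau> x \<xi>\<close>,
  which precedes the forward exit. A discontinuity of \<open>I0\<close> at the entry point would
  therefore place it in \<open>disc_B\<close>.\<close>

lemma entry_not_disc:
  assumes "(x, \<xi>) \<in> D" "(x, \<xi>) \<notin> disc_B \<Omega> I0"
  shows "continuous (at (P x \<xi>, \<xi>) within Gamma_minus \<Omega>) I0"
proof (rule ccontr)
  assume "\<not> continuous (at (P x \<xi>, \<xi>) within Gamma_minus \<Omega>) I0"
  then have 1: "(P x \<xi>, \<xi>) \<in> disc (Gamma_minus \<Omega>) I0"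
    using entry_Gamma_minus[OF assms(1)] by (simp add: disc_def)
  \<comment> \<open>The repeated conjunct is the second alternative of
    \<open>less_tau_plus_from_ray\<close> with \<open>t\<close> taken to be the exit time.\<close>
  have "x \<in> \<Omega> \<or> \<tau> x \<xi> = 0 \<and> \<tau> x \<xi> = 0"
    using tau_eqI[OF assms(1), of 0] phase_dom_props[OF assms(1)] by (auto simp: frontier_iff)
  then have 2: "\<tau> x \<xi> < tau_plus \<Omega> (P x \<xi>) \<xi>"
    unfolding entry_pt_def
    by (intro less_tau_plus_from_ray assms tau_nonneg order_refl)
  have "(P x \<xi> + \<tau> x \<xi> *\<^sub>R \<xi>, \<xi>) \<in> disc_B \<Omega> I0"
    unfolding disc_B_def
    by (rule CollectI, rule exI[of _ "P x \<xi>"], rule exI[of _ \<xi>], rule exI[of _ "\<tau> x \<xi>"])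
       (use 1 2 tau_nonneg[OF assms(1)] in simp)
  then show False using assms(2) by (simp add: entry_pt_def)
qed

theorem transport_solution_exists_unique:
  "\<exists>I. transport_solution \<Omega> \<mu>t \<mu>s p I0 I
     \<and> (\<forall>I'. transport_solution \<Omega> \<mu>t \<mu>s p I0 I' \<longrightarrow> (\<forall>z\<in>D. I' z = I z))
     \<and> disc D I \<subseteq> disc_B \<Omega> I0 \<union> disc_C \<Omega> K L \<xi>p"
proof -
  obtain J where J: "J \<in> borel_measurable borel" "\<And>z. \<bar>J z\<bar> \<le> C" "continuous_on (\<Omega>0 \<times> S1) J" and fix_J: "step J = J"
    using fixed_point by blast
  define I where "I = (\<lambda>z. source z + scatter J z)"
  \<comment> \<open>The fixed point equation says that \<open>J\<close> is the average of the
    \<open>I\<close> built from it, so the formula defining \<open>I\<close> is already the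
    transport equation.\<close>
  have "gain I = J" using fix_J by (simp add: step_def I_def)
  then have sol: "transport_solution \<Omega> \<mu>t \<mu>s p I0 I"
    unfolding transport_solution_iff
  proof (intro conjI ballI)
    show "bounded (I ` D)"
      unfolding bounded_iff I_def using total_bound[OF J(1,2)] by (intro exI[of _ C]) simp
  qed (use total_borel[OF J(1)] in \<open>auto simp: I_def\<close>)
  have "continuous (at (x, \<xi>) within D) I"
    if z: "(x, \<xi>) \<in> D" and nB: "(x, \<xi>) \<notin> disc_B \<Omega> I0" and nC: "(x, \<xi>) \<notin> disc_C \<Omega> K L \<xi>p" for x \<xi>
    unfolding continuous_within_sequentially
  proof (intro allI impI)
    fix X :: "nat \<Rightarrow> plane \<times> plane" assume X: "(\<forall>n. X n \<in> D) \<and> X \<longlonglongrightarrow> (x, \<xi>)"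
    define Y \<Xi> where "Y = (\<lambda>n. fst (X n))" and "\<Xi> = (\<lambda>n. snd (X n))"
    have mem: "(Y n, \<Xi> n) \<in> D" for n using X by (simp add: Y_def \<Xi>_def)
    have Y: "Y \<longlonglongrightarrow> x" and \<Xi>: "\<Xi> \<longlonglongrightarrow> \<xi>"
      using X tendsto_fst[of X "(x, \<xi>)"] tendsto_snd[of X "(x, \<xi>)"] by (auto simp: Y_def \<Xi>_def)
    have \<Xi>1: "norm (\<Xi> n) = 1" for n using phase_dom_props[OF mem] by simp
    have "(\<lambda>n. P (Y n) (\<Xi> n)) \<longlonglongrightarrow> P x \<xi>"
      by (rule entry_tendsto[OF z _ Y \<Xi>]) (simp add: mem)
    then have "(\<lambda>n. (P (Y n) (\<Xi> n), \<Xi> n)) \<longlonglongrightarrow> (P x \<xi>, \<xi>)" by (intro tendsto_Pair \<Xi>)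
    then have "(\<lambda>n. I0 (P (Y n) (\<Xi> n), \<Xi> n)) \<longlonglongrightarrow> I0 (P x \<xi>, \<xi>)"
      using entry_not_disc[OF z nB, unfolded continuous_within_sequentially comp_def, rule_format,
          of "\<lambda>n. (P (Y n) (\<Xi> n), \<Xi> n)"] entry_Gamma_minus[OF mem] by simp
    then have "(\<lambda>n. source (Y n, \<Xi> n)) \<longlonglongrightarrow> source (x, \<xi>)"
      by (rule source_tendsto[OF z nC Y \<Xi> \<Xi>1])
    then have "(\<lambda>n. I (Y n, \<Xi> n)) \<longlonglongrightarrow> I (x, \<xi>)"
      unfolding I_def by (intro tendsto_add scatter_tendsto[OF z nC Y \<Xi> \<Xi>1 J])
    then show "(I \<circ> X) \<longlonglongrightarrow> I (x, \<xi>)" by (simp add: comp_def Y_def \<Xi>_def)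
  qed
  then have "disc D I \<subseteq> disc_B \<Omega> I0 \<union> disc_C \<Omega> K L \<xi>p"
    by (auto simp: disc_def)
  then show ?thesis using sol solution_unique by blast
qed

end

theorem theorem3p1:
  fixes \<Omega> \<Omega>0 :: "plane set" and N K :: nat
    and \<Omega>s L :: "nat \<Rightarrow> plane set" and \<xi>p :: "nat \<Rightarrow> plane"
    and \<mu>t \<mu>s :: "plane \<Rightarrow> real"
    and p :: "plane \<times> plane \<times> plane \<Rightarrow> real"
    and I0 :: "plane \<times> plane \<Rightarrow> real"
  assumes Omega: "open \<Omega>" "\<Omega> \<noteq> {}" "bounded \<Omega>" "convex \<Omega>" "C1_boundary \<Omega>"
    and subdomains: "\<And>j. j \<in> {1..N} \<Longrightarrow>
          open (\<Omega>s j) \<and> connected (\<Omega>s j) \<and> \<Omega>s j \<noteq> {} \<and> \<Omega>s j \<subseteq> \<Omega>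
          \<and> piecewise_C1_boundary (\<Omega>s j)"
    and disjoint: "disjoint_family_on \<Omega>s {1..N}"
    and cover: "closure \<Omega> = (\<Union>j\<in>{1..N}. closure (\<Omega>s j))"
    and Omega0: "\<Omega>0 = (\<Union>j\<in>{1..N}. \<Omega>s j)"
    and K: "K \<ge> 1"
    and segments: "interface_segments (frontier \<Omega>0 - frontier \<Omega>) K L"
    and directions: "\<And>j. j \<in> {1..K} \<Longrightarrow>
          \<xi>p j \<in> S1 \<and> (\<forall>x\<in>L j. \<exists>t>0. x + t *\<^sub>R \<xi>p j \<in> L j)"
    and mu_bounded: "bounded (range \<mu>t)" "bounded (range \<mu>s)"
    and mu_order: "\<And>x. x \<in> \<Omega> \<Longrightarrow> 0 \<le> \<mu>s x \<and> \<mu>s x \<le> \<mu>t x"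
    and mu_disc: "disc \<Omega> \<mu>t \<subseteq> frontier \<Omega>0" "disc \<Omega> \<mu>s \<subseteq> frontier \<Omega>0"
    and mu_reset: "\<And>x. x \<notin> \<Omega>0 \<Longrightarrow> \<mu>t x = 0 \<and> \<mu>s x = 0"
    and p_bounded: "bounded (p ` (UNIV \<times> S1 \<times> S1))"
    and p_nonneg: "\<And>x \<xi> \<xi>'. \<xi> \<in> S1 \<Longrightarrow> \<xi>' \<in> S1 \<Longrightarrow> 0 \<le> p (x, \<xi>, \<xi>')"
    and p_cont: "continuous_on (\<Omega>0 \<times> S1 \<times> S1) p"
    and p_reset: "\<And>x \<xi> \<xi>'. x \<notin> \<Omega>0 \<Longrightarrow> \<xi> \<in> S1 \<Longrightarrow> \<xi>' \<in> S1 \<Longrightarrow> p (x, \<xi>, \<xi>') = 0"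
    and p_normalized: "\<And>x \<xi>. x \<in> \<Omega>0 \<Longrightarrow> \<xi> \<in> S1 \<Longrightarrow>
          (LINT \<xi>'|circle_measure. p (x, \<xi>, \<xi>')) = 1"
    and I0_measurable: "I0 \<in> borel_measurable (restrict_space borel (Gamma_minus \<Omega>))"
    and I0_bounded: "bounded (I0 ` Gamma_minus \<Omega>)"
    and I0_cont:
      "arc_length_null (frontier \<Omega>)
         {x \<in> frontier \<Omega>. \<not> continuous_on (Gamma_minus_pt \<Omega> x) (\<lambda>\<xi>. I0 (x, \<xi>))}
       \<or> (AE \<xi> in circle_measure. continuous_on (Gamma_minus_dir \<Omega> \<xi>) (\<lambda>x. I0 (x, \<xi>)))"
  shows "\<exists>I. transport_solution \<Omega> \<mu>t \<mu>s p I0 I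
           \<and> (\<forall>I'. transport_solution \<Omega> \<mu>t \<mu>s p I0 I' \<longrightarrow> (\<forall>z\<in>phase_dom \<Omega>. I' z = I z))
           \<and> disc (phase_dom \<Omega>) I \<subseteq> disc_B \<Omega> I0 \<union> disc_C \<Omega> K L \<xi>p"
proof -
  have \<Omega>0: "open \<Omega>0" "\<Omega>0 \<subseteq> \<Omega>" unfolding Omega0 using subdomains by blast+
  have "\<Omega> \<subseteq> closure \<Omega>" by (rule closure_subset)
  also have "\<dots> \<subseteq> closure \<Omega>0"
    unfolding cover Omega0 by (intro UN_least closure_mono UN_upper)
  finally have dense: "\<Omega> \<subseteq> closure \<Omega>0" .
  \<comment> \<open>An open set contains none of its frontier points, so no discontinuity falls into
    \<open>\<Omega>0\<close>; continuity within the open set \<open>\<Omega>\<close> is continuity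
    in the plane.\<close>
  have cont: "continuous_on \<Omega>0 f" if "disc \<Omega> f \<subseteq> frontier \<Omega>0" for f :: "plane \<Rightarrow> real"
  proof (rule continuous_at_imp_continuous_on, rule ballI)
    fix x assume x: "x \<in> \<Omega>0"
    with \<Omega>0 that have "continuous (at x within \<Omega>) f"
      by (auto simp: disc_def frontier_def interior_open)
    then show "continuous (at x) f"
      using x \<Omega>0(2) Omega(1) by (simp add: at_within_open[of x \<Omega>] subsetD)
  qed
  obtain B where B: "\<And>x. \<bar>\<mu>t x\<bar> \<le> B" using mu_bounded(1) by (auto simp: bounded_iff)
  obtain Bp where Bp: "\<And>w. w \<in> UNIV \<times> S1 \<times> S1 \<Longrightarrow> \<bar>p w\<bar> \<le> Bp"
    using p_bounded unfolding bounded_iff ball_simps real_norm_def by blast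
  obtain C0 where C0: "\<And>z. z \<in> Gamma_minus \<Omega> \<Longrightarrow> \<bar>I0 z\<bar> \<le> C0"
    using I0_bounded unfolding bounded_iff ball_simps real_norm_def by blast
  \<comment> \<open>The order is given on \<open>\<Omega>\<close>; off \<open>\<Omega>0\<close> both
    coefficients are 0, which extends it to the plane.\<close>
  have order: "0 \<le> \<mu>s x" "\<mu>s x \<le> \<mu>t x" for x
    using mu_order[of x] mu_reset[of x] \<Omega>0(2) by (cases "x \<in> \<Omega>0"; auto)+
  \<comment> \<open>The maximum with 0 secures the nonnegativity that is required of the bound on
    the boundary data.\<close>
  interpret transport_problem \<Omega> \<Omega>0 K L \<xi>p \<mu>t \<mu>s p B Bp I0 "max 0 C0"
  proof
    show "p (x, \<xi>, \<xi>') \<le> Bp" if "norm \<xi> = 1" "norm \<xi>' = 1" for x \<xi> \<xi>'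
      using Bp[of "(x, \<xi>, \<xi>')"] that by simp
    show "\<mu>t x \<le> B" for x using B[of x] by simp
    show "\<bar>I0 z\<bar> \<le> max 0 C0" if "z \<in> Gamma_minus \<Omega>" for z using C0[OF that] by simp
  qed (use Omega \<Omega>0 dense segments directions order cont mu_disc mu_reset p_nonneg p_cont p_normalized
      I0_measurable I0_cont in auto)
  show ?thesis by (rule transport_solution_exists_unique)
qed

end
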